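(* Let $\alpha,\lambda,\sigma>0$ and suppose the active-subspace condition holds for $(V,Q,\mathscr{E},\xi)$, with global minimizer $x^*$. Let $\mu_0=\mathrm{Law}(\xi)$ assign strictly positive mass to any neighborhood of $x^*$. Fix a radius $r>0$, and let $B_r(x^* )=\{x\in H:\|x-x^*\|_H<r\}$. Let $X_t$ be a solution, with law $\mu_t$, of $$dX_t=-\lambda\big(X_t-\mathfrak{m}_\alpha(\mu_t)\big)\,dt+\sigma\,\mathsf{D}\big(X_t-\mathfrak{m}_\alpha(\mu_t)\big)\,dW_t^Q,\qquad X_0=\xi,\qquad \mu_t=\mathrm{Law}(X_t).$$ Let $T>0$ be any finite time horizon and assume that the consensus point is uniformly bounded on $[0,T]$ in the sense that, for some constant $B>0$, $$\sup_{t\in[0,T]}\|x^*-\mathfrak{m}_\alpha(\mu_t)\|_H\le B.$$ Then there exists a constant $p>0$ such that for all $t\in[0,T]$, $$\mu_t(B_r(x^* ))\ge\mathbb{E}[\phi_r(X_t)]\ge\mathbb{E}[\phi_r(X_0)]\,e^{-pt}>0.$$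
   Context: $H$ is an infinite-dimensional real separable Hilbert space with inner product $\langle\cdot,\cdot\rangle_H$ and norm $\|\cdot\|_H$. $Q:H\to H$ is a symmetric, positive semi-definite, trace-class operator, and $W^Q$ is an $H$-valued $Q$-Wiener process on a filtered probability space satisfying the usual conditions; $\xi$ is an $\mathcal{F}_0$-measurable $H$-valued random variable with $\mathbb{E}[\|\xi\|_H^2]<\infty$. $\mathscr{E}:H\to\mathbb{R}$ is a continuous objective function. Active-subspace condition for $(V,Q,\mathscr{E},\xi)$: $V\subset H$ is a linear subspace of finite dimension $d<\infty$, $H=V\oplus V^\perp$; the global minimizer $x^*$ of $\mathscr{E}$ lies in $V$; $\mu_0=\mathrm{Law}(\xi)$ is supported on $V$; and there is $\lambda_{\min}>0$ with $\langle v,Qv\rangle_H\ge\lambda_{\min}\|v\|_H^2$ for all $v\in V$. Diffusion operator: $\mathsf{D}(x)=\|x\|_H\,\mathsf{P}_V$ for $x\in H$, where $\mathsf{P}_V$ is the orthogonal projection onto $V$. Consensus point: $\mathfrak{m}_\alpha(\mu)=\dfrac{\int_H x\,e^{-\alpha\mathscr{E}(x)}\,\mu(dx)}{\int_H e^{-\alpha\mathscr{E}(x)}\,\mu(dx)}$ for a probability measure $\mu$ on $H$ with finite second moment. Mollifier: $\phi_r:H\to[0,1]$ is given by $\phi_r(x)=\exp\!\Big(1-\dfrac{r^2}{r^2-\|x-x^*\|_H^2}\Big)$ if $\|x-x^*\|_H<r$, and $\phi_r(x)=0$ otherwise. A solution is a predictable $H$-valued process with almost surely continuous paths, in $L^2(\Omega;C([0,T];H))$,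 satisfying the equation in integral form almost surely for all $t\in[0,T]$. *)

theory Defs
  imports "HOL-Probability.Probability"
begin

section \<open>Operators on a Hilbert space\<close>

text \<open>
  A real separable Hilbert space is a type of sort \<open>{real_inner, banach, polish_space}\<close>.
  Orthonormal bases are indexed by \<open>nat\<close>, so these notions are meant for
  infinite-dimensional spaces only.
\<close>

definition infinite_dimensional :: "'h::real_vector itself \<Rightarrow> bool" where
  "infinite_dimensional _ \<longleftrightarrow> \<not> (\<exists>B :: 'h set. finite B \<and> span B = UNIV)"

definition orthonormal_basis :: "(nat \<Rightarrow> 'h::real_inner) \<Rightarrow> bool" where
  "orthonormal_basis e \<longleftrightarrow>
     (\<forall>i j. e i \<bullet> e j = (if i = j then 1 else 0)) \<and> closure (span (range e)) = UNIV"

definition some_onb :: "nat \<Rightarrow> 'h::real_inner" where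
  "some_onb = (SOME e. orthonormal_basis e)"

text \<open>
  The trace, for positive semi-definite operators only: there it takes values in
  \<open>[0, \<infinity>]\<close> and does not depend on the chosen orthonormal basis.
\<close>

definition psd_trace :: "('h::real_inner \<Rightarrow> 'h) \<Rightarrow> ennreal" where
  "psd_trace A = (\<Sum>k. ennreal (A (some_onb k) \<bullet> some_onb k))"

definition covariance_operator :: "('h::real_inner \<Rightarrow>\<^sub>L 'h) \<Rightarrow> bool" where
  "covariance_operator Q \<longleftrightarrow>
     (\<forall>x y. Q x \<bullet> y = x \<bullet> Q y) \<and> (\<forall>x. 0 \<le> x \<bullet> Q x) \<and> psd_trace (blinfun_apply Q) < \<infinity>"

text \<open>
  \<open>\<parallel>\<Psi> Q\<^sup>1\<^sup>/\<^sup>2\<parallel>\<^sup>2\<close> in the Hilbert-Schmidt norm, written as \<open>Tr (\<Psi> Q \<Psi>\<^sup>*)\<close>.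
\<close>

definition hs_norm_sq :: "('h::real_inner \<Rightarrow>\<^sub>L 'h) \<Rightarrow> ('h \<Rightarrow>\<^sub>L 'h) \<Rightarrow> ennreal" where
  "hs_norm_sq Q \<Psi> = psd_trace (\<lambda>x. \<Psi> (Q (adjoint (blinfun_apply \<Psi>) x)))"

definition orth_proj :: "'h::real_inner set \<Rightarrow> 'h \<Rightarrow>\<^sub>L 'h" where
  "orth_proj V = Blinfun (\<lambda>x. THE v. v \<in> V \<and> x - v \<in> V\<^sup>\<bottom>)"


section \<open>Filtrations and predictability\<close>

text \<open>Filtrations, and processes on \<open>[0, \<infinity>)\<close>, are constrained at nonnegative times only.\<close>

definition usual_filtered_prob_space :: "'a measure \<Rightarrow> (real \<Rightarrow> 'a measure) \<Rightarrow> bool" where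
  "usual_filtered_prob_space M F \<longleftrightarrow>
     prob_space M \<and> complete_measure M \<and>
     (\<forall>t\<ge>0. subalgebra M (F t)) \<and>
     (\<forall>s\<ge>0. \<forall>t\<ge>s. sets (F s) \<subseteq> sets (F t)) \<and>
     (\<forall>t\<ge>0. sets (F t) = (\<Inter>s\<in>{t<..}. sets (F s))) \<and>
     null_sets M \<subseteq> sets (F 0)"

definition predictable_sigma :: "(real \<Rightarrow> 'a measure) \<Rightarrow> real \<Rightarrow> (real \<times> 'a) measure" where
  "predictable_sigma F T = sigma ({0..T} \<times> space (F 0))
     ({{s<..t} \<times> A |s t A. 0 \<le> s \<and> s < t \<and> t \<le> T \<and> A \<in> sets (F s)}
      \<union> {{0} \<times> A |A. A \<in> sets (F 0)})"

definition predictable ::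
  "(real \<Rightarrow> 'a measure) \<Rightarrow> real \<Rightarrow> (real \<Rightarrow> 'a \<Rightarrow> 'b::topological_space) \<Rightarrow> bool" where
  "predictable F T X \<longleftrightarrow> (\<lambda>(t, \<omega>). X t \<omega>) \<in> predictable_sigma F T \<rightarrow>\<^sub>M borel"


section \<open>Q-Wiener processes\<close>

definition centered_gaussian :: "'a measure \<Rightarrow> ('a \<Rightarrow> real) \<Rightarrow> real \<Rightarrow> bool" where
  "centered_gaussian M Z v \<longleftrightarrow> Z \<in> borel_measurable M \<and>
     (if v = 0 then (AE \<omega> in M. Z \<omega> = 0)
      else distributed M lborel Z (\<lambda>x. ennreal (normal_density 0 (sqrt v) x)))"

definition q_wiener_process ::
  "'a measure \<Rightarrow> (real \<Rightarrow> 'a measure) \<Rightarrow> ('h::{real_inner, banach, polish_space} \<Rightarrow>\<^sub>L 'h)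
     \<Rightarrow> (real \<Rightarrow> 'a \<Rightarrow> 'h) \<Rightarrow> bool" where
  "q_wiener_process M F Q W \<longleftrightarrow>
     (\<forall>t\<ge>0. W t \<in> F t \<rightarrow>\<^sub>M borel) \<and>
     (AE \<omega> in M. W 0 \<omega> = 0) \<and>
     (AE \<omega> in M. continuous_on {0..} (\<lambda>t. W t \<omega>)) \<and>
     (\<forall>s\<ge>0. \<forall>t\<ge>s.
        prob_space.indep_set M (sets (F s))
          {(\<lambda>\<omega>. W t \<omega> - W s \<omega>) -` B \<inter> space M |B. B \<in> sets borel} \<and>
        (\<forall>h. centered_gaussian M (\<lambda>\<omega>. (W t \<omega> - W s \<omega>) \<bullet> h) ((t - s) * (Q h \<bullet> h))))"


section \<open>The Ito integral\<close>

text \<open>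
  An elementary process \<open>(n, \<tau>, G)\<close> equals \<open>G j\<close> on \<open>(\<tau> j, \<tau> (j + 1)]\<close> for \<open>j < n\<close>, where
  \<open>0 = \<tau> 0 < \<dots> < \<tau> n = T\<close> and each \<open>G j\<close> takes finitely many operators as values.
\<close>

definition elementary ::
  "(real \<Rightarrow> 'a measure) \<Rightarrow> real \<Rightarrow> nat \<Rightarrow> (nat \<Rightarrow> real)
     \<Rightarrow> (nat \<Rightarrow> 'a \<Rightarrow> ('h::real_normed_vector \<Rightarrow>\<^sub>L 'h)) \<Rightarrow> bool" where
  "elementary F T n \<tau> G \<longleftrightarrow>
     \<tau> 0 = 0 \<and> \<tau> n = T \<and> (\<forall>j<n. \<tau> j < \<tau> (Suc j)) \<and> (\<forall>j<n. simple_function (F (\<tau> j)) (G j))"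

definition elem_process ::
  "nat \<Rightarrow> (nat \<Rightarrow> real) \<Rightarrow> (nat \<Rightarrow> 'a \<Rightarrow> ('h::real_normed_vector \<Rightarrow>\<^sub>L 'h)) \<Rightarrow> real \<Rightarrow> 'a \<Rightarrow> ('h \<Rightarrow>\<^sub>L 'h)"
  where
  "elem_process n \<tau> G s \<omega> = (\<Sum>j<n. indicator {\<tau> j<..\<tau> (Suc j)} s *\<^sub>R G j \<omega>)"

definition elem_integral ::
  "(real \<Rightarrow> 'a \<Rightarrow> 'h) \<Rightarrow> nat \<Rightarrow> (nat \<Rightarrow> real)
     \<Rightarrow> (nat \<Rightarrow> 'a \<Rightarrow> ('h::real_normed_vector \<Rightarrow>\<^sub>L 'h)) \<Rightarrow> real \<Rightarrow> 'a \<Rightarrow> 'h" where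
  "elem_integral W n \<tau> G t \<omega> =
     (\<Sum>j<n. G j \<omega> (W (min t (\<tau> (Suc j))) \<omega> - W (min t (\<tau> j)) \<omega>))"

definition energy ::
  "'a measure \<Rightarrow> ('h::real_inner \<Rightarrow>\<^sub>L 'h) \<Rightarrow> real \<Rightarrow> (real \<Rightarrow> 'a \<Rightarrow> ('h \<Rightarrow>\<^sub>L 'h)) \<Rightarrow> ennreal" where
  "energy M Q T \<Phi> = (\<integral>\<^sup>+\<omega>. (\<integral>\<^sup>+s\<in>{0..T}. hs_norm_sq Q (\<Phi> s \<omega>) \<partial>lborel) \<partial>M)"

text \<open>
  \<open>I t = \<integral>\<^sub>0\<^sup>t \<Phi> s dW s\<close> for \<open>0 \<le> t \<le> T\<close>: \<open>I\<close> is an adapted continuous process and the mean-square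
  limit of integrals of elementary processes converging to \<open>\<Phi>\<close> in the energy norm. By the Ito
  isometry the limit does not depend on the sequence, and \<open>I\<close> is unique up to
  indistinguishability. Predictability of the operator-valued \<open>\<Phi>\<close> is meant strongly, i.e. for
  \<open>\<Phi> h\<close> with \<open>h\<close> fixed, as the space of bounded operators is not separable.
\<close>

definition ito_integral ::
  "'a measure \<Rightarrow> (real \<Rightarrow> 'a measure) \<Rightarrow> ('h::{real_inner, banach, polish_space} \<Rightarrow>\<^sub>L 'h)
     \<Rightarrow> (real \<Rightarrow> 'a \<Rightarrow> 'h) \<Rightarrow> real \<Rightarrow> (real \<Rightarrow> 'a \<Rightarrow> ('h \<Rightarrow>\<^sub>L 'h)) \<Rightarrow> (real \<Rightarrow> 'a \<Rightarrow> 'h) \<Rightarrow> bool" where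
  "ito_integral M F Q W T \<Phi> I \<longleftrightarrow>
     (\<forall>h. predictable F T (\<lambda>t \<omega>. \<Phi> t \<omega> h)) \<and> energy M Q T \<Phi> < \<infinity> \<and>
     (\<forall>t\<in>{0..T}. I t \<in> F t \<rightarrow>\<^sub>M borel) \<and> (AE \<omega> in M. continuous_on {0..T} (\<lambda>t. I t \<omega>)) \<and>
     (\<exists>N \<tau> G.
        (\<forall>i. elementary F T (N i) (\<tau> i) (G i)) \<and>
        ((\<lambda>i. energy M Q T (\<lambda>s \<omega>. \<Phi> s \<omega> - elem_process (N i) (\<tau> i) (G i) s \<omega>))
           \<longlonglongrightarrow> 0) \<and>
        (\<forall>t\<in>{0..T}.
           (\<lambda>i. \<integral>\<^sup>+\<omega>. ennreal ((norm (I t \<omega> - elem_integral W (N i) (\<tau> i) (G i) t \<omega>))\<^sup>2) \<partial>M)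
             \<longlonglongrightarrow> 0))"


section \<open>Consensus-based optimization\<close>

definition active_subspace ::
  "'a measure \<Rightarrow> 'h::{real_inner, banach, polish_space} set \<Rightarrow> ('h \<Rightarrow>\<^sub>L 'h)
     \<Rightarrow> ('h \<Rightarrow> real) \<Rightarrow> ('a \<Rightarrow> 'h) \<Rightarrow> 'h \<Rightarrow> bool" where
  "active_subspace M V Q \<E> \<xi> xstar \<longleftrightarrow>
     subspace V \<and> (\<exists>B. finite B \<and> V = span B) \<and>
     (\<forall>x. \<exists>!(v, w). v \<in> V \<and> w \<in> V\<^sup>\<bottom> \<and> x = v + w) \<and>
     (\<forall>x. \<E> xstar \<le> \<E> x) \<and> xstar \<in> V \<and>
     (AE x in distr M borel \<xi>. x \<in> V) \<and>
     (\<exists>lmin>0. \<forall>v\<in>V. v \<bullet> Q v \<ge> lmin * (norm v)\<^sup>2)"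

definition diffusion_op :: "'h::real_inner set \<Rightarrow> 'h \<Rightarrow> 'h \<Rightarrow>\<^sub>L 'h" where
  "diffusion_op V x = norm x *\<^sub>R orth_proj V"

definition consensus_point ::
  "('h::{real_inner, banach, polish_space} \<Rightarrow> real) \<Rightarrow> real \<Rightarrow> 'h measure \<Rightarrow> 'h" where
  "consensus_point \<E> \<alpha> \<mu> =
     (\<integral>x. exp (- \<alpha> * \<E> x) *\<^sub>R x \<partial>\<mu>) /\<^sub>R (\<integral>x. exp (- \<alpha> * \<E> x) \<partial>\<mu>)"

definition mollifier :: "'h::real_inner \<Rightarrow> real \<Rightarrow> 'h \<Rightarrow> real" where
  "mollifier xstar r x =
     (if norm (x - xstar) < r then exp (1 - r\<^sup>2 / (r\<^sup>2 - (norm (x - xstar))\<^sup>2)) else 0)"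

text \<open>
  Solutions on \<open>[0, T]\<close>; the initial condition is the integral equation at \<open>t = 0\<close>.
\<close>

definition cbo_solution ::
  "'a measure \<Rightarrow> (real \<Rightarrow> 'a measure) \<Rightarrow> ('h::{real_inner, banach, polish_space} \<Rightarrow>\<^sub>L 'h)
     \<Rightarrow> (real \<Rightarrow> 'a \<Rightarrow> 'h) \<Rightarrow> 'h set \<Rightarrow> ('h \<Rightarrow> real) \<Rightarrow> ('a \<Rightarrow> 'h)
     \<Rightarrow> real \<Rightarrow> real \<Rightarrow> real \<Rightarrow> real \<Rightarrow> (real \<Rightarrow> 'a \<Rightarrow> 'h) \<Rightarrow> bool" where
  "cbo_solution M F Q W V \<E> \<xi> \<alpha> lam \<sigma> T X \<longleftrightarrow>
     predictable F T X \<and>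
     (AE \<omega> in M. continuous_on {0..T} (\<lambda>t. X t \<omega>)) \<and>
     (\<integral>\<^sup>+\<omega>. (SUP t\<in>{0..T}. ennreal ((norm (X t \<omega>))\<^sup>2)) \<partial>M) < \<infinity> \<and>
     (\<exists>I. ito_integral M F Q W T
            (\<lambda>t \<omega>. \<sigma> *\<^sub>R diffusion_op V (X t \<omega> - consensus_point \<E> \<alpha> (distr M borel (X t)))) I \<and>
          (AE \<omega> in M. \<forall>t\<in>{0..T}.
             X t \<omega> = \<xi> \<omega>
               + (LINT s:{0..t}|lborel.
                    - lam *\<^sub>R (X s \<omega> - consensus_point \<E> \<alpha> (distr M borel (X s))))
               + I t \<omega>))"

end

theory Submission
  imports Defs
begin

text \<open>
  Write \<open>Y\<^sub>t = X\<^sub>t - x\<^sup>*\<close>, \<open>m\<^sub>t\<close> for the consensus point, \<open>n = \<parallel>X\<^sub>t - m\<^sub>t\<parallel>\<close>, and \<open>u = r\<^sup>2 / (r\<^sup>2 - \<parallel>Y\<^sub>t\<parallel>\<^sup>2)\<close>. The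
  mollifier is \<open>G (\<parallel>Y\<^sub>t\<parallel>\<^sup>2)\<close> with \<open>G s = exp (1 - r\<^sup>2 / (r\<^sup>2 - s))\<close>, and \<open>w t\<close> denotes its expectation. Ito's
  formula suggests that the derivative of \<open>w\<close> is the expectation of \<open>L G\<close> at \<open>X\<^sub>t\<close>, where \<open>L\<close> is the
  generator of the equation, so that an exponential lower bound follows from a pointwise inequality
  \<open>L G \<ge> - p G\<close>.

  Inside the ball this inequality holds for the following reason. The drift can push particles out of
  the ball, at a relative cost of order \<open>n u\<^sup>2\<close>, which is unbounded as \<open>u \<rightarrow> \<infinity>\<close>. The noise acts in the
  radial direction, since \<open>Q\<close> is coercive on \<open>V\<close> and \<open>Y\<^sub>t\<close> lies in \<open>V\<close>, and the convexity of \<open>G\<close> near the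
  sphere turns it into a gain of order \<open>n\<^sup>2 u\<^sup>4\<close>. Gain and cost form a quadratic polynomial in \<open>n u\<^sup>2\<close>,
  which is bounded below. Away from the sphere everything is bounded, as \<open>n \<le> r + B\<close>. This is
  \<open>generator_bump_lower_bound\<close>.

  Instead of Ito's formula it is enough to bound the lower right Dini derivative of \<open>w\<close> from below by
  \<open>- p w\<close>, by \<open>dini_exponential_lower_bound\<close>. Fix a time \<open>s\<close> and let \<open>h \<rightarrow> 0\<close>. The increment of \<open>X\<close> over
  \<open>[s, s + h]\<close> is \<open>a\<^sub>s P\<^sub>V (W\<^sub>s\<^sub>+\<^sub>h - W\<^sub>s)\<close>, with \<open>a\<^sub>s = \<sigma> \<parallel>X\<^sub>s - m\<^sub>s\<parallel>\<close>, up to an error whose mean square is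
  \<open>o h\<close>, by an Ito isometry estimate (\<open>ito_integral_increment_error\<close>). A second-order Taylor expansion
  of \<open>G\<close> at points inside the ball (\<open>bump_increment_lower_bound\<close>) then gives the expected increment up
  to \<open>o h\<close>, because the Wiener increment is independent of the past (\<open>dynkin_lower_bound\<close>). Outside the
  ball nothing has to be expanded: there \<open>G\<close> vanishes, and it can only grow.

  The noise takes values in \<open>V\<close>, but the drift contains the consensus point, so that \<open>X\<^sub>t \<in> V\<close> needs an
  argument (\<open>X_in_V\<close>): the component of \<open>X\<close> orthogonal to \<open>V\<close> solves an equation without noise, hence it
  is deterministic, hence it equals its own weighted mean, and so its drift vanishes. The Hilbert space
  part (Riesz representation, orthonormal bases) serves to show that the Hilbert-Schmidt norm, which
  is given by adjoints and a basis, controls the variance of each coordinate of an Ito integral.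
\<close>

section \<open>Riesz representation, adjoints and orthonormal bases in Hilbert spaces\<close>

text \<open>
  By the parallelogram law, two points that are almost nearest to \<open>x\<close> are close to each other, since
  their midpoint cannot be nearer than \<open>d\<close> allows.
\<close>

lemma minimizing_sequence_Cauchy:
  fixes x :: "'h::real_inner"
  assumes U: "subspace U" and u: "\<And>n. u n \<in> U"
    and d: "\<And>v. v \<in> U \<Longrightarrow> d \<le> (norm (x - v))\<^sup>2"
    and le: "\<And>n::nat. (norm (x - u n))\<^sup>2 \<le> d + 1 / real (Suc n)"
  shows "Cauchy u"
proof (rule metric_CauchyI)
  have key: "(norm (u m - u n))\<^sup>2 \<le> 2 / real (Suc m) + 2 / real (Suc n)" for m n
  proof -
    \<comment> \<open>parallelogram law for the two differences, applied to the midpoint\<close>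
    have "(1/2) *\<^sub>R (u m + u n) \<in> U"
      using U u by (intro subspace_mul subspace_add)
    from d[OF this] have "4 * d \<le> 4 * (norm (x - (1/2) *\<^sub>R (u m + u n)))\<^sup>2" by simp
    also have "\<dots> = (norm ((x - u m) + (x - u n)))\<^sup>2"
      unfolding power2_norm_eq_inner
      by (simp add: inner_diff_left inner_diff_right inner_add_left inner_add_right inner_commute algebra_simps)
    also have "\<dots> = 2 * (norm (x - u m))\<^sup>2 + 2 * (norm (x - u n))\<^sup>2 - (norm (u m - u n))\<^sup>2"
      unfolding power2_norm_eq_inner
      by (simp add: inner_diff_left inner_diff_right inner_add_left inner_add_right inner_commute algebra_simps)
    finally show ?thesis using le[of m] le[of n] by (simp add: algebra_simps)
  qed
  fix e :: real assume e: "0 < e"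
  obtain N :: nat where N: "4 / e\<^sup>2 < real N" using reals_Archimedean2 by blast
  have "dist (u m) (u n) < e" if "m \<ge> N" "n \<ge> N" for m n
  proof -
    have N0: "0 < real N" using N e by (smt (verit) divide_pos_pos zero_less_power)
    have "2 / real (Suc m) \<le> 2 / real N" "2 / real (Suc n) \<le> 2 / real N"
      using that N0 by (auto intro!: divide_left_mono)
    then have "(norm (u m - u n))\<^sup>2 \<le> 4 / real N" using key[of m n] by simp
    also have "\<dots> < e\<^sup>2" using N N0 e by (simp add: field_simps)
    finally show ?thesis using e by (simp add: dist_norm power2_less_imp_less)
  qed
  then show "\<exists>N. \<forall>m\<ge>N. \<forall>n\<ge>N. dist (u m) (u n) < e" by blast
qed

text \<open>
  The nearest point \<open>p\<close> of \<open>U\<close> is the limit of a minimizing sequence. If \<open>x - p\<close> were not orthogonal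
  to some \<open>v\<close>, moving \<open>p\<close> along \<open>v\<close> would decrease the distance.
\<close>

theorem orthogonal_projection_exists:
  fixes x :: "'h::{real_inner, banach}"
  assumes U: "subspace U" and cl: "closed U"
  obtains p where "p \<in> U" "\<And>v. v \<in> U \<Longrightarrow> (x - p) \<bullet> v = 0"
proof -
  define d where "d = (INF v\<in>U. (norm (x - v))\<^sup>2)"
  have bdd: "bdd_below ((\<lambda>v. (norm (x - v))\<^sup>2) ` U)" by (rule bdd_belowI[of _ 0]) auto
  have ne: "U \<noteq> {}" using U subspace_0 by blast
  have d: "d \<le> (norm (x - v))\<^sup>2" if "v \<in> U" for v
    unfolding d_def using bdd that by (rule cINF_lower)
  have "\<exists>v\<in>U. (norm (x - v))\<^sup>2 \<le> d + 1 / real (Suc n)" for n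
  proof -
    have "d < d + 1 / real (Suc n)" by simp
    then show ?thesis unfolding d_def using cINF_less_iff[OF ne bdd] by (meson less_imp_le)
  qed
  then obtain u where u: "\<And>n. u n \<in> U" "\<And>n. (norm (x - u n))\<^sup>2 \<le> d + 1 / real (Suc n)" by metis
  have "Cauchy u" using minimizing_sequence_Cauchy[OF U u(1) d u(2)] .
  then obtain p where p: "u \<longlonglongrightarrow> p" using Cauchy_convergent convergent_def by blast
  have pU: "p \<in> U" using closed_sequentially[OF cl] u(1) p by blast
  have "(\<lambda>n. (norm (x - u n))\<^sup>2) \<longlonglongrightarrow> (norm (x - p))\<^sup>2" by (intro tendsto_intros p)
  moreover have "(\<lambda>n. d + 1 / real (Suc n)) \<longlonglongrightarrow> d + 0"
    by (intro tendsto_intros LIMSEQ_Suc lim_1_over_n)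
  ultimately have pd: "(norm (x - p))\<^sup>2 \<le> d" using u(2) by (auto intro: LIMSEQ_le)
  have "(x - p) \<bullet> v = 0" if v: "v \<in> U" for v
  proof (cases "v = 0")
    case False
    \<comment> \<open>the step along \<open>v\<close> that decreases the distance most\<close>
    define c where "c = ((x - p) \<bullet> v) / (v \<bullet> v)"
    have "p + c *\<^sub>R v \<in> U" using U pU v by (intro subspace_add subspace_mul)
    from order_trans[OF pd d[OF this]]
    have "(norm (x - p))\<^sup>2 \<le> (norm ((x - p) - c *\<^sub>R v))\<^sup>2" by (simp add: diff_diff_eq)
    also have "\<dots> = (norm (x - p))\<^sup>2 - 2 * c * ((x - p) \<bullet> v) + c * c * (v \<bullet> v)"
      unfolding power2_norm_eq_inner
      by (simp add: inner_diff_left inner_diff_right inner_commute algebra_simps)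
    finally have "2 * c * ((x - p) \<bullet> v) \<le> c * c * (v \<bullet> v)" by simp
    moreover have "c * (v \<bullet> v) = (x - p) \<bullet> v" using False by (simp add: c_def)
    ultimately have "c * (c * (v \<bullet> v)) \<le> 0" by (metis add_le_same_cancel2 mult.assoc mult_2 mult.commute)
    then have "c * c * (v \<bullet> v) \<le> 0" by (simp add: mult.assoc)
    moreover have "v \<bullet> v > 0" using False by simp
    ultimately have "c * c \<le> 0" by (simp add: mult_le_0_iff)
    then have "c = 0" by (metis mult_eq_0_iff order_antisym zero_le_square)
    then show ?thesis using False by (simp add: c_def)
  qed simp
  then show thesis using pU that by blast
qed

text \<open>
  The functional is determined by its value on a vector orthogonal to its kernel.
\<close>

theorem riesz_representation:
  fixes f :: "'h::{real_inner, banach} \<Rightarrow> real"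
  assumes "bounded_linear f"
  obtains z where "\<And>x. f x = x \<bullet> z"
proof -
  interpret f: bounded_linear f by fact
  show thesis
  proof (cases "\<forall>x. f x = 0")
    case True
    then show ?thesis using that[of 0] by simp
  next
    case False
    then obtain x0 where x0: "f x0 \<noteq> 0" by blast
    define U where "U = {x. f x = 0}"
    have sub: "subspace U" by (auto simp: U_def subspace_def f.add f.scaleR)
    have "closed U" unfolding U_def
      by (intro closed_Collect_eq continuous_intros f.continuous_on)
    then obtain p where p: "p \<in> U" "\<And>v. v \<in> U \<Longrightarrow> (x0 - p) \<bullet> v = 0"
      using orthogonal_projection_exists[OF sub] by metis
    define n where "n = x0 - p"
    have fn: "f n = f x0" using p(1) by (simp add: n_def f.diff U_def)
    have n0: "n \<bullet> n \<noteq> 0" using fn x0 by auto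
    have "f x = x \<bullet> ((f n / (n \<bullet> n)) *\<^sub>R n)" for x
    proof -
      have "x - (f x / f n) *\<^sub>R n \<in> U" using fn x0 by (simp add: U_def f.diff f.scaleR)
      from p(2)[OF this] have "n \<bullet> x = (f x / f n) * (n \<bullet> n)"
        by (simp add: n_def[symmetric] inner_diff_right)
      then show ?thesis using n0 fn x0 by (simp add: inner_commute field_simps)
    qed
    then show ?thesis using that by blast
  qed
qed

text \<open>
  The adjoint is defined by a choice operator; the Riesz representation of \<open>\<lambda>x. \<Psi> x \<bullet> y\<close> shows that
  something can be chosen.
\<close>

lemma adjoint_blinfun:
  fixes \<Psi> :: "'h::{real_inner, banach} \<Rightarrow>\<^sub>L 'h"
  shows "\<Psi> x \<bullet> y = x \<bullet> adjoint (blinfun_apply \<Psi>) y"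
proof -
  have "\<exists>z. \<forall>x. \<Psi> x \<bullet> y = x \<bullet> z" for y
  proof -
    have "bounded_linear (\<lambda>x. \<Psi> x \<bullet> y)"
      by (rule bounded_linear_compose[OF bounded_linear_inner_left blinfun.bounded_linear_right])
    then show ?thesis by (metis riesz_representation)
  qed
  then have "\<exists>f'. \<forall>x y. \<Psi> x \<bullet> y = x \<bullet> f' y" by metis
  from someI_ex[OF this] show ?thesis unfolding adjoint_def by blast
qed

lemma adjoint_blinfun_eqI:
  fixes \<Psi> :: "'h::{real_inner, banach} \<Rightarrow>\<^sub>L 'h"
  assumes "\<And>x. \<Psi> x \<bullet> y = x \<bullet> z"
  shows "adjoint (blinfun_apply \<Psi>) y = z"
proof -
  have "x \<bullet> adjoint (blinfun_apply \<Psi>) y = x \<bullet> z" for x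
    using assms[of x] by (simp add: adjoint_blinfun)
  then show ?thesis using vector_eq_ldot by blast
qed

lemma bounded_linear_adjoint_blinfun:
  fixes \<Psi> :: "'h::{real_inner, banach} \<Rightarrow>\<^sub>L 'h"
  shows "bounded_linear (adjoint (blinfun_apply \<Psi>))"
proof (rule bounded_linear_intro[where K = "norm \<Psi>"])
  let ?A = "adjoint (blinfun_apply \<Psi>)"
  show "?A (x + y) = ?A x + ?A y" for x y
    by (rule adjoint_blinfun_eqI) (simp add: inner_add_right adjoint_blinfun)
  show "?A (c *\<^sub>R x) = c *\<^sub>R ?A x" for c x
    by (rule adjoint_blinfun_eqI) (simp add: adjoint_blinfun)
  show "norm (?A x) \<le> norm x * norm \<Psi>" for x
  proof (cases "?A x = 0")
    case False
    have "norm (?A x) * norm (?A x) = \<Psi> (?A x) \<bullet> x"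
      by (simp add: adjoint_blinfun power2_norm_eq_inner[symmetric] power2_eq_square)
    also have "\<dots> \<le> norm (\<Psi> (?A x)) * norm x" by (rule norm_cauchy_schwarz)
    also have "\<dots> \<le> (norm \<Psi> * norm (?A x)) * norm x"
      by (intro mult_right_mono norm_blinfun) auto
    finally have "norm (?A x) * norm (?A x) \<le> norm (?A x) * (norm x * norm \<Psi>)" by (simp add: ac_simps)
    then show ?thesis using False by simp
  qed simp
qed

lemma subspace_closure:
  fixes U :: "'h::real_normed_vector set"
  assumes U: "subspace U"
  shows "subspace (closure U)"
  unfolding subspace_def
proof (intro conjI ballI allI)
  show "0 \<in> closure U" using U closure_subset subspace_0 by blast
next
  fix x y assume "x \<in> closure U" "y \<in> closure U"
  then obtain f g where "\<And>n. f n \<in> U" "f \<longlonglongrightarrow> x" "\<And>n. g n \<in> U" "g \<longlonglongrightarrow> y"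
    unfolding closure_sequential by blast
  then have "\<And>n. f n + g n \<in> U" "(\<lambda>n. f n + g n) \<longlonglongrightarrow> x + y"
    using U by (auto intro: subspace_add tendsto_add)
  then show "x + y \<in> closure U" unfolding closure_sequential by (intro exI conjI allI)
next
  fix c x assume "x \<in> closure U"
  then obtain f where "\<And>n. f n \<in> U" "f \<longlonglongrightarrow> x"
    unfolding closure_sequential by blast
  then have "\<And>n. c *\<^sub>R f n \<in> U" "(\<lambda>n. c *\<^sub>R f n) \<longlonglongrightarrow> c *\<^sub>R x"
    using U by (auto intro: subspace_mul tendsto_scaleR)
  then show "c *\<^sub>R x \<in> closure U" unfolding closure_sequential by (intro exI conjI allI)
qed

text \<open>
  The balls of radius \<open>1/2\<close> around the elements are disjoint, since two orthonormal vectors have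
  distance \<open>sqrt 2\<close>.
\<close>

lemma orthonormal_countable:
  fixes S :: "'h::{real_inner, second_countable_topology} set"
  assumes S: "\<And>x y. x \<in> S \<Longrightarrow> y \<in> S \<Longrightarrow> x \<bullet> y = (if x = y then 1 else 0)"
  shows "countable S"
proof -
  have d: "dist x y = sqrt 2" if "x \<in> S" "y \<in> S" "x \<noteq> y" for x y
    using S[OF that(1,2)] S[OF that(2,1)] S[OF that(1,1)] S[OF that(2,2)] that(3)
    by (simp add: dist_norm norm_eq_sqrt_inner inner_diff_left inner_diff_right)
  have disj: "ball x (1/2) \<inter> ball y (1/2) = {}" if "x \<in> S" "y \<in> S" "x \<noteq> y" for x y
  proof -
    have "dist x y > 1" using d[OF that] by simp
    show ?thesis
    proof (rule ccontr)
      assume "ball x (1/2) \<inter> ball y (1/2) \<noteq> {}"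
      then obtain z where "dist x z < 1/2" "dist y z < 1/2" by auto
      then have "dist x y < 1" using dist_triangle2[of x y z] by simp
      then show False using \<open>dist x y > 1\<close> by simp
    qed
  qed
  have inj: "inj_on (\<lambda>x. ball x (1/2)) S"
    using disj by (intro inj_onI) (metis Int_absorb centre_in_ball empty_iff half_gt_zero_iff zero_less_one)
  have "pairwise disjnt ((\<lambda>x. ball x (1/2)) ` S)"
    unfolding pairwise_image pairwise_def disjnt_def using disj by blast
  then have "countable ((\<lambda>x. ball x (1/2)) ` S)"
    by (intro countable_disjoint_open_subsets) auto
  then show ?thesis using inj by (rule countable_image_inj_on)
qed

definition orthonormal_set :: "'h::real_inner set \<Rightarrow> bool" where
  "orthonormal_set S \<longleftrightarrow> (\<forall>x\<in>S. \<forall>y\<in>S. x \<bullet> y = (if x = y then 1 else 0))"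

lemma orthonormal_set_insert:
  assumes "orthonormal_set S" "norm y = 1" "\<And>x. x \<in> S \<Longrightarrow> y \<bullet> x = 0"
  shows "orthonormal_set (insert y S)"
proof -
  have yy: "y \<bullet> y = 1" using assms(2) by (simp add: norm_eq_1)
  have yS: "y \<notin> S" using assms(3)[of y] yy by auto
  have "x \<bullet> y = 0" if "x \<in> S" for x using assms(3)[OF that] by (simp add: inner_commute)
  then show ?thesis using assms(1,3) yy yS unfolding orthonormal_set_def by auto
qed

text \<open>
  A maximal orthonormal set, from Zorn's lemma, has dense span by the projection theorem. It is
  countable by separability, and infinite, as otherwise it would span the space; an enumeration of it
  is the basis.
\<close>

theorem orthonormal_basis_exists:
  assumes inf: "infinite_dimensional TYPE('h::{real_inner, banach, second_countable_topology})"
  shows "\<exists>e :: nat \<Rightarrow> 'h. orthonormal_basis e"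
proof -
  have "\<exists>S\<in>Collect orthonormal_set. \<forall>S'\<in>Collect orthonormal_set. S \<subseteq> S' \<longrightarrow> S' = (S :: 'h set)"
  proof (rule subset_Zorn')
    fix C :: "'h set set" assume C: "subset.chain (Collect orthonormal_set) C"
    have "x \<bullet> y = (if x = y then 1 else 0)" if xy: "x \<in> \<Union>C" "y \<in> \<Union>C" for x y
    proof -
      obtain A B where AB: "A \<in> C" "B \<in> C" "x \<in> A" "y \<in> B" using xy by blast
      then have "A \<subseteq> B \<or> B \<subseteq> A" using C by (auto simp: subset.chain_def)
      then obtain D where D: "D \<in> C" "x \<in> D" "y \<in> D" using AB by blast
      then have "orthonormal_set D" using C by (auto simp: subset.chain_def)
      then show ?thesis using D unfolding orthonormal_set_def by blast
    qed
    then show "\<Union>C \<in> Collect orthonormal_set" by (auto simp: orthonormal_set_def)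
  qed
  then obtain S :: "'h set" where S: "orthonormal_set S"
    and max: "\<And>S'. orthonormal_set S' \<Longrightarrow> S \<subseteq> S' \<Longrightarrow> S' = S" by auto
  \<comment> \<open>a vector orthogonal to \<open>S\<close> could be normalized and added to \<open>S\<close>\<close>
  have complete: "y = 0" if y: "\<And>x. x \<in> S \<Longrightarrow> y \<bullet> x = 0" for y
  proof (rule ccontr)
    assume "y \<noteq> 0"
    then have "orthonormal_set (insert (y /\<^sub>R norm y) S)"
      using y by (intro orthonormal_set_insert[OF S]) auto
    from max[OF this] have "y /\<^sub>R norm y \<in> S" by blast
    from y[OF this] show False using \<open>y \<noteq> 0\<close> by simp
  qed
  have cl: "closure (span S) = UNIV"
  proof -
    have "subspace (closure (span S))" by (simp add: subspace_closure)
    have "x \<in> closure (span S)" for x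
    proof -
      obtain p where p: "p \<in> closure (span S)" "\<And>v. v \<in> closure (span S) \<Longrightarrow> (x - p) \<bullet> v = 0"
        using orthogonal_projection_exists[OF \<open>subspace (closure (span S))\<close> closed_closure] by metis
      have "S \<subseteq> closure (span S)" using closure_subset span_superset by (rule subset_trans[rotated])
      then have "x - p = 0" by (intro complete p(2)) auto
      then show ?thesis using p(1) by simp
    qed
    then show ?thesis by auto
  qed
  have count: "countable S" using S by (intro orthonormal_countable) (auto simp: orthonormal_set_def)
  have infS: "infinite S"
  proof
    assume fin: "finite S"
    \<comment> \<open>the Fourier expansion along a finite maximal set reproduces every vector\<close>
    have "x \<in> span S" for x
    proof -
      have "x - (\<Sum>e\<in>S. (x \<bullet> e) *\<^sub>R e) = 0"
      proof (rule complete)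
        fix e assume e: "e \<in> S"
        have "(\<Sum>e'\<in>S. (x \<bullet> e') * (e' \<bullet> e)) = (\<Sum>e'\<in>S. if e' = e then x \<bullet> e else 0)"
          using S e by (intro sum.cong) (auto simp: orthonormal_set_def)
        then show "(x - (\<Sum>e\<in>S. (x \<bullet> e) *\<^sub>R e)) \<bullet> e = 0"
          using fin e by (simp add: inner_diff_left inner_sum_left)
      qed
      then have "x = (\<Sum>e\<in>S. (x \<bullet> e) *\<^sub>R e)" by simp
      also have "\<dots> \<in> span S" by (intro span_sum span_mul span_base)
      finally show ?thesis .
    qed
    then have "span S = UNIV" by blast
    then show False using inf fin by (auto simp: infinite_dimensional_def)
  qed
  let ?e = "from_nat_into S"
  have bij: "bij_betw ?e UNIV S" using count infS by (rule bij_betw_from_nat_into)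
  then have "range ?e = S" "inj ?e" by (auto simp: bij_betw_def)
  then have "orthonormal_basis ?e"
    using S cl unfolding orthonormal_basis_def orthonormal_set_def by (metis inj_eq rangeI)
  then show ?thesis by blast
qed

section \<open>Quadratic forms and the Hilbert-Schmidt norm\<close>

lemma psd_add_le:
  assumes "bounded_linear Q" and sym: "\<And>x y. Q x \<bullet> y = x \<bullet> Q y" and pos: "\<And>x. 0 \<le> x \<bullet> Q x"
  shows "(Q (x + y)) \<bullet> (x + y) \<le> 2 * (Q x \<bullet> x) + 2 * (Q y \<bullet> y)"
proof -
  interpret Q: bounded_linear Q by fact
  have "0 \<le> (x - y) \<bullet> Q (x - y)" by (rule pos)
  then show ?thesis using sym[of x y]
    by (simp add: Q.add Q.diff inner_add_left inner_add_right inner_diff_left inner_diff_right inner_commute)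
qed

text \<open>
  The triangle inequality for the seminorm of a positive semi-definite form.
\<close>

lemma quadratic_form_sum_le:
  assumes Q: "bounded_linear Q" and sym: "\<And>x y. Q x \<bullet> y = x \<bullet> Q y" and pos: "\<And>x::'h::real_inner. 0 \<le> x \<bullet> Q x"
  shows "finite S \<Longrightarrow> sqrt (Q (\<Sum>k\<in>S. f k) \<bullet> (\<Sum>k\<in>S. f k)) \<le> (\<Sum>k\<in>S. sqrt (Q (f k) \<bullet> f k))"
proof (induction rule: finite_induct)
  case empty
  interpret Q: bounded_linear Q by fact
  show ?case by (simp add: Q.zero)
next
  case (insert a S)
  interpret Q: bounded_linear Q by fact
  let ?x = "f a" and ?y = "\<Sum>k\<in>S. f k"
  have pos': "0 \<le> Q x \<bullet> x" for x using pos[of x] by (simp add: inner_commute)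
  have cs: "(Q x \<bullet> y)\<^sup>2 \<le> (Q x \<bullet> x) * (Q y \<bullet> y)" for x y
  proof -
    have *: "0 \<le> (Q x \<bullet> x) + 2 * t * (Q x \<bullet> y) + t\<^sup>2 * (Q y \<bullet> y)" for t
      using pos'[of "x + t *\<^sub>R y"] sym[of x y]
      by (simp add: Q.add Q.scaleR inner_add_left inner_add_right inner_commute power2_eq_square algebra_simps)
    show ?thesis
    proof (cases "Q y \<bullet> y = 0")
      case True
      have "Q x \<bullet> y = 0"
      proof (rule ccontr)
        assume n: "Q x \<bullet> y \<noteq> 0"
        have "0 \<le> (Q x \<bullet> x) + 2 * (- (Q x \<bullet> x + 1) / (2 * (Q x \<bullet> y))) * (Q x \<bullet> y)"
          using *[of "- (Q x \<bullet> x + 1) / (2 * (Q x \<bullet> y))"] True by simp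
        then show False using n by (simp add: field_simps)
      qed
      then show ?thesis using True by simp
    next
      case False
      then have p: "Q y \<bullet> y > 0" using pos'[of y] by simp
      have "0 \<le> (Q x \<bullet> x) - (Q x \<bullet> y)\<^sup>2 / (Q y \<bullet> y)"
        using *[of "- (Q x \<bullet> y) / (Q y \<bullet> y)"] p by (simp add: power2_eq_square field_simps)
      then show ?thesis using p by (simp add: field_simps)
    qed
  qed
  have "Q (?x + ?y) \<bullet> (?x + ?y) = Q ?x \<bullet> ?x + 2 * (Q ?x \<bullet> ?y) + Q ?y \<bullet> ?y"
    using sym[of ?x ?y] by (simp add: Q.add inner_add_left inner_add_right inner_commute)
  also have "\<dots> \<le> Q ?x \<bullet> ?x + 2 * (sqrt (Q ?x \<bullet> ?x) * sqrt (Q ?y \<bullet> ?y)) + Q ?y \<bullet> ?y"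
  proof -
    have "Q ?x \<bullet> ?y \<le> sqrt ((Q ?x \<bullet> ?x) * (Q ?y \<bullet> ?y))"
      using cs[of ?x ?y] by (simp add: real_le_rsqrt)
    then show ?thesis by (simp add: real_sqrt_mult)
  qed
  also have "\<dots> = (sqrt (Q ?x \<bullet> ?x) + sqrt (Q ?y \<bullet> ?y))\<^sup>2"
    using pos'[of ?x] pos'[of ?y] by (simp add: power2_sum)
  finally have "sqrt (Q (?x + ?y) \<bullet> (?x + ?y)) \<le> sqrt (Q ?x \<bullet> ?x) + sqrt (Q ?y \<bullet> ?y)"
    by (rule real_le_lsqrt[rotated]) (simp add: pos')
  then show ?case using insert by simp
qed

text \<open>
  The quadratic form of a positive semi-definite operator is at most its trace times \<open>\<parallel>v\<parallel>\<^sup>2\<close>, here for the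
  operator \<open>\<Psi> Q \<Psi>\<^sup>*\<close>. On finite combinations of basis vectors this is the triangle inequality for the
  seminorm, followed by the Cauchy-Schwarz inequality for the coefficients; both sides are continuous
  in \<open>v\<close>. Through this bound the Hilbert-Schmidt norm enters the estimates of the Ito integral.
\<close>

theorem quadratic_form_le_hs_norm_sq:
  fixes Q \<Psi> :: "'h::{real_inner, banach, second_countable_topology} \<Rightarrow>\<^sub>L 'h"
  assumes inf: "infinite_dimensional TYPE('h)" and Q: "covariance_operator Q"
  shows "ennreal (Q (adjoint (blinfun_apply \<Psi>) v) \<bullet> adjoint (blinfun_apply \<Psi>) v)
           \<le> ennreal ((norm v)\<^sup>2) * hs_norm_sq Q \<Psi>"
proof (cases "hs_norm_sq Q \<Psi> = \<infinity>")
  case True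
  interpret A: bounded_linear "adjoint (blinfun_apply \<Psi>)" by (rule bounded_linear_adjoint_blinfun)
  show ?thesis
  proof (cases "v = 0")
    case True then show ?thesis by (simp add: A.zero)
  next
    case False
    then show ?thesis using True by (simp add: ennreal_mult_top)
  qed
next
  case False
  let ?A = "adjoint (blinfun_apply \<Psi>)"
  define p where "p x = Q (?A x) \<bullet> ?A x" for x
  interpret A: bounded_linear ?A by (rule bounded_linear_adjoint_blinfun)
  have sym: "Q x \<bullet> y = x \<bullet> Q y" for x y using Q by (simp add: covariance_operator_def)
  have pos: "0 \<le> x \<bullet> Q x" for x using Q by (simp add: covariance_operator_def)
  have p0: "0 \<le> p x" for x unfolding p_def using pos[of "?A x"] by (simp add: inner_commute)
  define e where "e = (some_onb :: nat \<Rightarrow> 'h)"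
  have e: "orthonormal_basis e" unfolding e_def some_onb_def
    using orthonormal_basis_exists[OF inf] by (rule someI_ex)
  then have ee: "e i \<bullet> e j = (if i = j then 1 else 0)" and ecl: "closure (span (range e)) = UNIV" for i j
    by (auto simp: orthonormal_basis_def)
  have einj: "inj e" by (rule injI) (metis ee zero_neq_one)
  have "hs_norm_sq Q \<Psi> = (\<Sum>k. ennreal (p (e k)))"
    unfolding hs_norm_sq_def psd_trace_def e_def[symmetric] p_def by (simp add: adjoint_blinfun)
  then have sumtop: "(\<Sum>k. ennreal (p (e k))) \<noteq> \<infinity>" using False by simp
  then have smb: "summable (\<lambda>k. p (e k))" using p0
    by (intro summable_suminf_not_top) auto
  define tr where "tr = (\<Sum>k. p (e k))"
  have tr0: "0 \<le> tr" unfolding tr_def using p0 smb by (intro suminf_nonneg)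
  have hs: "hs_norm_sq Q \<Psi> = ennreal tr"
    unfolding tr_def using \<open>hs_norm_sq Q \<Psi> = _\<close> p0 smb by (simp add: suminf_ennreal2)
  have onspan: "p x \<le> (norm x)\<^sup>2 * tr" if x: "x \<in> span (range e)" for x
  proof -
    obtain t r where t: "finite t" "t \<subseteq> range e" "x = (\<Sum>a\<in>t. r a *\<^sub>R a)"
      using x unfolding span_explicit by blast
    from t(2) obtain S where te: "t = e ` S" by (rule subset_imageE)
    have inS: "inj_on e S" using einj by (rule inj_on_subset) simp
    define c where "c k = r (e k)" for k
    have S: "finite S" "x = (\<Sum>k\<in>S. c k *\<^sub>R e k)"
      using t(1) inS unfolding t(3) te c_def by (simp_all add: finite_image_iff sum.reindex)
    have nx: "(norm x)\<^sup>2 = (\<Sum>k\<in>S. (c k)\<^sup>2)"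
    proof -
      have "x \<bullet> x = (\<Sum>k\<in>S. \<Sum>l\<in>S. c k * (c l * (e l \<bullet> e k)))"
        unfolding S(2) by (simp add: inner_sum_left inner_sum_right sum_distrib_left)
      also have "\<dots> = (\<Sum>k\<in>S. \<Sum>l\<in>S. if k = l then (c k)\<^sup>2 else 0)"
        by (intro sum.cong refl) (simp add: ee power2_eq_square)
      also have "\<dots> = (\<Sum>k\<in>S. (c k)\<^sup>2)" using S(1) by simp
      finally show ?thesis by (simp add: power2_norm_eq_inner)
    qed
    have "sqrt (p x) \<le> (\<Sum>k\<in>S. sqrt (Q (?A (c k *\<^sub>R e k)) \<bullet> ?A (c k *\<^sub>R e k)))"
      unfolding p_def S(2) A.sum
      by (rule quadratic_form_sum_le[OF blinfun.bounded_linear_right sym pos S(1)])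
    also have "\<dots> = (\<Sum>k\<in>S. \<bar>c k\<bar> * \<bar>sqrt (p (e k))\<bar>)"
    proof (rule sum.cong[OF refl])
      fix k
      have "Q (?A (c k *\<^sub>R e k)) \<bullet> ?A (c k *\<^sub>R e k) = (c k)\<^sup>2 * p (e k)"
        by (simp add: p_def A.scaleR blinfun.scaleR_right power2_eq_square)
      then show "sqrt (Q (?A (c k *\<^sub>R e k)) \<bullet> ?A (c k *\<^sub>R e k)) = \<bar>c k\<bar> * \<bar>sqrt (p (e k))\<bar>"
        using p0[of "e k"] by (simp add: real_sqrt_mult)
    qed
    also have "\<dots> \<le> L2_set c S * L2_set (\<lambda>k. sqrt (p (e k))) S" by (rule L2_set_mult_ineq)
    also have "\<dots> = norm x * sqrt (\<Sum>k\<in>S. p (e k))"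
      unfolding L2_set_def nx[symmetric] using p0 by simp
    also have "\<dots> \<le> norm x * sqrt tr"
      unfolding tr_def using p0 smb S(1) by (intro mult_left_mono real_sqrt_le_mono sum_le_suminf) auto
    finally have "(sqrt (p x))\<^sup>2 \<le> (norm x * sqrt tr)\<^sup>2" using p0 by (intro power_mono) auto
    then show ?thesis using p0 tr0 by (simp add: power_mult_distrib)
  qed
  have "closed {x. p x \<le> (norm x)\<^sup>2 * tr}"
    unfolding p_def
    by (intro closed_Collect_le continuous_intros A.continuous_on)
  then have "closure (span (range e)) \<subseteq> {x. p x \<le> (norm x)\<^sup>2 * tr}"
    using onspan by (intro closure_minimal) auto
  then have "p v \<le> (norm v)\<^sup>2 * tr" using ecl by blast
  then show ?thesis unfolding hs p_def using tr0
    by (simp add: ennreal_mult[symmetric] ennreal_leI)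
qed

section \<open>Orthogonal projection onto a finite-dimensional subspace\<close>

text \<open>
  An orthogonal spanning set becomes orthonormal after discarding \<open>0\<close> and normalizing.
\<close>

lemma finite_orthonormal_basis:
  fixes V :: "'h::real_inner set"
  assumes "finite B" "V = span B"
  obtains E where "finite E" "orthonormal_set E" "span E = V"
proof -
  obtain C where C: "finite C" "span C = span B" "pairwise orthogonal C"
    using basis_orthogonal[OF assms(1)] by blast
  define D where "D = C - {0}"
  define E where "E = (\<lambda>x. x /\<^sub>R norm x) ` D"
  have "finite E" using C by (simp add: E_def D_def)
  moreover have "orthonormal_set E"
  proof -
    have "(x /\<^sub>R norm x) \<bullet> (y /\<^sub>R norm y) = (if x /\<^sub>R norm x = y /\<^sub>R norm y then 1 else 0)"
      if "x \<in> D" "y \<in> D" for x y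
    proof (cases "x = y")
      case True
      have "norm x \<noteq> 0" using that by (simp add: D_def)
      then show ?thesis using True
        by (simp add: power2_norm_eq_inner[symmetric] power2_eq_square)
    next
      case False
      then have o: "x \<bullet> y = 0" using C(3) that by (auto simp: pairwise_def orthogonal_def D_def)
      have "x /\<^sub>R norm x \<noteq> y /\<^sub>R norm y"
      proof
        assume e: "x /\<^sub>R norm x = y /\<^sub>R norm y"
        have "(x /\<^sub>R norm x) \<bullet> (y /\<^sub>R norm y) = 0" using o by simp
        then have "(x /\<^sub>R norm x) \<bullet> (x /\<^sub>R norm x) = 0" unfolding e[symmetric] .
        then have "x /\<^sub>R norm x = 0" by (simp only: inner_eq_zero_iff)
        then show False using that by (simp add: D_def)
      qed
      then show ?thesis using o by simp
    qed
    then show ?thesis unfolding orthonormal_set_def E_def by blast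
  qed
  moreover have "span E = V"
  proof
    show "span E \<subseteq> V"
      unfolding assms(2) C(2)[symmetric] E_def D_def
      by (intro span_minimal subspace_span) (auto intro: span_mul span_base)
    have "C \<subseteq> span E"
    proof
      fix x assume x: "x \<in> C"
      show "x \<in> span E"
      proof (cases "x = 0")
        case True then show ?thesis by (simp add: span_zero)
      next
        case False
        then have "x /\<^sub>R norm x \<in> E" using x by (simp add: E_def D_def)
        then have "norm x *\<^sub>R (x /\<^sub>R norm x) \<in> span E" by (intro span_mul span_base)
        then show ?thesis using False by simp
      qed
    qed
    then show "V \<subseteq> span E" unfolding assms(2) C(2)[symmetric]
      by (intro span_minimal subspace_span)
  qed
  ultimately show thesis by (rule that)
qed

lemma orthonormal_set_sum_inner:
  assumes "finite E" "orthonormal_set E" "e \<in> E"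
  shows "(\<Sum>v\<in>E. c v *\<^sub>R v) \<bullet> e = c e"
proof -
  have "(\<Sum>v\<in>E. c v *\<^sub>R v) \<bullet> e = (\<Sum>v\<in>E. if v = e then c e else 0)"
    unfolding inner_sum_left using assms by (intro sum.cong) (auto simp: orthonormal_set_def)
  then show ?thesis using assms by simp
qed

lemma orth_proj_eq:
  fixes E :: "'h::real_inner set"
  assumes E: "finite E" "orthonormal_set E"
  shows "blinfun_apply (orth_proj (span E)) x = (\<Sum>v\<in>E. (x \<bullet> v) *\<^sub>R v)"
proof -
  have "(THE v. v \<in> span E \<and> x - v \<in> (span E)\<^sup>\<bottom>) = (\<Sum>v\<in>E. (x \<bullet> v) *\<^sub>R v)" for x
  proof (rule the_equality)
    let ?p = "\<Sum>v\<in>E. (x \<bullet> v) *\<^sub>R v"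
    have pin: "?p \<in> span E" by (intro span_sum span_mul span_base)
    have perp: "y \<bullet> (x - ?p) = 0" if "y \<in> span E" for y
      using that
    proof (induction rule: span_induct_alt)
      case (step c b y)
      have "b \<bullet> (x - ?p) = 0"
        using orthonormal_set_sum_inner[OF E step(1)] by (simp add: inner_diff_right inner_commute)
      then show ?case using step by (simp add: inner_add_left)
    qed simp
    then show "?p \<in> span E \<and> x - ?p \<in> (span E)\<^sup>\<bottom>"
      using pin by (auto simp: orthogonal_comp_def orthogonal_def)
    fix v assume v: "v \<in> span E \<and> x - v \<in> (span E)\<^sup>\<bottom>"
    then have "v - ?p \<in> span E" using pin by (intro span_diff) auto
    then have "(v - ?p) \<bullet> (x - v) = 0" "(v - ?p) \<bullet> (x - ?p) = 0"
      using v perp by (auto simp: orthogonal_comp_def orthogonal_def)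
    then have "(v - ?p) \<bullet> ((x - ?p) - (x - v)) = 0" by (simp only: inner_diff_right[of _ "x - ?p"])
    then show "v = ?p" by simp
  qed
  then have "orth_proj (span E) = Blinfun (\<lambda>x. \<Sum>v\<in>E. (x \<bullet> v) *\<^sub>R v)"
    unfolding orth_proj_def by simp
  moreover have "bounded_linear (\<lambda>x. \<Sum>v\<in>E. (x \<bullet> v) *\<^sub>R v)"
    by (intro bounded_linear_sum bounded_linear_scaleR_const bounded_linear_inner_left)
  ultimately show ?thesis by (simp add: bounded_linear_Blinfun_apply)
qed

section \<open>Increments of a Wiener process and independence of the past\<close>

lemma (in prob_space) centered_gaussian_moments:
  assumes g: "centered_gaussian M Z v" and v: "0 \<le> v"
  shows "integrable M (\<lambda>\<omega>. Z \<omega> ^ k)" (is ?i)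
    and "(\<integral>\<omega>. Z \<omega> \<partial>M) = 0"
    and "(\<integral>\<omega>. (Z \<omega>)\<^sup>2 \<partial>M) = v"
    and "(\<integral>\<omega>. Z \<omega> ^ 4 \<partial>M) = 3 * v\<^sup>2"
proof -
  have [measurable]: "Z \<in> borel_measurable M" using g by (simp add: centered_gaussian_def)
  have "?i \<and> (\<integral>\<omega>. Z \<omega> \<partial>M) = 0 \<and> (\<integral>\<omega>. (Z \<omega>)\<^sup>2 \<partial>M) = v \<and> (\<integral>\<omega>. Z \<omega> ^ 4 \<partial>M) = 3 * v\<^sup>2"
  proof (cases "v = 0")
    case True
    then have ae: "AE \<omega> in M. Z \<omega> = 0" using g by (simp add: centered_gaussian_def)
    have "integrable M (\<lambda>\<omega>. Z \<omega> ^ k) = integrable M (\<lambda>\<omega>. (0::real) ^ k)"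
      using ae by (intro integrable_cong_AE) auto
    moreover have "(\<integral>\<omega>. Z \<omega> ^ n \<partial>M) = (\<integral>\<omega>. 0 ^ n \<partial>M)" for n
      using ae by (intro integral_cong_AE) auto
    from this[of 1] this[of 2] this[of 4] have "(\<integral>\<omega>. Z \<omega> \<partial>M) = 0" "(\<integral>\<omega>. (Z \<omega>)\<^sup>2 \<partial>M) = 0" "(\<integral>\<omega>. Z \<omega> ^ 4 \<partial>M) = 0"
      by simp_all
    ultimately show ?thesis using True by simp
  next
    case False
    then have v: "0 < sqrt v" using v by simp
    have d: "distributed M lborel Z (\<lambda>x. ennreal (normal_density 0 (sqrt v) x))"
      using g False by (simp add: centered_gaussian_def)
    have int: "(\<integral>\<omega>. Z \<omega> ^ n \<partial>M) = (\<integral>x. normal_density 0 (sqrt v) x * (x - 0) ^ n \<partial>lborel)" for n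
      using distributed_integral[OF d, of "\<lambda>x. x ^ n"] by simp
    have "?i" using distributed_integrable[OF d, of "\<lambda>x. x ^ k"] integrable_normal_moment[OF v, of 0 k] by simp
    moreover have "(\<integral>\<omega>. Z \<omega> \<partial>M) = 0"
      using int[of 1] integral_normal_moment_odd[OF v, of 0 0] by simp
    moreover have "(\<integral>\<omega>. (Z \<omega>)\<^sup>2 \<partial>M) = v"
      using int[of 2] integral_normal_moment_even[OF v, of 0 1] v by simp
    moreover have "(\<integral>\<omega>. Z \<omega> ^ 4 \<partial>M) = 3 * v\<^sup>2"
      using int[of 4] integral_normal_moment_even[OF v, of 0 2] v
      by (simp add: fact_numeral power_divide power4_eq_xxxx power2_eq_square)
    ultimately show ?thesis by simp
  qed
  then show ?i "(\<integral>\<omega>. Z \<omega> \<partial>M) = 0" "(\<integral>\<omega>. (Z \<omega>)\<^sup>2 \<partial>M) = v" "(\<integral>\<omega>. Z \<omega> ^ 4 \<partial>M) = 3 * v\<^sup>2" by auto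
qed

lemma integrable_mult_of_square:
  fixes f g :: "'a \<Rightarrow> real"
  assumes [measurable]: "f \<in> borel_measurable M" "g \<in> borel_measurable M"
    and "integrable M (\<lambda>x. (f x)\<^sup>2)" "integrable M (\<lambda>x. (g x)\<^sup>2)"
  shows "integrable M (\<lambda>x. f x * g x)"
proof (rule Bochner_Integration.integrable_bound)
  show "integrable M (\<lambda>x. (f x)\<^sup>2 + (g x)\<^sup>2)" using assms by simp
  show "AE x in M. norm (f x * g x) \<le> norm ((f x)\<^sup>2 + (g x)\<^sup>2)"
  proof (rule AE_I2)
    fix x
    have "0 \<le> (\<bar>f x\<bar> - \<bar>g x\<bar>)\<^sup>2" "0 \<le> \<bar>f x\<bar> * \<bar>g x\<bar>" by simp_all
    then have "\<bar>f x\<bar> * \<bar>g x\<bar> \<le> (f x)\<^sup>2 + (g x)\<^sup>2"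
      unfolding power2_diff power2_abs by linarith
    then have "\<bar>f x * g x\<bar> \<le> (f x)\<^sup>2 + (g x)\<^sup>2" by (simp only: abs_mult)
    then show "norm (f x * g x) \<le> norm ((f x)\<^sup>2 + (g x)\<^sup>2)" by simp
  qed
qed measurable

locale wiener_filtration = prob_space M
  for M :: "'a measure" and F :: "real \<Rightarrow> 'a measure"
    and Q :: "'h::{real_inner, banach, polish_space} \<Rightarrow>\<^sub>L 'h"
    and W :: "real \<Rightarrow> 'a \<Rightarrow> 'h" +
  assumes usual: "usual_filtered_prob_space M F"
    and wiener: "q_wiener_process M F Q W"
    and cov: "covariance_operator Q"
begin

lemma Q_sym: "Q x \<bullet> y = x \<bullet> Q y"
  using cov unfolding covariance_operator_def by blast

lemma Q_nonneg: "0 \<le> Q x \<bullet> x"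
  using cov unfolding covariance_operator_def inner_commute[of "Q x"] by blast

lemma F_subalgebra: "0 \<le> t \<Longrightarrow> subalgebra M (F t)"
  using usual unfolding usual_filtered_prob_space_def by blast

lemma space_F: "0 \<le> t \<Longrightarrow> space (F t) = space M"
  using F_subalgebra by (simp add: subalgebra_def)

lemma F_mono:
  assumes "0 \<le> s" "s \<le> t"
  shows "subalgebra (F t) (F s)"
proof -
  have "sets (F s) \<subseteq> sets (F t)"
    using usual assms unfolding usual_filtered_prob_space_def by blast
  then show ?thesis using assms by (simp add: subalgebra_def space_F)
qed

lemma measurable_F: "0 \<le> t \<Longrightarrow> f \<in> F t \<rightarrow>\<^sub>M N \<Longrightarrow> f \<in> M \<rightarrow>\<^sub>M N"
  by (rule measurable_from_subalg[OF F_subalgebra])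

lemma measurable_F_mono: "0 \<le> s \<Longrightarrow> s \<le> t \<Longrightarrow> f \<in> F s \<rightarrow>\<^sub>M N \<Longrightarrow> f \<in> F t \<rightarrow>\<^sub>M N"
  by (rule measurable_from_subalg[OF F_mono])

definition incr :: "real \<Rightarrow> real \<Rightarrow> 'a \<Rightarrow> 'h" where
  "incr s t \<omega> = W t \<omega> - W s \<omega>"

lemma measurable_W: "0 \<le> t \<Longrightarrow> W t \<in> F t \<rightarrow>\<^sub>M borel"
  using wiener by (simp add: q_wiener_process_def)

lemma measurable_incr: "0 \<le> s \<Longrightarrow> s \<le> t \<Longrightarrow> incr s t \<in> F t \<rightarrow>\<^sub>M borel"
  unfolding incr_def[abs_def]
  by (intro borel_measurable_diff measurable_W measurable_F_mono[OF _ _ measurable_W]) auto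

lemma measurable_incr': "0 \<le> s \<Longrightarrow> s \<le> t \<Longrightarrow> incr s t \<in> M \<rightarrow>\<^sub>M borel"
  using measurable_F[OF _ measurable_incr] by simp

lemma incr_gaussian: "0 \<le> s \<Longrightarrow> s \<le> t \<Longrightarrow> centered_gaussian M (\<lambda>\<omega>. incr s t \<omega> \<bullet> h) ((t - s) * (Q h \<bullet> h))"
  using wiener by (simp add: q_wiener_process_def incr_def)

lemma incr_moments:
  assumes "0 \<le> s" "s \<le> t"
  shows "integrable M (\<lambda>\<omega>. (incr s t \<omega> \<bullet> h) ^ k)"
    and "(\<integral>\<omega>. incr s t \<omega> \<bullet> h \<partial>M) = 0"
    and "(\<integral>\<omega>. (incr s t \<omega> \<bullet> h)\<^sup>2 \<partial>M) = (t - s) * (Q h \<bullet> h)"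
    and "(\<integral>\<omega>. (incr s t \<omega> \<bullet> h) ^ 4 \<partial>M) = 3 * ((t - s) * (Q h \<bullet> h))\<^sup>2"
  using centered_gaussian_moments[OF incr_gaussian[OF assms]] assms Q_nonneg by simp_all

text \<open>
  Independence of the whole \<open>\<sigma>\<close>-algebra \<open>F s\<close> from the increment: the pair of the sample point, seen
  as an element of the measurable space \<open>F s\<close>, and the increment has a product law.
\<close>

lemma distr_incr_product:
  assumes st: "0 \<le> s" "s \<le> t"
  shows "distr M (F s \<Otimes>\<^sub>M borel) (\<lambda>\<omega>. (\<omega>, incr s t \<omega>)) = distr M (F s) (\<lambda>\<omega>. \<omega>) \<Otimes>\<^sub>M distr M borel (incr s t)"
proof -
  have id: "(\<lambda>\<omega>. \<omega>) \<in> M \<rightarrow>\<^sub>M F s" by (rule measurable_F[OF st(1)]) simp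
  have ind: "indep_set (sets (F s)) {incr s t -` B \<inter> space M |B. B \<in> sets borel}"
    using wiener st by (auto simp: q_wiener_process_def incr_def[abs_def])
  have [measurable]: "incr s t \<in> M \<rightarrow>\<^sub>M borel" by (rule measurable_incr'[OF st])
  have [measurable]: "(\<lambda>\<omega>. \<omega>) \<in> M \<rightarrow>\<^sub>M F s" by (rule id)
  interpret D1: prob_space "distr M (F s) (\<lambda>\<omega>. \<omega>)" by (rule prob_space_distr) measurable
  interpret D2: prob_space "distr M borel (incr s t)" by (rule prob_space_distr) measurable
  show ?thesis
  proof (rule pair_measure_eqI[symmetric])
    fix A B assume A: "A \<in> sets (distr M (F s) (\<lambda>\<omega>. \<omega>))" and B: "B \<in> sets (distr M borel (incr s t))"
    then have AM: "A \<in> sets M" "A \<subseteq> space M"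
      using F_subalgebra[OF st(1)] sets.sets_into_space by (auto simp: subalgebra_def)
    have "prob (A \<inter> (incr s t -` B \<inter> space M)) = prob A * prob (incr s t -` B \<inter> space M)"
      using A B by (intro indep_setD[OF ind]) auto
    moreover have "(\<lambda>\<omega>. (\<omega>, incr s t \<omega>)) -` (A \<times> B) \<inter> space M = A \<inter> (incr s t -` B \<inter> space M)"
      "(\<lambda>\<omega>. \<omega>) -` A \<inter> space M = A"
      using AM by auto
    ultimately show "emeasure (distr M (F s) (\<lambda>\<omega>. \<omega>)) A * emeasure (distr M borel (incr s t)) B =
      emeasure (distr M (F s \<Otimes>\<^sub>M borel) (\<lambda>\<omega>. (\<omega>, incr s t \<omega>))) (A \<times> B)"
      using A B by (simp add: emeasure_distr emeasure_eq_measure ennreal_mult'')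
  qed (auto simp: D1.sigma_finite_measure_axioms D2.sigma_finite_measure_axioms intro!: sets_pair_measure_cong)
qed

text \<open>
  In an expectation of a function of the past and of an increment, the past can be frozen: one
  integrates over an independent copy of the increment first.
\<close>

lemma nn_integral_freeze:
  assumes st: "0 \<le> s" "s \<le> t" and g [measurable]: "g \<in> borel_measurable (F s \<Otimes>\<^sub>M borel)"
  shows "(\<integral>\<^sup>+\<omega>. g (\<omega>, incr s t \<omega>) \<partial>M) = (\<integral>\<^sup>+\<omega>. (\<integral>\<^sup>+\<omega>'. g (\<omega>, incr s t \<omega>') \<partial>M) \<partial>M)"
proof -
  have [measurable]: "(\<lambda>\<omega>. \<omega>) \<in> M \<rightarrow>\<^sub>M F s" "incr s t \<in> M \<rightarrow>\<^sub>M borel"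
    using measurable_incr'[OF st] by (auto intro: measurable_F[OF st(1)])
  interpret D: prob_space "distr M borel (incr s t)" by (rule prob_space_distr) measurable
  have "(\<integral>\<^sup>+\<omega>. g (\<omega>, incr s t \<omega>) \<partial>M) = (\<integral>\<^sup>+z. g z \<partial>distr M (F s \<Otimes>\<^sub>M borel) (\<lambda>\<omega>. (\<omega>, incr s t \<omega>)))"
    by (subst nn_integral_distr) measurable
  also have "\<dots> = (\<integral>\<^sup>+\<omega>. (\<integral>\<^sup>+w. g (\<omega>, w) \<partial>distr M borel (incr s t)) \<partial>distr M (F s) (\<lambda>\<omega>. \<omega>))"
    unfolding distr_incr_product[OF st] by (rule D.nn_integral_fst[symmetric]) measurable
  also have "\<dots> = (\<integral>\<^sup>+\<omega>. (\<integral>\<^sup>+w. g (\<omega>, w) \<partial>distr M borel (incr s t)) \<partial>M)"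
    by (subst nn_integral_distr) measurable
  also have "\<dots> = (\<integral>\<^sup>+\<omega>. (\<integral>\<^sup>+\<omega>'. g (\<omega>, incr s t \<omega>') \<partial>M) \<partial>M)"
    by (intro nn_integral_cong nn_integral_distr) (auto simp: space_F[OF st(1)])
  finally show ?thesis .
qed

lemma integral_freeze:
  fixes g :: "'a \<times> 'h \<Rightarrow> real"
  assumes st: "0 \<le> s" "s \<le> t" and g [measurable]: "g \<in> borel_measurable (F s \<Otimes>\<^sub>M borel)"
    and int: "integrable M (\<lambda>\<omega>. g (\<omega>, incr s t \<omega>))"
  shows "(\<integral>\<omega>. g (\<omega>, incr s t \<omega>) \<partial>M) = (\<integral>\<omega>. (\<integral>\<omega>'. g (\<omega>, incr s t \<omega>') \<partial>M) \<partial>M)"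
proof -
  have [measurable]: "(\<lambda>\<omega>. \<omega>) \<in> M \<rightarrow>\<^sub>M F s" "incr s t \<in> M \<rightarrow>\<^sub>M borel"
    using measurable_incr'[OF st] by (auto intro: measurable_F[OF st(1)])
  interpret D: prob_space "distr M borel (incr s t)" by (rule prob_space_distr) measurable
  interpret D1: prob_space "distr M (F s) (\<lambda>\<omega>. \<omega>)" by (rule prob_space_distr) measurable
  interpret P: pair_prob_space "distr M (F s) (\<lambda>\<omega>. \<omega>)" "distr M borel (incr s t)" ..
  have i2: "integrable (distr M (F s \<Otimes>\<^sub>M borel) (\<lambda>\<omega>. (\<omega>, incr s t \<omega>))) g"
    using int by (subst integrable_distr_eq) measurable
  have "(\<integral>\<omega>. g (\<omega>, incr s t \<omega>) \<partial>M) = (\<integral>z. g z \<partial>distr M (F s \<Otimes>\<^sub>M borel) (\<lambda>\<omega>. (\<omega>, incr s t \<omega>)))"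
    by (subst integral_distr) measurable
  also have "\<dots> = (\<integral>\<omega>. (\<integral>w. g (\<omega>, w) \<partial>distr M borel (incr s t)) \<partial>distr M (F s) (\<lambda>\<omega>. \<omega>))"
    using i2 unfolding distr_incr_product[OF st] by (rule P.integral_fst'[symmetric])
  also have "\<dots> = (\<integral>\<omega>. (\<integral>w. g (\<omega>, w) \<partial>distr M borel (incr s t)) \<partial>M)"
    by (subst integral_distr) measurable
  also have "\<dots> = (\<integral>\<omega>. (\<integral>\<omega>'. g (\<omega>, incr s t \<omega>') \<partial>M) \<partial>M)"
    by (intro Bochner_Integration.integral_cong refl integral_distr) (auto simp: space_F[OF st(1)])
  finally show ?thesis .
qed

lemma nn_integral_incr_inner_square:
  assumes st: "0 \<le> s" "s \<le> t" and K [measurable]: "K \<in> F s \<rightarrow>\<^sub>M borel"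
  shows "(\<integral>\<^sup>+\<omega>. ennreal ((incr s t \<omega> \<bullet> K \<omega>)\<^sup>2) \<partial>M) = (\<integral>\<^sup>+\<omega>. ennreal ((t - s) * (Q (K \<omega>) \<bullet> K \<omega>)) \<partial>M)"
proof -
  have "(\<integral>\<^sup>+\<omega>. ennreal ((incr s t \<omega> \<bullet> K \<omega>)\<^sup>2) \<partial>M) = (\<integral>\<^sup>+\<omega>. (\<integral>\<^sup>+\<omega>'. ennreal ((incr s t \<omega>' \<bullet> K \<omega>)\<^sup>2) \<partial>M) \<partial>M)"
    using nn_integral_freeze[OF st, of "\<lambda>(\<omega>, w). ennreal ((w \<bullet> K \<omega>)\<^sup>2)"] by simp
  also have "\<dots> = (\<integral>\<^sup>+\<omega>. ennreal ((t - s) * (Q (K \<omega>) \<bullet> K \<omega>)) \<partial>M)"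
    using incr_moments[OF st] by (intro nn_integral_cong) (subst nn_integral_eq_integral, auto)
  finally show ?thesis .
qed

lemma integrable_incr_inner_square:
  assumes st: "0 \<le> s" "s \<le> t" and K [measurable]: "K \<in> F s \<rightarrow>\<^sub>M borel"
    and int: "integrable M (\<lambda>\<omega>. Q (K \<omega>) \<bullet> K \<omega>)"
  shows "integrable M (\<lambda>\<omega>. (incr s t \<omega> \<bullet> K \<omega>)\<^sup>2)"
    and "(\<integral>\<omega>. (incr s t \<omega> \<bullet> K \<omega>)\<^sup>2 \<partial>M) = (t - s) * (\<integral>\<omega>. Q (K \<omega>) \<bullet> K \<omega> \<partial>M)"
proof -
  have [measurable]: "incr s t \<in> M \<rightarrow>\<^sub>M borel" "K \<in> M \<rightarrow>\<^sub>M borel"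
    using measurable_incr'[OF st] measurable_F[OF st(1) K] by auto
  have i: "integrable M (\<lambda>\<omega>. (t - s) * (Q (K \<omega>) \<bullet> K \<omega>))" using int by simp
  have eq: "(\<integral>\<^sup>+\<omega>. ennreal ((incr s t \<omega> \<bullet> K \<omega>)\<^sup>2) \<partial>M) = ennreal ((t - s) * (\<integral>\<omega>. Q (K \<omega>) \<bullet> K \<omega> \<partial>M))"
    unfolding nn_integral_incr_inner_square[OF st K]
    using i st Q_nonneg by (subst nn_integral_eq_integral) auto
  have p: "0 \<le> (t - s) * (\<integral>\<omega>. Q (K \<omega>) \<bullet> K \<omega> \<partial>M)"
    using st Q_nonneg by (intro mult_nonneg_nonneg integral_nonneg_AE) auto
  show "integrable M (\<lambda>\<omega>. (incr s t \<omega> \<bullet> K \<omega>)\<^sup>2)"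
    using eq p by (intro integrableI_nn_integral_finite[where x = "(t - s) * (\<integral>\<omega>. Q (K \<omega>) \<bullet> K \<omega> \<partial>M)"]) auto
  show "(\<integral>\<omega>. (incr s t \<omega> \<bullet> K \<omega>)\<^sup>2 \<partial>M) = (t - s) * (\<integral>\<omega>. Q (K \<omega>) \<bullet> K \<omega> \<partial>M)"
    using eq p by (intro integral_eq_nn_integral[THEN trans]) auto
qed

text \<open>
  Freezing the past leaves the mean of a centered Gaussian.
\<close>

lemma integral_mult_incr_inner:
  assumes st: "0 \<le> s" "s \<le> t" and K [measurable]: "K \<in> F s \<rightarrow>\<^sub>M borel"
    and A [measurable]: "A \<in> borel_measurable (F s)"
    and int: "integrable M (\<lambda>\<omega>. A \<omega> * (incr s t \<omega> \<bullet> K \<omega>))"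
  shows "(\<integral>\<omega>. A \<omega> * (incr s t \<omega> \<bullet> K \<omega>) \<partial>M) = 0"
proof -
  have "(\<integral>\<omega>. A \<omega> * (incr s t \<omega> \<bullet> K \<omega>) \<partial>M) = (\<integral>\<omega>. (\<integral>\<omega>'. A \<omega> * (incr s t \<omega>' \<bullet> K \<omega>) \<partial>M) \<partial>M)"
    using integral_freeze[OF st, of "\<lambda>(\<omega>, w). A \<omega> * (w \<bullet> K \<omega>)"] int by simp
  also have "\<dots> = 0" using incr_moments[OF st] by simp
  finally show ?thesis .
qed

text \<open>
  The Ito isometry and the martingale property for sums of increments against vectors that are known
  when the increment starts. General random vectors are allowed, so that a frozen integrand can be
  subtracted from an elementary one. Each new summand is orthogonal to the previous sum.
\<close>

lemma ito_sum:
  fixes p :: "nat \<Rightarrow> real"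
  assumes p0: "0 \<le> p 0" and pm: "\<And>j. p j \<le> p (Suc j)"
    and K: "\<And>j. j < n \<Longrightarrow> K j \<in> F (p j) \<rightarrow>\<^sub>M borel"
    and int: "\<And>j. j < n \<Longrightarrow> integrable M (\<lambda>\<omega>. Q (K j \<omega>) \<bullet> K j \<omega>)"
  defines "L \<equiv> \<lambda>n \<omega>. \<Sum>j<n. incr (p j) (p (Suc j)) \<omega> \<bullet> K j \<omega>"
  shows "L n \<in> borel_measurable (F (p n)) \<and> integrable M (\<lambda>\<omega>. (L n \<omega>)\<^sup>2) \<and>
    (\<integral>\<omega>. (L n \<omega>)\<^sup>2 \<partial>M) = (\<Sum>j<n. (p (Suc j) - p j) * (\<integral>\<omega>. Q (K j \<omega>) \<bullet> K j \<omega> \<partial>M)) \<and>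
    (\<forall>\<eta> C. \<eta> \<in> borel_measurable (F (p 0)) \<longrightarrow> (\<forall>\<omega>. \<bar>\<eta> \<omega>\<bar> \<le> C) \<longrightarrow> (\<integral>\<omega>. \<eta> \<omega> * L n \<omega> \<partial>M) = 0)"
  using K int
proof (induction n)
  case 0
  show ?case by (simp add: L_def)
next
  case (Suc n)
  have pmono: "p i \<le> p j" if "i \<le> j" for i j using that pm by (simp add: lift_Suc_mono_le)
  have pn: "0 \<le> p n" "0 \<le> p (Suc n)" using p0 pmono[of 0 n] pmono[of 0 "Suc n"] by auto
  have Ln [measurable]: "L n \<in> borel_measurable (F (p n))" and Li: "integrable M (\<lambda>\<omega>. (L n \<omega>)\<^sup>2)"
    and Le: "(\<integral>\<omega>. (L n \<omega>)\<^sup>2 \<partial>M) = (\<Sum>j<n. (p (Suc j) - p j) * (\<integral>\<omega>. Q (K j \<omega>) \<bullet> K j \<omega> \<partial>M))"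
    and Lz: "\<And>\<eta> C. \<eta> \<in> borel_measurable (F (p 0)) \<Longrightarrow> (\<forall>\<omega>. \<bar>\<eta> \<omega>\<bar> \<le> C) \<Longrightarrow> (\<integral>\<omega>. \<eta> \<omega> * L n \<omega> \<partial>M) = 0"
    using Suc.IH Suc.prems by (simp_all, blast)
  have Kn [measurable]: "K n \<in> F (p n) \<rightarrow>\<^sub>M borel" using Suc.prems by simp
  define D where "D = (\<lambda>\<omega>. incr (p n) (p (Suc n)) \<omega> \<bullet> K n \<omega>)"
  have [measurable]: "incr (p n) (p (Suc n)) \<in> F (p (Suc n)) \<rightarrow>\<^sub>M borel" using pn pm by (simp add: measurable_incr)
  have Kn' [measurable]: "K n \<in> F (p (Suc n)) \<rightarrow>\<^sub>M borel" and Ln' [measurable]: "L n \<in> borel_measurable (F (p (Suc n)))"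
    by (rule measurable_F_mono[OF pn(1) pm Kn], rule measurable_F_mono[OF pn(1) pm Ln])
  have Dm [measurable]: "D \<in> borel_measurable (F (p (Suc n)))" unfolding D_def by measurable
  have [measurable]: "D \<in> borel_measurable M" "L n \<in> borel_measurable M"
    by (rule measurable_F[OF pn(2) Dm], rule measurable_F[OF pn(2) Ln'])
  have Di: "integrable M (\<lambda>\<omega>. (D \<omega>)\<^sup>2)"
    and De: "(\<integral>\<omega>. (D \<omega>)\<^sup>2 \<partial>M) = (p (Suc n) - p n) * (\<integral>\<omega>. Q (K n \<omega>) \<bullet> K n \<omega> \<partial>M)"
    unfolding D_def using integrable_incr_inner_square[OF pn(1) pm Kn] Suc.prems by auto
  have LDi: "integrable M (\<lambda>\<omega>. L n \<omega> * D \<omega>)"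
    using Li Di by (intro integrable_mult_of_square) auto
  have LD0: "(\<integral>\<omega>. L n \<omega> * D \<omega> \<partial>M) = 0"
    using LDi unfolding D_def by (intro integral_mult_incr_inner[OF pn(1) pm]) auto
  have L: "L (Suc n) = (\<lambda>\<omega>. L n \<omega> + D \<omega>)" by (auto simp: L_def D_def)
  have sq: "(\<lambda>\<omega>. (L (Suc n) \<omega>)\<^sup>2) = (\<lambda>\<omega>. (L n \<omega>)\<^sup>2 + (D \<omega>)\<^sup>2 + 2 * (L n \<omega> * D \<omega>))"
    by (simp add: L power2_sum mult.assoc)
  have "(\<integral>\<omega>. (L (Suc n) \<omega>)\<^sup>2 \<partial>M) = (\<Sum>j<Suc n. (p (Suc j) - p j) * (\<integral>\<omega>. Q (K j \<omega>) \<bullet> K j \<omega> \<partial>M))"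
    unfolding sq using Li Di LDi by (simp add: Le De LD0)
  moreover have "(\<integral>\<omega>. \<eta> \<omega> * L (Suc n) \<omega> \<partial>M) = 0"
    if \<eta>: "\<eta> \<in> borel_measurable (F (p 0))" "\<forall>\<omega>. \<bar>\<eta> \<omega>\<bar> \<le> C" for \<eta> C
  proof -
    have \<eta>n: "\<eta> \<in> borel_measurable (F (p n))"
      by (rule measurable_F_mono[OF p0 pmono \<eta>(1)]) simp
    have [measurable]: "\<eta> \<in> borel_measurable M" by (rule measurable_F[OF p0 \<eta>(1)])
    have "integrable M (\<lambda>\<omega>. (\<eta> \<omega>)\<^sup>2)"
    proof (rule integrable_const_bound[where B = "C\<^sup>2"])
      have "(\<eta> \<omega>)\<^sup>2 \<le> C\<^sup>2" for \<omega>
        using \<eta>(2) power_mono[of "\<bar>\<eta> \<omega>\<bar>" C 2] by simp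
      then show "AE \<omega> in M. norm ((\<eta> \<omega>)\<^sup>2) \<le> C\<^sup>2" by simp
    qed measurable
    then have i: "integrable M (\<lambda>\<omega>. \<eta> \<omega> * L n \<omega>)" "integrable M (\<lambda>\<omega>. \<eta> \<omega> * D \<omega>)"
      using Li Di by (auto intro!: integrable_mult_of_square)
    have "(\<integral>\<omega>. \<eta> \<omega> * D \<omega> \<partial>M) = 0"
      using i(2) \<eta>n unfolding D_def by (intro integral_mult_incr_inner[OF pn(1) pm]) auto
    then show ?thesis using i Lz[OF \<eta>] by (simp add: L distrib_left)
  qed
  ultimately show ?case using Li Di LDi unfolding sq by (auto simp: L)
qed

end

section \<open>Increments of the Ito integral\<close>

text \<open>
  The adjoint of an elementary process, applied to a fixed vector. Coordinates of elementary
  integrals depend on the operators only through it.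
\<close>

definition step_adjoint :: "nat \<Rightarrow> (nat \<Rightarrow> real) \<Rightarrow> (nat \<Rightarrow> 'a \<Rightarrow> ('h::real_inner \<Rightarrow>\<^sub>L 'h)) \<Rightarrow> 'h \<Rightarrow> real \<Rightarrow> 'a \<Rightarrow> 'h" where
  "step_adjoint n \<tau> G v u \<omega> = (\<Sum>j<n. indicator {\<tau> j<..\<tau> (Suc j)} u *\<^sub>R adjoint (blinfun_apply (G j \<omega>)) v)"

lemma adjoint_elem_process:
  fixes G :: "nat \<Rightarrow> 'a \<Rightarrow> ('h::{real_inner, banach} \<Rightarrow>\<^sub>L 'h)"
  shows "adjoint (blinfun_apply (elem_process n \<tau> G u \<omega>)) v = step_adjoint n \<tau> G v u \<omega>"
  by (rule adjoint_blinfun_eqI)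
    (simp add: elem_process_def step_adjoint_def blinfun.sum_left blinfun.scaleR_left
      inner_sum_left inner_sum_right adjoint_blinfun)

lemma elementary_times:
  assumes "elementary F T n \<tau> G"
  shows "\<tau> 0 = 0" "\<tau> n = T" "i \<le> j \<Longrightarrow> j \<le> n \<Longrightarrow> \<tau> i \<le> \<tau> j" "j < n \<Longrightarrow> \<tau> j < \<tau> (Suc j)"
    "j < n \<Longrightarrow> simple_function (F (\<tau> j)) (G j)"
proof -
  show "\<tau> 0 = 0" "\<tau> n = T" "j < n \<Longrightarrow> \<tau> j < \<tau> (Suc j)" "j < n \<Longrightarrow> simple_function (F (\<tau> j)) (G j)"
    using assms by (auto simp: elementary_def)
  show "i \<le> j \<Longrightarrow> j \<le> n \<Longrightarrow> \<tau> i \<le> \<tau> j"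
  proof (induction j rule: dec_induct)
    case (step k)
    then have "\<tau> k < \<tau> (Suc k)" using assms by (auto simp: elementary_def)
    then show ?case using step by simp
  qed simp
qed

lemma ex_grid_interval:
  fixes \<tau> :: "nat \<Rightarrow> real"
  shows "\<tau> 0 < u \<Longrightarrow> u \<le> \<tau> n \<Longrightarrow> \<exists>j<n. \<tau> j < u \<and> u \<le> \<tau> (Suc j)"
proof (induction n)
  case (Suc n)
  show ?case
  proof (cases "u \<le> \<tau> n")
    case True then show ?thesis using Suc by (metis less_SucI)
  next
    case False then show ?thesis using Suc by (intro exI[of _ n]) auto
  qed
qed simp

lemma grid_interval_unique:
  assumes e: "elementary F T n \<tau> G" and j: "j < n" "\<tau> j < u" "u \<le> \<tau> (Suc j)"
    and i: "i < n" "\<tau> i < u" "u \<le> \<tau> (Suc i)"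
  shows "i = j"
proof (rule ccontr)
  assume "i \<noteq> j"
  then consider "Suc i \<le> j" | "Suc j \<le> i" by linarith
  then show False
    using elementary_times(3)[OF e, of "Suc i" j] elementary_times(3)[OF e, of "Suc j" i] i j by cases auto
qed

lemma step_adjoint_on_grid:
  assumes e: "elementary F T n \<tau> G" and j: "j < n" "\<tau> j < u" "u \<le> \<tau> (Suc j)"
  shows "step_adjoint n \<tau> G v u \<omega> = adjoint (blinfun_apply (G j \<omega>)) v"
proof -
  have "step_adjoint n \<tau> G v u \<omega> = (\<Sum>i<n. if i = j then adjoint (blinfun_apply (G j \<omega>)) v else 0)"
    unfolding step_adjoint_def
  proof (intro sum.cong refl)
    fix i assume "i \<in> {..<n}"
    then have "u \<in> {\<tau> i<..\<tau> (Suc i)} \<longleftrightarrow> i = j"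
      using grid_interval_unique[OF e j, of i] j by auto
    then show "indicator {\<tau> i<..\<tau> (Suc i)} u *\<^sub>R adjoint (blinfun_apply (G i \<omega>)) v
      = (if i = j then adjoint (blinfun_apply (G j \<omega>)) v else 0)"
      by (simp add: indicator_def)
  qed
  then show ?thesis using j by simp
qed

lemma borel_measurable_blinfun_apply [measurable (raw)]:
  fixes g :: "'b::real_normed_vector \<Rightarrow>\<^sub>L 'c::real_normed_vector"
  assumes "x \<in> M \<rightarrow>\<^sub>M borel"
  shows "(\<lambda>\<omega>. blinfun_apply g (x \<omega>)) \<in> M \<rightarrow>\<^sub>M borel"
  by (rule borel_measurable_continuous_on[OF _ assms])
     (rule linear_continuous_on[OF blinfun.bounded_linear_right])

text \<open>
  Evaluation is not jointly measurable in general, as the space of operators is not separable; for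
  finitely many operators it is a finite case distinction.
\<close>

lemma measurable_simple_blinfun_apply:
  fixes x :: "'a \<Rightarrow> 'h::{real_normed_vector, second_countable_topology}"
  assumes G: "simple_function M G" and x [measurable]: "x \<in> M \<rightarrow>\<^sub>M borel"
  shows "(\<lambda>\<omega>. blinfun_apply (G \<omega>) (x \<omega>) :: 'h) \<in> M \<rightarrow>\<^sub>M borel"
proof (rule measurable_compose_countable'[where g = G and I = "G ` space M"])
  show "(\<lambda>\<omega>. blinfun_apply g (x \<omega>)) \<in> M \<rightarrow>\<^sub>M borel" for g by measurable
  show "G \<in> M \<rightarrow>\<^sub>M count_space (G ` space M)"
    using G by (auto simp: simple_function_def measurable_count_space_eq2)
  show "countable (G ` space M)" using G by (simp add: simple_function_def countable_finite)
qed

context wiener_filtration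
begin

lemma Q_add_le: "Q (x + y) \<bullet> (x + y) \<le> 2 * (Q x \<bullet> x) + 2 * (Q y \<bullet> y)"
proof (rule psd_add_le[OF blinfun.bounded_linear_right])
  show "Q x \<bullet> y = x \<bullet> Q y" for x y by (rule Q_sym)
  show "0 \<le> x \<bullet> Q x" for x using Q_nonneg[of x] by (simp add: inner_commute[of x])
qed

lemma Q_minus: "Q (- x) \<bullet> (- x) = Q x \<bullet> x"
  by (simp add: blinfun.minus_right)

text \<open>
  A coordinate of an increment of an elementary integral, minus an increment of \<open>W\<close> paired with a
  vector \<open>K\<close> known at time \<open>s\<close>, is an Ito sum on the grid restricted to \<open>[s, t]\<close>. So its variance is the
  energy of the difference of the integrands.
\<close>

lemma elementary_increment:
  fixes v :: 'h
  assumes e: "elementary F T n \<tau> G" and st: "0 \<le> s" "s \<le> t" "t \<le> T"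
    and K [measurable]: "K \<in> F s \<rightarrow>\<^sub>M borel" and Ki: "integrable M (\<lambda>\<omega>. Q (K \<omega>) \<bullet> K \<omega>)"
  defines "L \<equiv> \<lambda>\<omega>. (elem_integral W n \<tau> G t \<omega> - elem_integral W n \<tau> G s \<omega>) \<bullet> v - incr s t \<omega> \<bullet> K \<omega>"
  shows "L \<in> borel_measurable M" "integrable M (\<lambda>\<omega>. (L \<omega>)\<^sup>2)"
    "(\<integral>\<^sup>+\<omega>. ennreal ((L \<omega>)\<^sup>2) \<partial>M) = (\<integral>\<^sup>+\<omega>. (\<integral>\<^sup>+u. indicator {s<..t} u *
        ennreal (Q (step_adjoint n \<tau> G v u \<omega> - K \<omega>) \<bullet> (step_adjoint n \<tau> G v u \<omega> - K \<omega>)) \<partial>lborel) \<partial>M)"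
    "\<And>\<eta> C. \<eta> \<in> borel_measurable (F s) \<Longrightarrow> (\<forall>\<omega>. \<bar>\<eta> \<omega>\<bar> \<le> C) \<Longrightarrow> (\<integral>\<omega>. \<eta> \<omega> * L \<omega> \<partial>M) = 0"
proof -
  note \<tau> = elementary_times[OF e]
  \<comment> \<open>the grid clamped to \<open>[s, t]\<close>; beyond \<open>n\<close> it is constant, so that it is monotone everywhere\<close>
  define p where "p j = max s (min t (\<tau> (min j n)))" for j
  define A where "A j \<omega> = adjoint (blinfun_apply (G j \<omega>)) v" for j \<omega>
  \<comment> \<open>a cell after \<open>t\<close> collapses, and \<open>G j\<close> is not known at its clamped start; there \<open>W\<close> has no increment, so that \<open>0\<close> does as well\<close>
  define K' where "K' j \<omega> = (if p j < p (Suc j) then A j \<omega> - K \<omega> else 0)" for j \<omega>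
  have p0: "p 0 = s" and pn: "p n = t" using st \<tau>(1,2) by (auto simp: p_def)
  have p0': "0 \<le> p 0" using p0 st by simp
  have pm: "p j \<le> p (Suc j)" for j
  proof -
    have "\<tau> (min j n) \<le> \<tau> (min (Suc j) n)" by (rule \<tau>(3)) auto
    then show ?thesis unfolding p_def by (intro max.mono min.mono order_refl)
  qed
  have ps: "s \<le> p j" "p j \<le> t" for j using st by (auto simp: p_def)
  have active: "\<tau> j \<le> p j" "p j = max s (\<tau> j)" "p (Suc j) \<le> \<tau> (Suc j)" if "j < n" "p j < p (Suc j)" for j
  proof -
    have p: "p j = max s (min t (\<tau> j))" "p (Suc j) = max s (min t (\<tau> (Suc j)))"
      using that(1) by (simp_all add: p_def)
    have "\<tau> j < t" "s < \<tau> (Suc j)" using that(2) ps[of "Suc j"] ps[of j] unfolding p by linarith+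
    then show "\<tau> j \<le> p j" "p j = max s (\<tau> j)" "p (Suc j) \<le> \<tau> (Suc j)"
      unfolding p by auto
  qed
  have sub: "\<tau> j < u" "u \<le> \<tau> (Suc j)" "s < u" "u \<le> t" if "j < n" "p j < u" "u \<le> p (Suc j)" for j u
    using active[of j] that ps[of j] ps[of "Suc j"] by linarith+
  have Am: "A j \<in> F (\<tau> j) \<rightarrow>\<^sub>M borel" and Afin: "finite (A j ` space M)" if "j < n" for j
  proof -
    have "simple_function (F (\<tau> j)) (\<lambda>\<omega>. A j \<omega>)"
      unfolding A_def using \<tau>(5)[OF that] by (rule simple_function_compose1)
    moreover have "0 \<le> \<tau> j" using \<tau>(3)[of 0 j] \<tau>(1) that by simp
    ultimately show "A j \<in> F (\<tau> j) \<rightarrow>\<^sub>M borel" "finite (A j ` space M)"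
      by (auto simp: simple_function_def space_F intro: borel_measurable_simple_function)
  qed
  have K'm: "K' j \<in> F (p j) \<rightarrow>\<^sub>M borel" if "j < n" for j
  proof (cases "p j < p (Suc j)")
    case True
    have "0 \<le> \<tau> j" using \<tau>(3)[of 0 j] \<tau>(1) that by simp
    then have [measurable]: "A j \<in> F (p j) \<rightarrow>\<^sub>M borel"
      using active(1)[OF that True] Am[OF that] by (rule measurable_F_mono)
    have [measurable]: "K \<in> F (p j) \<rightarrow>\<^sub>M borel" by (rule measurable_F_mono[OF st(1) ps(1) K])
    have "K' j = (\<lambda>\<omega>. A j \<omega> - K \<omega>)" using True by (simp add: K'_def fun_eq_iff)
    then show ?thesis by simp
  next
    case False
    then have "K' j = (\<lambda>\<omega>. 0)" by (simp add: K'_def fun_eq_iff)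
    then show ?thesis by simp
  qed
  have K'i: "integrable M (\<lambda>\<omega>. Q (K' j \<omega>) \<bullet> K' j \<omega>)" if "j < n" for j
  proof -
    have [measurable]: "K' j \<in> M \<rightarrow>\<^sub>M borel"
      using K'm[OF that] by (rule measurable_F[rotated]) (use ps[of j] st in simp)
    have [measurable]: "A j \<in> M \<rightarrow>\<^sub>M borel"
      using Am[OF that] by (rule measurable_F[rotated]) (use \<tau>(3)[of 0 j] \<tau>(1) that in simp)
    define q where "q x = Q x \<bullet> x" for x
    have fin: "finite ((\<lambda>\<omega>. q (A j \<omega>)) ` space M)"
      using finite_imageI[OF Afin[OF that], of q] by (simp add: image_image)
    define C where "C = Max ((\<lambda>\<omega>. q (A j \<omega>)) ` space M)"
    have "q (A j \<omega>) \<le> C" if "\<omega> \<in> space M" for \<omega>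
      unfolding C_def using fin that by (intro Max_ge) auto
    then have "integrable M (\<lambda>\<omega>. q (A j \<omega>))"
      by (intro integrable_const_bound[where B = C]) (auto simp: q_def Q_nonneg)
    then have i: "integrable M (\<lambda>\<omega>. 2 * q (A j \<omega>) + 2 * q (K \<omega>))" using Ki by (simp add: q_def)
    show ?thesis
    proof (rule Bochner_Integration.integrable_bound[OF i])
      have "q (K' j \<omega>) \<le> 2 * q (A j \<omega>) + 2 * q (K \<omega>)" for \<omega>
        using Q_add_le[of "A j \<omega>" "- K \<omega>"] Q_nonneg[of "A j \<omega>"] Q_nonneg[of "K \<omega>"]
        by (simp add: K'_def q_def Q_minus blinfun.minus_right)
      then show "AE \<omega> in M. norm (Q (K' j \<omega>) \<bullet> K' j \<omega>) \<le> norm (2 * q (A j \<omega>) + 2 * q (K \<omega>))"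
        using Q_nonneg by (auto simp: q_def)
    qed measurable
  qed
  have L_eq: "L \<omega> = (\<Sum>j<n. incr (p j) (p (Suc j)) \<omega> \<bullet> K' j \<omega>)" for \<omega>
  proof -
    have "incr s t \<omega> \<bullet> K \<omega> = (\<Sum>j<n. incr (p j) (p (Suc j)) \<omega> \<bullet> K \<omega>)"
      using sum_lessThan_telescope[of "\<lambda>j. W (p j) \<omega>" n]
      by (simp add: incr_def p0 pn flip: inner_sum_left)
    moreover have "(elem_integral W n \<tau> G t \<omega> - elem_integral W n \<tau> G s \<omega>) \<bullet> v
      = (\<Sum>j<n. incr (p j) (p (Suc j)) \<omega> \<bullet> A j \<omega>)"
    proof -
      have "W (min t (\<tau> (Suc j))) \<omega> - W (min t (\<tau> j)) \<omega> - (W (min s (\<tau> (Suc j))) \<omega> - W (min s (\<tau> j)) \<omega>)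
        = incr (p j) (p (Suc j)) \<omega>" if "j < n" for j
      proof -
        have c: "W (min t x) \<omega> - W (min s x) \<omega> = W (max s (min t x)) \<omega> - W s \<omega>" for x
          using st by (auto simp: min_def max_def)
        have "p j = max s (min t (\<tau> j))" "p (Suc j) = max s (min t (\<tau> (Suc j)))"
          using that by (simp_all add: p_def)
        then have "incr (p j) (p (Suc j)) \<omega> = (W (min t (\<tau> (Suc j))) \<omega> - W (min s (\<tau> (Suc j))) \<omega>)
          - (W (min t (\<tau> j)) \<omega> - W (min s (\<tau> j)) \<omega>)"
          unfolding c by (simp add: incr_def)
        then show ?thesis by simp
      qed
      then have "blinfun_apply (G j \<omega>) (W (min t (\<tau> (Suc j))) \<omega> - W (min t (\<tau> j)) \<omega>) \<bullet> v
        - blinfun_apply (G j \<omega>) (W (min s (\<tau> (Suc j))) \<omega> - W (min s (\<tau> j)) \<omega>) \<bullet> v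
        = incr (p j) (p (Suc j)) \<omega> \<bullet> A j \<omega>" if "j < n" for j
        using that unfolding A_def adjoint_blinfun[symmetric] inner_diff_left[symmetric] blinfun.diff_right[symmetric] by simp
      then show ?thesis unfolding elem_integral_def
        by (simp add: inner_diff_left inner_sum_left flip: sum_subtractf)
    qed
    ultimately have "L \<omega> = (\<Sum>j<n. incr (p j) (p (Suc j)) \<omega> \<bullet> (A j \<omega> - K \<omega>))"
      by (simp add: L_def inner_diff_right sum_subtractf)
    also have "\<dots> = (\<Sum>j<n. incr (p j) (p (Suc j)) \<omega> \<bullet> K' j \<omega>)"
    proof (intro sum.cong refl)
      fix j
      show "incr (p j) (p (Suc j)) \<omega> \<bullet> (A j \<omega> - K \<omega>) = incr (p j) (p (Suc j)) \<omega> \<bullet> K' j \<omega>"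
        using pm[of j] by (cases "p j < p (Suc j)") (auto simp: K'_def incr_def)
    qed
    finally show ?thesis .
  qed
  note iso = ito_sum[where p = p and n = n and K = K', OF p0' pm K'm K'i, folded L_eq]
  have Lm: "L \<in> borel_measurable (F t)" and Li: "integrable M (\<lambda>\<omega>. (L \<omega>)\<^sup>2)"
    and LE: "(\<integral>\<omega>. (L \<omega>)\<^sup>2 \<partial>M) = (\<Sum>j<n. (p (Suc j) - p j) * (\<integral>\<omega>. Q (K' j \<omega>) \<bullet> K' j \<omega> \<partial>M))"
    using iso by (simp_all add: pn)
  show "L \<in> borel_measurable M" using Lm by (rule measurable_F[rotated]) (use st in simp)
  show "integrable M (\<lambda>\<omega>. (L \<omega>)\<^sup>2)" by (rule Li)
  show "(\<integral>\<omega>. \<eta> \<omega> * L \<omega> \<partial>M) = 0" if "\<eta> \<in> borel_measurable (F s)" "\<forall>\<omega>. \<bar>\<eta> \<omega>\<bar> \<le> C" for \<eta> C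
    using iso that unfolding p0 by blast
  define q where "q x = ennreal (Q x \<bullet> x)" for x
  \<comment> \<open>pointwise in time, the Ito sum is the restriction of the elementary integrand to \<open>(s, t]\<close>\<close>
  have pt: "indicator {s<..t} u * q (step_adjoint n \<tau> G v u \<omega> - K \<omega>)
      = (\<Sum>j<n. q (K' j \<omega>) * indicator {p j<..p (Suc j)} u)" for u \<omega>
  proof (cases "u \<in> {s<..t}")
    case True
    then obtain j where j: "j < n" "\<tau> j < u" "u \<le> \<tau> (Suc j)"
      using ex_grid_interval[of \<tau> u n] st \<tau>(1,2) by auto
    then have uj: "p j < u" "u \<le> p (Suc j)" using True by (auto simp: p_def)
    have "(\<Sum>i<n. q (K' i \<omega>) * indicator {p i<..p (Suc i)} u) = (\<Sum>i<n. if i = j then q (K' j \<omega>) else 0)"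
    proof (intro sum.cong refl)
      fix i assume i: "i \<in> {..<n}"
      have "u \<in> {p i<..p (Suc i)} \<longleftrightarrow> i = j"
        using grid_interval_unique[OF e j, of i] sub[of i u] i uj by auto
      then show "q (K' i \<omega>) * indicator {p i<..p (Suc i)} u = (if i = j then q (K' j \<omega>) else 0)"
        by (simp add: indicator_def)
    qed
    also have "\<dots> = q (A j \<omega> - K \<omega>)" using j uj by (simp add: K'_def)
    finally show ?thesis using True step_adjoint_on_grid[OF e j] by (simp add: A_def)
  next
    case False
    have "(\<Sum>j<n. q (K' j \<omega>) * indicator {p j<..p (Suc j)} u) = 0"
    proof (intro sum.neutral ballI)
      fix j assume "j \<in> {..<n}"
      then have "u \<notin> {p j<..p (Suc j)}" using sub(3,4)[of j u] False by auto
      then show "q (K' j \<omega>) * indicator {p j<..p (Suc j)} u = 0" by simp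
    qed
    then show ?thesis using False by simp
  qed
  have K'M [measurable]: "K' j \<in> M \<rightarrow>\<^sub>M borel" if "j < n" for j
    using K'm[OF that] by (rule measurable_F[rotated]) (use ps[of j] st in simp)
  have "(\<integral>\<^sup>+\<omega>. (\<integral>\<^sup>+u. indicator {s<..t} u * q (step_adjoint n \<tau> G v u \<omega> - K \<omega>) \<partial>lborel) \<partial>M)
    = (\<integral>\<^sup>+\<omega>. (\<Sum>j<n. q (K' j \<omega>) * ennreal (p (Suc j) - p j)) \<partial>M)"
    unfolding pt
  proof (intro nn_integral_cong)
    fix \<omega>
    have "(\<integral>\<^sup>+u. (\<Sum>j<n. q (K' j \<omega>) * indicator {p j<..p (Suc j)} u) \<partial>lborel)
      = (\<Sum>j<n. \<integral>\<^sup>+u. q (K' j \<omega>) * indicator {p j<..p (Suc j)} u \<partial>lborel)"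
      by (rule nn_integral_sum) measurable
    also have "\<dots> = (\<Sum>j<n. q (K' j \<omega>) * ennreal (p (Suc j) - p j))"
      using pm by (intro sum.cong refl) (subst nn_integral_cmult_indicator, simp_all)
    finally show "(\<integral>\<^sup>+u. (\<Sum>j<n. q (K' j \<omega>) * indicator {p j<..p (Suc j)} u) \<partial>lborel)
      = (\<Sum>j<n. q (K' j \<omega>) * ennreal (p (Suc j) - p j))" .
  qed
  also have "\<dots> = (\<Sum>j<n. (\<integral>\<^sup>+\<omega>. q (K' j \<omega>) * ennreal (p (Suc j) - p j) \<partial>M))"
    by (rule nn_integral_sum) (auto simp: q_def)
  also have "\<dots> = (\<Sum>j<n. ennreal ((p (Suc j) - p j) * (\<integral>\<omega>. Q (K' j \<omega>) \<bullet> K' j \<omega> \<partial>M)))"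
  proof (intro sum.cong refl)
    fix j assume j: "j \<in> {..<n}"
    then have "(\<integral>\<^sup>+\<omega>. q (K' j \<omega>) \<partial>M) = ennreal (\<integral>\<omega>. Q (K' j \<omega>) \<bullet> K' j \<omega> \<partial>M)"
      unfolding q_def using K'i[of j] Q_nonneg by (intro nn_integral_eq_integral) auto
    then show "(\<integral>\<^sup>+\<omega>. q (K' j \<omega>) * ennreal (p (Suc j) - p j) \<partial>M)
      = ennreal ((p (Suc j) - p j) * (\<integral>\<omega>. Q (K' j \<omega>) \<bullet> K' j \<omega> \<partial>M))"
      using j pm[of j] by (subst nn_integral_multc) (auto simp: q_def ennreal_mult' mult.commute)
  qed
  also have "\<dots> = ennreal (\<integral>\<omega>. (L \<omega>)\<^sup>2 \<partial>M)"
    unfolding LE using pm Q_nonneg by (intro sum_ennreal) (auto intro!: mult_nonneg_nonneg integral_nonneg_AE)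
  also have "\<dots> = (\<integral>\<^sup>+\<omega>. ennreal ((L \<omega>)\<^sup>2) \<partial>M)"
    using Li by (intro nn_integral_eq_integral[symmetric]) auto
  finally show "(\<integral>\<^sup>+\<omega>. ennreal ((L \<omega>)\<^sup>2) \<partial>M) = (\<integral>\<^sup>+\<omega>. (\<integral>\<^sup>+u. indicator {s<..t} u *
        ennreal (Q (step_adjoint n \<tau> G v u \<omega> - K \<omega>) \<bullet> (step_adjoint n \<tau> G v u \<omega> - K \<omega>)) \<partial>lborel) \<partial>M)"
    unfolding q_def by simp
qed

lemma measurable_elem_integral:
  assumes e: "elementary F T n \<tau> G" and t: "0 \<le> t"
  shows "elem_integral W n \<tau> G t \<in> M \<rightarrow>\<^sub>M borel"
  unfolding elem_integral_def[abs_def]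
proof (intro borel_measurable_sum measurable_simple_blinfun_apply)
  fix j assume j: "j \<in> {..<n}"
  note \<tau> = elementary_times[OF e]
  have "0 \<le> \<tau> j" "0 \<le> \<tau> (Suc j)" using \<tau>(3)[of 0 j] \<tau>(3)[of 0 "Suc j"] \<tau>(1) j by auto
  then show "(\<lambda>\<omega>. W (min t (\<tau> (Suc j))) \<omega> - W (min t (\<tau> j)) \<omega>) \<in> M \<rightarrow>\<^sub>M borel"
    using t by (intro borel_measurable_diff measurable_F[OF _ measurable_W]) auto
  have s: "sets (F (\<tau> j)) \<subseteq> sets M" "space (F (\<tau> j)) = space M"
    using F_subalgebra[OF \<open>0 \<le> \<tau> j\<close>] by (auto simp: subalgebra_def)
  show "simple_function M (G j)"
    using \<tau>(5)[of j] j s unfolding simple_function_def by auto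
qed

lemma measurable_step_adjoint:
  fixes v :: 'h
  assumes e: "elementary F T n \<tau> G"
  shows "(\<lambda>(\<omega>, u). step_adjoint n \<tau> G v u \<omega>) \<in> M \<Otimes>\<^sub>M lborel \<rightarrow>\<^sub>M borel"
proof -
  note \<tau> = elementary_times[OF e]
  have [measurable]: "(\<lambda>\<omega>. adjoint (blinfun_apply (G j \<omega>)) v) \<in> M \<rightarrow>\<^sub>M borel" if "j < n" for j
  proof -
    have "0 \<le> \<tau> j" using \<tau>(3)[of 0 j] \<tau>(1) that by simp
    moreover have "simple_function (F (\<tau> j)) (\<lambda>\<omega>. adjoint (blinfun_apply (G j \<omega>)) v)"
      using \<tau>(5)[OF that] by (rule simple_function_compose1)
    ultimately show ?thesis by (intro measurable_F[OF _ borel_measurable_simple_function])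
  qed
  show ?thesis unfolding step_adjoint_def split_beta'
  proof (intro borel_measurable_sum)
    fix j assume "j \<in> {..<n}"
    then have [measurable]: "(\<lambda>\<omega>. adjoint (blinfun_apply (G j \<omega>)) v) \<in> M \<rightarrow>\<^sub>M borel" by simp
    show "(\<lambda>z. indicat_real {\<tau> j<..\<tau> (Suc j)} (snd z) *\<^sub>R adjoint (blinfun_apply (G j (fst z))) v)
      \<in> M \<Otimes>\<^sub>M lborel \<rightarrow>\<^sub>M borel" by measurable
  qed
qed

lemma square_add_le:
  fixes x y :: real
  shows "(x + y)\<^sup>2 \<le> 2 * x\<^sup>2 + 2 * y\<^sup>2"
proof -
  have "0 \<le> (x - y)\<^sup>2" by simp
  then show ?thesis by (simp add: power2_eq_square algebra_simps)
qed

lemma ennreal_two_squares: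
  assumes "z \<le> 2 * x\<^sup>2 + 2 * (y::real)\<^sup>2"
  shows "ennreal z \<le> 2 * ennreal (x\<^sup>2) + 2 * ennreal (y\<^sup>2)"
proof -
  have "ennreal (2 * x\<^sup>2 + 2 * y\<^sup>2) = ennreal 2 * ennreal (x\<^sup>2) + ennreal 2 * ennreal (y\<^sup>2)"
    by (subst ennreal_plus, simp_all only: ennreal_mult zero_le_power2 zero_le_numeral mult_nonneg_nonneg)
  then show ?thesis using ennreal_leI[OF assms] by simp
qed

text \<open>
  The coordinate along \<open>v\<close> of a vector is at most its norm; so mean-square approximation of \<open>I\<close> at the
  two times suffices.
\<close>

lemma elementary_increment_distance:
  assumes e: "elementary F T n \<tau> G" and st: "0 \<le> s" "s \<le> t" "t \<le> T"
    and I [measurable]: "I s \<in> M \<rightarrow>\<^sub>M borel" "I t \<in> M \<rightarrow>\<^sub>M borel" and v: "norm v \<le> 1"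
  shows "(\<integral>\<^sup>+\<omega>. ennreal (((I t \<omega> - I s \<omega>) \<bullet> v - (elem_integral W n \<tau> G t \<omega> - elem_integral W n \<tau> G s \<omega>) \<bullet> v)\<^sup>2) \<partial>M)
    \<le> 2 * (\<integral>\<^sup>+\<omega>. ennreal ((norm (I t \<omega> - elem_integral W n \<tau> G t \<omega>))\<^sup>2) \<partial>M)
      + 2 * (\<integral>\<^sup>+\<omega>. ennreal ((norm (I s \<omega> - elem_integral W n \<tau> G s \<omega>))\<^sup>2) \<partial>M)"
    (is "?l \<le> 2 * ?a + 2 * ?b")
proof -
  let ?J = "elem_integral W n \<tau> G"
  have [measurable]: "?J s \<in> M \<rightarrow>\<^sub>M borel" "?J t \<in> M \<rightarrow>\<^sub>M borel"
    using measurable_elem_integral[OF e] st by auto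
  have "((I t \<omega> - I s \<omega>) \<bullet> v - (?J t \<omega> - ?J s \<omega>) \<bullet> v)\<^sup>2
    \<le> 2 * (norm (I t \<omega> - ?J t \<omega>))\<^sup>2 + 2 * (norm (I s \<omega> - ?J s \<omega>))\<^sup>2" for \<omega>
  proof -
    let ?x = "(I t \<omega> - ?J t \<omega>) \<bullet> v" and ?y = "- ((I s \<omega> - ?J s \<omega>) \<bullet> v)"
    have sq: "((z::'h) \<bullet> v)\<^sup>2 \<le> (norm z)\<^sup>2" for z
    proof -
      have "\<bar>z \<bullet> v\<bar> \<le> norm z * norm v" by (rule Cauchy_Schwarz_ineq2)
      also have "\<dots> \<le> norm z" using v by (simp add: mult_left_le)
      finally show ?thesis using abs_le_square_iff[of "z \<bullet> v" "norm z"] by simp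
    qed
    have "(I t \<omega> - I s \<omega>) \<bullet> v - (?J t \<omega> - ?J s \<omega>) \<bullet> v = ?x + ?y"
      by (simp add: inner_diff_left)
    then have "((I t \<omega> - I s \<omega>) \<bullet> v - (?J t \<omega> - ?J s \<omega>) \<bullet> v)\<^sup>2 \<le> 2 * ?x\<^sup>2 + 2 * ?y\<^sup>2"
      using square_add_le[of ?x ?y] by simp
    also have "\<dots> \<le> 2 * (norm (I t \<omega> - ?J t \<omega>))\<^sup>2 + 2 * (norm (I s \<omega> - ?J s \<omega>))\<^sup>2"
      using sq[of "I t \<omega> - ?J t \<omega>"] sq[of "I s \<omega> - ?J s \<omega>"] by simp
    finally show ?thesis .
  qed
  then have "?l \<le> (\<integral>\<^sup>+\<omega>. 2 * ennreal ((norm (I t \<omega> - ?J t \<omega>))\<^sup>2) + 2 * ennreal ((norm (I s \<omega> - ?J s \<omega>))\<^sup>2) \<partial>M)"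
    by (intro nn_integral_mono ennreal_two_squares)
  also have "\<dots> = 2 * ?a + 2 * ?b"
    by (subst nn_integral_add) (auto simp: nn_integral_cmult)
  finally show ?thesis .
qed

text \<open>
  The energy of \<open>S - K\<close>, with \<open>S\<close> the elementary integrand, is at most twice the energy of \<open>A - S\<close> plus
  twice that of \<open>A - K\<close>. The former is at most the approximation error in Hilbert-Schmidt norm. The
  integrals are split on the side of \<open>A\<close> and \<open>S\<close>, which are jointly measurable; the Hilbert-Schmidt norm
  enters by monotonicity alone, as its measurability in time and sample point is unclear.
\<close>

lemma elementary_energy_bound:
  assumes inf: "infinite_dimensional TYPE('h)"
    and e: "elementary F T n \<tau> G" and st: "0 \<le> s" "s \<le> t" "t \<le> T"
    and v: "norm v \<le> 1" and K [measurable]: "K \<in> M \<rightarrow>\<^sub>M borel"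
    and Am [measurable]: "(\<lambda>(\<omega>, u). A u \<omega>) \<in> M \<Otimes>\<^sub>M lborel \<rightarrow>\<^sub>M borel"
    and A: "\<And>u \<omega>. u \<in> {0..T} \<Longrightarrow> adjoint (blinfun_apply (\<Phi> u \<omega>)) v = A u \<omega>"
  shows "(\<integral>\<^sup>+\<omega>. (\<integral>\<^sup>+u. indicator {s<..t} u *
        ennreal (Q (step_adjoint n \<tau> G v u \<omega> - K \<omega>) \<bullet> (step_adjoint n \<tau> G v u \<omega> - K \<omega>)) \<partial>lborel) \<partial>M)
    \<le> 2 * energy M Q T (\<lambda>u \<omega>. \<Phi> u \<omega> - elem_process n \<tau> G u \<omega>)
      + 2 * (\<integral>\<^sup>+\<omega>. (\<integral>\<^sup>+u. indicator {s<..t} u * ennreal (Q (A u \<omega> - K \<omega>) \<bullet> (A u \<omega> - K \<omega>)) \<partial>lborel) \<partial>M)"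
    (is "?l \<le> 2 * ?e + 2 * ?d")
proof -
  define S where "S u \<omega> = step_adjoint n \<tau> G v u \<omega>" for u \<omega>
  have [measurable]: "(\<lambda>(\<omega>, u). S u \<omega>) \<in> M \<Otimes>\<^sub>M lborel \<rightarrow>\<^sub>M borel"
    unfolding S_def by (rule measurable_step_adjoint[OF e])
  define q where "q x = ennreal (Q x \<bullet> x)" for x
  have [measurable]: "q \<in> borel_measurable borel" unfolding q_def by measurable
  let ?i = "\<lambda>u. indicator {s<..t} u :: ennreal"
  have "q (S u \<omega> - K \<omega>) \<le> 2 * q (A u \<omega> - S u \<omega>) + 2 * q (A u \<omega> - K \<omega>)" for u \<omega>
  proof -
    have "Q (S u \<omega> - K \<omega>) \<bullet> (S u \<omega> - K \<omega>) \<le>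
      2 * (Q (A u \<omega> - S u \<omega>) \<bullet> (A u \<omega> - S u \<omega>)) + 2 * (Q (A u \<omega> - K \<omega>) \<bullet> (A u \<omega> - K \<omega>))"
      using Q_add_le[of "- (A u \<omega> - S u \<omega>)" "A u \<omega> - K \<omega>"] unfolding Q_minus by simp
    then have "q (S u \<omega> - K \<omega>) \<le> ennreal (2 * (Q (A u \<omega> - S u \<omega>) \<bullet> (A u \<omega> - S u \<omega>)) + 2 * (Q (A u \<omega> - K \<omega>) \<bullet> (A u \<omega> - K \<omega>)))"
      unfolding q_def by (rule ennreal_leI)
    also have "\<dots> = 2 * q (A u \<omega> - S u \<omega>) + 2 * q (A u \<omega> - K \<omega>)"
      unfolding q_def using Q_nonneg by (simp add: ennreal_mult)
    finally show ?thesis .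
  qed
  then have "?l \<le> (\<integral>\<^sup>+\<omega>. (\<integral>\<^sup>+u. 2 * (?i u * q (A u \<omega> - S u \<omega>)) + 2 * (?i u * q (A u \<omega> - K \<omega>)) \<partial>lborel) \<partial>M)"
    unfolding S_def[symmetric] q_def[symmetric]
    by (intro nn_integral_mono) (simp add: indicator_def)
  also have "\<dots> = (\<integral>\<^sup>+\<omega>. 2 * (\<integral>\<^sup>+u. ?i u * q (A u \<omega> - S u \<omega>) \<partial>lborel) + 2 * (\<integral>\<^sup>+u. ?i u * q (A u \<omega> - K \<omega>) \<partial>lborel) \<partial>M)"
  proof (intro nn_integral_cong)
    fix \<omega> assume [measurable]: "\<omega> \<in> space M"
    have [measurable]: "(\<lambda>u. S u \<omega>) \<in> borel_measurable lborel" "(\<lambda>u. A u \<omega>) \<in> borel_measurable lborel"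
      by measurable
    show "(\<integral>\<^sup>+u. 2 * (?i u * q (A u \<omega> - S u \<omega>)) + 2 * (?i u * q (A u \<omega> - K \<omega>)) \<partial>lborel)
      = 2 * (\<integral>\<^sup>+u. ?i u * q (A u \<omega> - S u \<omega>) \<partial>lborel) + 2 * (\<integral>\<^sup>+u. ?i u * q (A u \<omega> - K \<omega>) \<partial>lborel)"
      by (subst nn_integral_add) (auto simp: nn_integral_cmult)
  qed
  also have "\<dots> = 2 * (\<integral>\<^sup>+\<omega>. (\<integral>\<^sup>+u. ?i u * q (A u \<omega> - S u \<omega>) \<partial>lborel) \<partial>M) + 2 * ?d"
    unfolding q_def[symmetric]
    by (subst nn_integral_add) (auto simp: nn_integral_cmult)
  also have "\<dots> \<le> 2 * ?e + 2 * ?d"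
  proof -
    have "?i u * q (A u \<omega> - S u \<omega>) \<le> hs_norm_sq Q (\<Phi> u \<omega> - elem_process n \<tau> G u \<omega>) * indicator {0..T} u" for u \<omega>
    proof (cases "u \<in> {s<..t}")
      case True
      then have u: "u \<in> {0..T}" using st by auto
      have "adjoint (blinfun_apply (\<Phi> u \<omega> - elem_process n \<tau> G u \<omega>)) v = A u \<omega> - S u \<omega>"
      proof (rule adjoint_blinfun_eqI)
        fix x
        show "blinfun_apply (\<Phi> u \<omega> - elem_process n \<tau> G u \<omega>) x \<bullet> v = x \<bullet> (A u \<omega> - S u \<omega>)"
          unfolding S_def adjoint_elem_process[symmetric] A[OF u, symmetric]
          by (simp add: blinfun.diff_left inner_diff_left inner_diff_right adjoint_blinfun)
      qed
      then have "q (A u \<omega> - S u \<omega>) \<le> ennreal ((norm v)\<^sup>2) * hs_norm_sq Q (\<Phi> u \<omega> - elem_process n \<tau> G u \<omega>)"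
        using quadratic_form_le_hs_norm_sq[OF inf cov, of "\<Phi> u \<omega> - elem_process n \<tau> G u \<omega>" v] by (simp add: q_def)
      also have "\<dots> \<le> 1 * hs_norm_sq Q (\<Phi> u \<omega> - elem_process n \<tau> G u \<omega>)"
        using v by (intro mult_right_mono) (auto simp: power_le_one)
      finally show ?thesis using True u by simp
    qed simp
    then have "(\<integral>\<^sup>+\<omega>. (\<integral>\<^sup>+u. ?i u * q (A u \<omega> - S u \<omega>) \<partial>lborel) \<partial>M) \<le> ?e"
      unfolding energy_def by (intro nn_integral_mono)
    then show ?thesis by (intro add_right_mono mult_left_mono) auto
  qed
  finally show ?thesis .
qed

text \<open>
  One direction of the Ito isometry, with a constant \<open>4\<close>: on a short interval the integral is close to
  the integral of its integrand frozen at the initial time, represented by \<open>K\<close>. The constant comes from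
  splitting squares twice, first to replace \<open>I\<close> by an elementary integral and then to replace the
  elementary integrand by \<open>A\<close>; both replacements cost nothing in the limit.
\<close>

theorem ito_integral_increment_error:
  assumes inf: "infinite_dimensional TYPE('h)"
    and ito: "ito_integral M F Q W T \<Phi> I" and st: "0 \<le> s" "s \<le> t" "t \<le> T" and v: "norm v \<le> 1"
    and K [measurable]: "K \<in> F s \<rightarrow>\<^sub>M borel" and Ki: "integrable M (\<lambda>\<omega>. Q (K \<omega>) \<bullet> K \<omega>)"
    and Am [measurable]: "(\<lambda>(\<omega>, u). A u \<omega>) \<in> M \<Otimes>\<^sub>M lborel \<rightarrow>\<^sub>M borel"
    and A: "\<And>u \<omega>. u \<in> {0..T} \<Longrightarrow> adjoint (blinfun_apply (\<Phi> u \<omega>)) v = A u \<omega>"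
  shows "(\<integral>\<^sup>+\<omega>. ennreal (((I t \<omega> - I s \<omega>) \<bullet> v - incr s t \<omega> \<bullet> K \<omega>)\<^sup>2) \<partial>M)
    \<le> 4 * (\<integral>\<^sup>+\<omega>. (\<integral>\<^sup>+u. indicator {s<..t} u * ennreal (Q (A u \<omega> - K \<omega>) \<bullet> (A u \<omega> - K \<omega>)) \<partial>lborel) \<partial>M)"
    (is "?l \<le> 4 * ?d")
proof -
  obtain N \<tau> G where e: "\<And>i. elementary F T (N i) (\<tau> i) (G i)"
    and en: "(\<lambda>i. energy M Q T (\<lambda>s \<omega>. \<Phi> s \<omega> - elem_process (N i) (\<tau> i) (G i) s \<omega>)) \<longlonglongrightarrow> 0" (is "?en \<longlonglongrightarrow> 0")
    and J: "\<And>t. t \<in> {0..T} \<Longrightarrow> (\<lambda>i. \<integral>\<^sup>+\<omega>. ennreal ((norm (I t \<omega> - elem_integral W (N i) (\<tau> i) (G i) t \<omega>))\<^sup>2) \<partial>M) \<longlonglongrightarrow> 0"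
    using ito unfolding ito_integral_def by blast
  let ?J = "\<lambda>i t. \<integral>\<^sup>+\<omega>. ennreal ((norm (I t \<omega> - elem_integral W (N i) (\<tau> i) (G i) t \<omega>))\<^sup>2) \<partial>M"
  have Im: "I u \<in> M \<rightarrow>\<^sub>M borel" if "u \<in> {0..T}" for u
    using ito that unfolding ito_integral_def by (auto intro: measurable_F)
  have [measurable]: "I s \<in> M \<rightarrow>\<^sub>M borel" "I t \<in> M \<rightarrow>\<^sub>M borel" "K \<in> M \<rightarrow>\<^sub>M borel" "incr s t \<in> M \<rightarrow>\<^sub>M borel"
    using Im st measurable_F[OF st(1) K] measurable_incr'[OF st(1,2)] by auto
  have le: "?l \<le> 4 * ?J i t + 4 * ?J i s + 4 * ?en i + 4 * ?d" for i
  proof -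
    let ?E = "elem_integral W (N i) (\<tau> i) (G i)"
    have [measurable]: "?E s \<in> M \<rightarrow>\<^sub>M borel" "?E t \<in> M \<rightarrow>\<^sub>M borel"
      using measurable_elem_integral[OF e] st by auto
    let ?x = "\<lambda>\<omega>. (I t \<omega> - I s \<omega>) \<bullet> v - (?E t \<omega> - ?E s \<omega>) \<bullet> v"
    let ?y = "\<lambda>\<omega>. (?E t \<omega> - ?E s \<omega>) \<bullet> v - incr s t \<omega> \<bullet> K \<omega>"
    have "?l \<le> (\<integral>\<^sup>+\<omega>. 2 * ennreal ((?x \<omega>)\<^sup>2) + 2 * ennreal ((?y \<omega>)\<^sup>2) \<partial>M)"
    proof (intro nn_integral_mono)
      fix \<omega>
      have "((I t \<omega> - I s \<omega>) \<bullet> v - incr s t \<omega> \<bullet> K \<omega>)\<^sup>2 \<le> 2 * (?x \<omega>)\<^sup>2 + 2 * (?y \<omega>)\<^sup>2"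
        using square_add_le[of "?x \<omega>" "?y \<omega>"] by simp
      then show "ennreal (((I t \<omega> - I s \<omega>) \<bullet> v - incr s t \<omega> \<bullet> K \<omega>)\<^sup>2) \<le> 2 * ennreal ((?x \<omega>)\<^sup>2) + 2 * ennreal ((?y \<omega>)\<^sup>2)"
        by (rule ennreal_two_squares)
    qed
    also have "\<dots> = 2 * (\<integral>\<^sup>+\<omega>. ennreal ((?x \<omega>)\<^sup>2) \<partial>M) + 2 * (\<integral>\<^sup>+\<omega>. ennreal ((?y \<omega>)\<^sup>2) \<partial>M)"
      by (subst nn_integral_add) (auto simp: nn_integral_cmult)
    also have "\<dots> \<le> 2 * (2 * ?J i t + 2 * ?J i s) + 2 * (2 * ?en i + 2 * ?d)"
    proof (intro add_mono mult_left_mono)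
      show "(\<integral>\<^sup>+\<omega>. ennreal ((?x \<omega>)\<^sup>2) \<partial>M) \<le> 2 * ?J i t + 2 * ?J i s"
        by (rule elementary_increment_distance[OF e st _ _ v]) measurable
      show "(\<integral>\<^sup>+\<omega>. ennreal ((?y \<omega>)\<^sup>2) \<partial>M) \<le> 2 * ?en i + 2 * ?d"
        unfolding elementary_increment(3)[OF e st K Ki]
        by (rule elementary_energy_bound[OF inf e st v _ Am A]) measurable
    qed auto
    also have "\<dots> = 4 * ?J i t + 4 * ?J i s + 4 * ?en i + 4 * ?d"
      by (simp add: distrib_left add.assoc mult.assoc[symmetric])
    finally show ?thesis .
  qed
  have "(\<lambda>i. 4 * ?J i t + 4 * ?J i s + 4 * ?en i + 4 * ?d) \<longlonglongrightarrow> 4 * 0 + 4 * 0 + 4 * 0 + 4 * ?d"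
  proof (rule tendsto_add[OF tendsto_add[OF tendsto_add] tendsto_const])
    show "(\<lambda>i. 4 * ?J i t) \<longlonglongrightarrow> 4 * 0" by (rule ennreal_tendsto_cmult[OF _ J]) (use st in simp_all)
    show "(\<lambda>i. 4 * ?J i s) \<longlonglongrightarrow> 4 * 0" by (rule ennreal_tendsto_cmult[OF _ J]) (use st in simp_all)
    show "(\<lambda>i. 4 * ?en i) \<longlonglongrightarrow> 4 * 0" by (rule ennreal_tendsto_cmult[OF _ en]) simp
  qed
  then have "(\<lambda>i. 4 * ?J i t + 4 * ?J i s + 4 * ?en i + 4 * ?d) \<longlonglongrightarrow> 4 * ?d" by simp
  then show ?thesis by (rule LIMSEQ_le_const) (use le in blast)
qed

text \<open>
  Increments of the Ito integral are orthogonal to bounded functions of the past, since this holds for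
  elementary integrals and passes to mean-square limits.
\<close>

theorem ito_integral_increment_mean_zero:
  assumes ito: "ito_integral M F Q W T \<Phi> I" and st: "0 \<le> s" "s \<le> t" "t \<le> T" and v: "norm v \<le> 1"
    and \<eta>: "\<eta> \<in> borel_measurable (F s)" and \<eta>C: "\<forall>\<omega>. \<bar>\<eta> \<omega>\<bar> \<le> C"
  shows "integrable M (\<lambda>\<omega>. ((I t \<omega> - I s \<omega>) \<bullet> v)\<^sup>2)" "integrable M (\<lambda>\<omega>. \<eta> \<omega> * ((I t \<omega> - I s \<omega>) \<bullet> v))"
    "(\<integral>\<omega>. \<eta> \<omega> * ((I t \<omega> - I s \<omega>) \<bullet> v) \<partial>M) = 0"
proof -
  obtain N \<tau> G where e: "\<And>i. elementary F T (N i) (\<tau> i) (G i)"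
    and J: "\<And>t. t \<in> {0..T} \<Longrightarrow> (\<lambda>i. \<integral>\<^sup>+\<omega>. ennreal ((norm (I t \<omega> - elem_integral W (N i) (\<tau> i) (G i) t \<omega>))\<^sup>2) \<partial>M) \<longlonglongrightarrow> 0"
    using ito unfolding ito_integral_def by blast
  let ?J = "\<lambda>i t. \<integral>\<^sup>+\<omega>. ennreal ((norm (I t \<omega> - elem_integral W (N i) (\<tau> i) (G i) t \<omega>))\<^sup>2) \<partial>M"
  have Im: "I u \<in> M \<rightarrow>\<^sub>M borel" if "u \<in> {0..T}" for u
    using ito that unfolding ito_integral_def by (auto intro: measurable_F)
  have [measurable]: "I s \<in> M \<rightarrow>\<^sub>M borel" "I t \<in> M \<rightarrow>\<^sub>M borel" "\<eta> \<in> borel_measurable M"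
    using Im st measurable_F[OF st(1) \<eta>] by auto
  define D where "D \<omega> = (I t \<omega> - I s \<omega>) \<bullet> v" for \<omega>
  define L where "L i \<omega> = (elem_integral W (N i) (\<tau> i) (G i) t \<omega> - elem_integral W (N i) (\<tau> i) (G i) s \<omega>) \<bullet> v" for i \<omega>
  have [measurable]: "D \<in> borel_measurable M" unfolding D_def by measurable
  have L: "L i \<in> borel_measurable M" "integrable M (\<lambda>\<omega>. (L i \<omega>)\<^sup>2)" "(\<integral>\<omega>. \<eta> \<omega> * L i \<omega> \<partial>M) = 0" for i
    using elementary_increment(1,2)[OF e[of i] st, where K = "\<lambda>_. 0" and v = v]
      elementary_increment(4)[OF e[of i] st _ _ \<eta> \<eta>C, where K = "\<lambda>_. 0" and v = v]
    unfolding L_def by simp_all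
  note [measurable] = L(1)
  have conv: "(\<lambda>i. \<integral>\<^sup>+\<omega>. ennreal ((D \<omega> - L i \<omega>)\<^sup>2) \<partial>M) \<longlonglongrightarrow> 0"
  proof (rule tendsto_sandwich[OF _ _ tendsto_const])
    show "\<forall>\<^sub>F i in sequentially. (\<integral>\<^sup>+\<omega>. ennreal ((D \<omega> - L i \<omega>)\<^sup>2) \<partial>M) \<le> 2 * ?J i t + 2 * ?J i s"
      unfolding D_def L_def by (intro always_eventually allI elementary_increment_distance[OF e st _ _ v]) auto
    have "(\<lambda>i. 2 * ?J i t + 2 * ?J i s) \<longlonglongrightarrow> 2 * 0 + 2 * 0"
    proof (rule tendsto_add)
      show "(\<lambda>i. 2 * ?J i t) \<longlonglongrightarrow> 2 * 0" by (rule ennreal_tendsto_cmult[OF _ J]) (use st in simp_all)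
      show "(\<lambda>i. 2 * ?J i s) \<longlonglongrightarrow> 2 * 0" by (rule ennreal_tendsto_cmult[OF _ J]) (use st in simp_all)
    qed
    then show "(\<lambda>i. 2 * ?J i t + 2 * ?J i s) \<longlonglongrightarrow> 0" by simp
  qed simp
  have ev: "\<forall>\<^sub>F i in sequentially. (\<integral>\<^sup>+\<omega>. ennreal ((D \<omega> - L i \<omega>)\<^sup>2) \<partial>M) < \<epsilon>" if "\<epsilon> > 0" for \<epsilon>
    using order_tendstoD(2)[OF conv that] .
  have DL: "integrable M (\<lambda>\<omega>. (D \<omega> - L i \<omega>)\<^sup>2)" if "(\<integral>\<^sup>+\<omega>. ennreal ((D \<omega> - L i \<omega>)\<^sup>2) \<partial>M) < \<infinity>" for i
    using that by (intro integrableI_bounded) auto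
  obtain i0 where i0: "(\<integral>\<^sup>+\<omega>. ennreal ((D \<omega> - L i0 \<omega>)\<^sup>2) \<partial>M) < \<infinity>"
    using ev[of \<infinity>] by (auto simp: eventually_sequentially)
  have D2: "integrable M (\<lambda>\<omega>. (D \<omega>)\<^sup>2)"
  proof (rule Bochner_Integration.integrable_bound)
    show "integrable M (\<lambda>\<omega>. 2 * (D \<omega> - L i0 \<omega>)\<^sup>2 + 2 * (L i0 \<omega>)\<^sup>2)" using DL[OF i0] L by simp
    show "AE \<omega> in M. norm ((D \<omega>)\<^sup>2) \<le> norm (2 * (D \<omega> - L i0 \<omega>)\<^sup>2 + 2 * (L i0 \<omega>)\<^sup>2)"
    proof (rule AE_I2)
      fix \<omega> show "norm ((D \<omega>)\<^sup>2) \<le> norm (2 * (D \<omega> - L i0 \<omega>)\<^sup>2 + 2 * (L i0 \<omega>)\<^sup>2)"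
        using square_add_le[of "D \<omega> - L i0 \<omega>" "L i0 \<omega>"] by simp
    qed
  qed measurable
  have \<eta>2: "integrable M (\<lambda>\<omega>. (\<eta> \<omega>)\<^sup>2)"
  proof (rule integrable_const_bound[where B = "C\<^sup>2"])
    have "(\<eta> \<omega>)\<^sup>2 \<le> C\<^sup>2" for \<omega> using \<eta>C power_mono[of "\<bar>\<eta> \<omega>\<bar>" C 2] by simp
    then show "AE \<omega> in M. norm ((\<eta> \<omega>)\<^sup>2) \<le> C\<^sup>2" by simp
  qed measurable
  have \<eta>D: "integrable M (\<lambda>\<omega>. \<eta> \<omega> * D \<omega>)" using \<eta>2 D2 by (intro integrable_mult_of_square) auto
  have \<eta>L: "integrable M (\<lambda>\<omega>. \<eta> \<omega> * L i \<omega>)" for i using \<eta>2 L by (intro integrable_mult_of_square) auto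
  have C0: "0 \<le> C" using \<eta>C by (meson abs_ge_zero order_trans)
  have small: "\<bar>\<integral>\<omega>. \<eta> \<omega> * D \<omega> \<partial>M\<bar> \<le> C * (2 * \<delta>)" if \<delta>: "\<delta> > 0" for \<delta>
  proof -
    obtain i where i: "(\<integral>\<^sup>+\<omega>. ennreal ((D \<omega> - L i \<omega>)\<^sup>2) \<partial>M) < ennreal (\<delta>\<^sup>2)"
      using ev[of "ennreal (\<delta>\<^sup>2)"] \<delta> by (auto simp: eventually_sequentially)
    then have ii: "integrable M (\<lambda>\<omega>. (D \<omega> - L i \<omega>)\<^sup>2)" by (intro DL) (auto intro: less_trans)
    have "(\<integral>\<omega>. (D \<omega> - L i \<omega>)\<^sup>2 \<partial>M) \<le> \<delta>\<^sup>2"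
      using i ii by (subst (asm) nn_integral_eq_integral) (auto simp: ennreal_less_iff)
    then have s: "(\<integral>\<omega>. (D \<omega> - L i \<omega>)\<^sup>2 \<partial>M) / \<delta> \<le> \<delta>" using \<delta> by (simp add: divide_le_eq power2_eq_square)
    have pt: "\<bar>\<eta> \<omega> * (D \<omega> - L i \<omega>)\<bar> \<le> C * (\<delta> + (D \<omega> - L i \<omega>)\<^sup>2 / \<delta>)" for \<omega>
    proof -
      have "\<bar>x\<bar> \<le> \<delta> + x\<^sup>2 / \<delta>" for x
      proof (cases "\<bar>x\<bar> \<le> \<delta>")
        case True then show ?thesis using \<delta> by (simp add: add_increasing2)
      next
        case False
        then have "\<bar>x\<bar> * \<delta> \<le> \<bar>x\<bar> * \<bar>x\<bar>" by (intro mult_left_mono) auto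
        then have "\<bar>x\<bar> \<le> x\<^sup>2 / \<delta>" using \<delta> by (simp add: pos_le_divide_eq power2_eq_square)
        then show ?thesis using \<delta> by simp
      qed
      then show ?thesis using \<eta>C C0 unfolding abs_mult by (intro mult_mono) auto
    qed
    have "(\<integral>\<omega>. \<eta> \<omega> * D \<omega> \<partial>M) = (\<integral>\<omega>. \<eta> \<omega> * (D \<omega> - L i \<omega>) \<partial>M)"
      using \<eta>D \<eta>L[of i] L(3)[of i] by (simp add: right_diff_distrib)
    also have "\<bar>\<dots>\<bar> \<le> (\<integral>\<omega>. \<bar>\<eta> \<omega> * (D \<omega> - L i \<omega>)\<bar> \<partial>M)" by (rule integral_abs_bound)
    also have "\<dots> \<le> (\<integral>\<omega>. C * (\<delta> + (D \<omega> - L i \<omega>)\<^sup>2 / \<delta>) \<partial>M)"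
      using \<eta>D \<eta>L[of i] ii pt by (intro integral_mono) (auto simp: right_diff_distrib)
    also have "\<dots> = C * (\<delta> + (\<integral>\<omega>. (D \<omega> - L i \<omega>)\<^sup>2 \<partial>M) / \<delta>)"
      using ii by (simp add: prob_space)
    also have "\<dots> \<le> C * (2 * \<delta>)" using s C0 by (intro mult_left_mono) auto
    finally show ?thesis by simp
  qed
  have "\<bar>\<integral>\<omega>. \<eta> \<omega> * D \<omega> \<partial>M\<bar> \<le> 0"
  proof (rule field_le_epsilon)
    fix \<epsilon> :: real assume \<epsilon>: "0 < \<epsilon>"
    have "C * (2 * (\<epsilon> / (2 * (C + 1)))) = \<epsilon> * (C / (C + 1))" using C0 by (simp add: field_simps)
    also have "\<dots> \<le> \<epsilon>" using C0 \<epsilon> by (intro mult_left_le) (auto simp: divide_le_eq_1)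
    finally show "\<bar>\<integral>\<omega>. \<eta> \<omega> * D \<omega> \<partial>M\<bar> \<le> 0 + \<epsilon>"
      using small[of "\<epsilon> / (2 * (C + 1))"] C0 \<epsilon> by auto
  qed
  then show "integrable M (\<lambda>\<omega>. ((I t \<omega> - I s \<omega>) \<bullet> v)\<^sup>2)" "integrable M (\<lambda>\<omega>. \<eta> \<omega> * ((I t \<omega> - I s \<omega>) \<bullet> v))"
    "(\<integral>\<omega>. \<eta> \<omega> * ((I t \<omega> - I s \<omega>) \<bullet> v) \<partial>M) = 0"
    using D2 \<eta>D by (auto simp: D_def)
qed

end

section \<open>The radial profile of the mollifier\<close>

text \<open>
  The profile \<open>G\<close> with \<open>R = r\<^sup>2\<close>, as a function of the squared distance; \<open>bump'\<close> and \<open>bump''\<close> are its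
  first two derivatives. All three vanish outside the ball by definition, so that no case distinction
  is needed in expectations.
\<close>

definition bump :: "real \<Rightarrow> real \<Rightarrow> real" where
  "bump R s = (if s < R then exp (1 - R / (R - s)) else 0)"

definition bump' :: "real \<Rightarrow> real \<Rightarrow> real" where
  "bump' R s = (if s < R then - bump R s * (R / (R - s))\<^sup>2 / R else 0)"

definition bump'' :: "real \<Rightarrow> real \<Rightarrow> real" where
  "bump'' R s = (if s < R then bump R s * ((R / (R - s)) ^ 4 - 2 * (R / (R - s)) ^ 3) / R\<^sup>2 else 0)"

lemma mollifier_eq_bump: "r > 0 \<Longrightarrow> mollifier xstar r x = bump (r\<^sup>2) ((norm (x - xstar))\<^sup>2)"
  using abs_le_square_iff[of r "norm (x - xstar)"]
  by (auto simp: mollifier_def bump_def not_less[symmetric])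

lemma bump_nonneg: "0 \<le> bump R s"
  by (simp add: bump_def)

lemma bump_le_1:
  assumes "0 \<le> s" "0 < R" shows "bump R s \<le> 1"
  using assms by (auto simp: bump_def le_divide_eq)

lemma bump_has_derivative:
  assumes s: "s < R" and R: "0 < R"
  shows "(bump R has_real_derivative bump' R s) (at s)"
proof (rule has_field_derivative_transform_within_open)
  show "((\<lambda>s. exp (1 - R / (R - s))) has_real_derivative bump' R s) (at s)"
    using assms by (auto intro!: derivative_eq_intros simp: bump'_def bump_def power2_eq_square)
  show "open {..<R}" "s \<in> {..<R}" using s by auto
qed (simp add: bump_def)

lemma bump'_has_derivative:
  assumes s: "s < R" and R: "0 < R"
  shows "(bump' R has_real_derivative bump'' R s) (at s)"
proof (rule has_field_derivative_transform_within_open)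
  have u: "((\<lambda>s. R / (R - s)) has_real_derivative (R / (R - s))\<^sup>2 / R) (at s)"
    using assms by (auto intro!: derivative_eq_intros simp: power2_eq_square)
  have u2: "((\<lambda>s. (R / (R - s))\<^sup>2) has_real_derivative 2 * (R / (R - s)) * ((R / (R - s))\<^sup>2 / R)) (at s)"
    using DERIV_power[OF u, of 2] by (rule DERIV_cong) simp
  note DERIV_cdivide[OF DERIV_minus[OF DERIV_mult'[OF bump_has_derivative[OF assms] u2]], of R]
  moreover have "- (bump R s * (2 * (R / (R - s)) * ((R / (R - s))\<^sup>2 / R)) + bump' R s * (R / (R - s))\<^sup>2) / R = bump'' R s"
  proof -
    define u where "u = R / (R - s)"
    show ?thesis using s R unfolding bump''_def bump'_def u_def[symmetric]
      by (simp add: field_simps eval_nat_numeral)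
  qed
  ultimately show "((\<lambda>s. - bump R s * (R / (R - s))\<^sup>2 / R) has_real_derivative bump'' R s) (at s)" by simp
  show "open {..<R}" "s \<in> {..<R}" using s by auto
qed (simp add: bump'_def)

lemma isCont_bump'':
  assumes "s < R" "0 < R"
  shows "isCont (bump'' R) s"
proof -
  have "isCont (\<lambda>s. bump R s * ((R / (R - s)) ^ 4 - 2 * (R / (R - s)) ^ 3) / R\<^sup>2) s"
    using assms by (intro continuous_intros DERIV_isCont[OF bump_has_derivative]) auto
  moreover have "\<forall>\<^sub>F x in nhds s. bump R x * ((R / (R - x)) ^ 4 - 2 * (R / (R - x)) ^ 3) / R\<^sup>2 = bump'' R x"
    using eventually_nhds_in_open[of "{..<R}" s] assms(1) by (auto elim!: eventually_mono simp: bump''_def)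
  then have "isCont (\<lambda>s. bump R s * ((R / (R - s)) ^ 4 - 2 * (R / (R - s)) ^ 3) / R\<^sup>2) s = isCont (bump'' R) s"
    by (rule isCont_cong)
  ultimately show ?thesis by simp
qed

text \<open>
  With \<open>u = R / (R - s)\<close> the derivatives of the profile are \<open>exp (1 - u)\<close> times polynomials in \<open>u\<close>; this
  bounds them, and also their decay towards the sphere.
\<close>

lemma power_le_fact_exp:
  fixes u :: real assumes "0 \<le> u"
  shows "u ^ k * exp (1 - u) \<le> exp 1 * fact k"
proof -
  have "u ^ k / fact k \<le> exp u"
  proof -
    have "(\<Sum>n\<in>{k}. u ^ n /\<^sub>R fact n) \<le> (\<Sum>n. u ^ n /\<^sub>R fact n)"
      using assms by (intro sum_le_suminf summable_exp_generic) auto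
    then show ?thesis by (simp add: exp_def divide_inverse mult.commute)
  qed
  then have "u ^ k \<le> fact k * exp u" by (simp add: divide_le_eq mult.commute)
  then show ?thesis by (simp add: exp_diff divide_le_eq mult.commute mult.left_commute)
qed

lemma bump_bounds:
  assumes R: "0 < R" and s: "s < R"
  shows "bump R s \<le> exp 1" "\<bar>bump' R s\<bar> \<le> 2 * exp 1 / R" "\<bar>bump'' R s\<bar> \<le> 36 * exp 1 / R\<^sup>2"
    "bump R s \<le> 2 * exp 1 / R\<^sup>2 * (R - s)\<^sup>2" "\<bar>bump' R s\<bar> \<le> 6 * exp 1 / R\<^sup>2 * (R - s)"
proof -
  define u where "u = R / (R - s)"
  have u: "0 < u" using R s by (simp add: u_def)
  have b: "bump R s = exp (1 - u)" using s by (simp add: bump_def u_def)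
  have d: "R - s = R / u" using R s by (simp add: u_def)
  have e: "u ^ k * exp (1 - u) \<le> exp 1 * fact k" for k using u by (intro power_le_fact_exp) auto
  have b1: "bump' R s = - (u\<^sup>2 * exp (1 - u)) / R" using s by (simp add: bump'_def b u_def[symmetric])
  have b2: "bump'' R s = (u ^ 4 * exp (1 - u) - 2 * (u ^ 3 * exp (1 - u))) / R\<^sup>2"
    using s by (simp add: bump''_def b u_def[symmetric] algebra_simps)
  show "bump R s \<le> exp 1" using e[of 0] by (simp add: b)
  show "\<bar>bump' R s\<bar> \<le> 2 * exp 1 / R" using e[of 2] R u by (simp add: b1 divide_right_mono mult.commute)
  show "\<bar>bump'' R s\<bar> \<le> 36 * exp 1 / R\<^sup>2"
  proof -
    have "\<bar>u ^ 4 * exp (1 - u) - 2 * (u ^ 3 * exp (1 - u))\<bar> \<le> u ^ 4 * exp (1 - u) + 2 * (u ^ 3 * exp (1 - u))"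
      using u by (intro abs_leI) auto
    also have "\<dots> \<le> 36 * exp 1" using e[of 4] e[of 3] by (simp add: fact_numeral)
    finally show ?thesis unfolding b2 using R by (simp add: divide_right_mono)
  qed
  show "bump R s \<le> 2 * exp 1 / R\<^sup>2 * (R - s)\<^sup>2"
    using e[of 2] R u unfolding b d by (simp add: power_divide pos_le_divide_eq mult.commute)
  show "\<bar>bump' R s\<bar> \<le> 6 * exp 1 / R\<^sup>2 * (R - s)"
  proof -
    have "u ^ 3 * exp (1 - u) \<le> 6 * exp 1" using e[of 3] by (simp add: fact_numeral mult.commute)
    then have "u\<^sup>2 * exp (1 - u) \<le> 6 * exp 1 / u"
      using u by (simp add: pos_le_divide_eq eval_nat_numeral mult.commute mult.left_commute mult.assoc)
    then have "u\<^sup>2 * exp (1 - u) / R \<le> 6 * exp 1 / u / R" using R by (intro divide_right_mono) auto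
    then show ?thesis unfolding b1 d using R u by (simp add: power2_eq_square mult.commute)
  qed
qed

lemma continuous_bump:
  assumes R: "0 < R" shows "isCont (bump R) s"
proof (cases "s = R")
  case False
  then consider "s < R" | "R < s" by linarith
  then show ?thesis
  proof cases
    case 1 then show ?thesis using DERIV_isCont[OF bump_has_derivative] R by blast
  next
    case 2
    have "\<forall>\<^sub>F x in nhds s. 0 = bump R x"
      using eventually_nhds_in_open[of "{R<..}" s] 2 by (auto elim!: eventually_mono simp: bump_def)
    then have "isCont (\<lambda>_. 0 :: real) s = isCont (bump R) s" by (rule isCont_cong)
    then show ?thesis by simp
  qed
next
  case True
  have "bump R \<midarrow>R\<rightarrow> 0"
  proof (rule Lim_null_comparison)
    show "\<forall>\<^sub>F x in at R. norm (bump R x) \<le> 2 * exp 1 / R\<^sup>2 * (R - x)\<^sup>2"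
    proof (intro always_eventually allI)
      fix x show "norm (bump R x) \<le> 2 * exp 1 / R\<^sup>2 * (R - x)\<^sup>2"
        using bump_bounds(4)[OF R, of x] bump_nonneg[of R x] by (cases "x < R") (auto simp: bump_def)
    qed
    have "((\<lambda>x. 2 * exp 1 / R\<^sup>2 * (R - x)\<^sup>2) \<longlongrightarrow> 2 * exp 1 / R\<^sup>2 * (R - R)\<^sup>2) (at R)"
      by (intro tendsto_intros)
    then show "((\<lambda>x. 2 * exp 1 / R\<^sup>2 * (R - x)\<^sup>2) \<longlongrightarrow> 0) (at R)" by simp
  qed
  then show ?thesis using True by (simp add: isCont_def bump_def)
qed

section \<open>Second-order expansion of the profile\<close>

lemma bump_taylor:
  assumes R: "0 < R" and s: "s < R" "s + \<delta> < R"
  obtains \<theta> where "\<bar>\<theta> - s\<bar> \<le> \<bar>\<delta>\<bar>" "\<theta> < R"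
    "bump R (s + \<delta>) = bump R s + bump' R s * \<delta> + bump'' R \<theta> / 2 * \<delta>\<^sup>2"
proof (cases "\<delta> = 0")
  case True
  then show ?thesis using that[of s] s by simp
next
  case False
  define diff where "diff m = (if m = 0 then bump R else if m = 1 then bump' R else bump'' R)" for m :: nat
  have "\<forall>m t. m < 2 \<and> min s (s + \<delta>) \<le> t \<and> t \<le> max s (s + \<delta>) \<longrightarrow> DERIV (diff m) t :> diff (Suc m) t"
  proof (intro allI impI)
    fix m t assume a: "m < (2::nat) \<and> min s (s + \<delta>) \<le> t \<and> t \<le> max s (s + \<delta>)"
    then have "t < R" using s by auto
    moreover have "m = 0 \<or> m = 1" using a by auto
    ultimately show "DERIV (diff m) t :> diff (Suc m) t"
      using bump_has_derivative[of t R] bump'_has_derivative[of t R] R by (auto simp: diff_def)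
  qed
  from Taylor[OF _ _ this, of "bump R" s "s + \<delta>"] False
  obtain t where t: "if s + \<delta> < s then s + \<delta> < t \<and> t < s else s < t \<and> t < s + \<delta>"
    and eq: "bump R (s + \<delta>) = (\<Sum>m<2. diff m s / fact m * (s + \<delta> - s) ^ m) + diff 2 t / fact 2 * (s + \<delta> - s)\<^sup>2"
    by (auto simp: diff_def)
  show ?thesis
  proof (rule that[of t])
    show "\<bar>t - s\<bar> \<le> \<bar>\<delta>\<bar>" "t < R" using t s by (auto split: if_splits)
    show "bump R (s + \<delta>) = bump R s + bump' R s * \<delta> + bump'' R t / 2 * \<delta>\<^sup>2"
      using eq by (simp add: diff_def numeral_2_eq_2)
  qed
qed

text \<open>
  The amount by which the second-order Taylor polynomial exceeds the profile. An upper bound for it is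
  a lower bound for the profile.
\<close>

definition bump_rem :: "real \<Rightarrow> real \<Rightarrow> real \<Rightarrow> real" where
  "bump_rem R s \<delta> = bump R s + bump' R s * \<delta> + bump'' R s / 2 * \<delta>\<^sup>2 - bump R (s + \<delta>)"

text \<open>
  For a step that leaves the ball the profile drops to \<open>0\<close>. Then \<open>R - s \<le> \<delta>\<close>, and the decay of the
  profile and its derivative towards the sphere, of orders \<open>(R - s)\<^sup>2\<close> and \<open>R - s\<close>, makes the Taylor
  polynomial itself \<open>O (\<delta>\<^sup>2)\<close>, uniformly in \<open>s\<close>.
\<close>

lemma bump_rem_bound:
  assumes R: "0 < R" and s: "s < R"
  shows "bump_rem R s \<delta> \<le> 36 * exp 1 / R\<^sup>2 * \<delta>\<^sup>2"
proof (cases "s + \<delta> < R")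
  case True
  obtain \<theta> where \<theta>: "\<theta> < R" "bump R (s + \<delta>) = bump R s + bump' R s * \<delta> + bump'' R \<theta> / 2 * \<delta>\<^sup>2"
    using bump_taylor[OF R s True] by blast
  have "bump_rem R s \<delta> = (bump'' R s - bump'' R \<theta>) / 2 * \<delta>\<^sup>2"
    unfolding bump_rem_def \<theta>(2) by (simp add: algebra_simps diff_divide_distrib)
  also have "\<dots> \<le> 36 * exp 1 / R\<^sup>2 * \<delta>\<^sup>2"
    using bump_bounds(3)[OF R s] bump_bounds(3)[OF R \<theta>(1)] by (intro mult_right_mono) (auto simp: abs_le_iff)
  finally show ?thesis .
next
  case False
  then have d: "0 < R - s" "R - s \<le> \<delta>" using s by auto
  let ?c = "exp 1 / R\<^sup>2"
  have c: "0 \<le> ?c" by simp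
  have "bump_rem R s \<delta> = bump R s + bump' R s * \<delta> + bump'' R s / 2 * \<delta>\<^sup>2"
    using False by (simp add: bump_rem_def bump_def)
  also have "\<dots> \<le> (2 * ?c * \<delta>\<^sup>2) + (6 * ?c * \<delta>\<^sup>2) + (18 * ?c * \<delta>\<^sup>2)"
  proof (intro add_mono)
    have "bump R s \<le> 2 * ?c * (R - s)\<^sup>2" using bump_bounds(4)[OF R s] by simp
    also have "\<dots> \<le> 2 * ?c * \<delta>\<^sup>2" using d c by (intro mult_left_mono power_mono) auto
    finally show "bump R s \<le> 2 * ?c * \<delta>\<^sup>2" .
    have "bump' R s * \<delta> \<le> \<bar>bump' R s\<bar> * \<delta>" using d by (intro mult_right_mono) auto
    also have "\<dots> \<le> (6 * ?c * (R - s)) * \<delta>"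
      using bump_bounds(5)[OF R s] d by (intro mult_right_mono) auto
    also have "\<dots> \<le> (6 * ?c * \<delta>) * \<delta>" using d c by (intro mult_right_mono mult_left_mono) auto
    finally show "bump' R s * \<delta> \<le> 6 * ?c * \<delta>\<^sup>2" by (simp add: power2_eq_square)
    have "bump'' R s \<le> 36 * ?c" using bump_bounds(3)[OF R s] by simp
    then show "bump'' R s / 2 * \<delta>\<^sup>2 \<le> 18 * ?c * \<delta>\<^sup>2" by (intro mult_right_mono) auto
  qed
  also have "\<dots> = 26 * (?c * \<delta>\<^sup>2)" by simp
  also have "\<dots> \<le> 36 * (?c * \<delta>\<^sup>2)" using c by (intro mult_right_mono mult_nonneg_nonneg) auto
  also have "\<dots> = 36 * exp 1 / R\<^sup>2 * \<delta>\<^sup>2" by simp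
  finally show ?thesis .
qed

lemma bump_rem_little_o:
  assumes R: "0 < R" and s: "s < R" and \<epsilon>: "0 < \<epsilon>"
  shows "\<exists>d>0. \<forall>\<delta>. \<bar>\<delta>\<bar> < d \<longrightarrow> bump_rem R s \<delta> \<le> \<epsilon> * \<delta>\<^sup>2"
proof -
  obtain d where d: "d > 0" "\<And>x. \<bar>x - s\<bar> < d \<Longrightarrow> \<bar>bump'' R x - bump'' R s\<bar> < \<epsilon>"
    using isCont_bump''[OF s R] \<epsilon> unfolding continuous_at_eps_delta by (auto simp: dist_real_def)
  have "bump_rem R s \<delta> \<le> \<epsilon> * \<delta>\<^sup>2" if \<delta>: "\<bar>\<delta>\<bar> < min d (R - s)" for \<delta>
  proof -
    have "s + \<delta> < R" using \<delta> by auto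
    then obtain \<theta> where \<theta>: "\<bar>\<theta> - s\<bar> \<le> \<bar>\<delta>\<bar>" "bump R (s + \<delta>) = bump R s + bump' R s * \<delta> + bump'' R \<theta> / 2 * \<delta>\<^sup>2"
      using bump_taylor[OF R s] by blast
    have "bump_rem R s \<delta> = (bump'' R s - bump'' R \<theta>) / 2 * \<delta>\<^sup>2"
      unfolding bump_rem_def \<theta>(2) by (simp add: algebra_simps diff_divide_distrib)
    also have "\<dots> \<le> \<epsilon> * \<delta>\<^sup>2"
      using d(2)[of \<theta>] \<theta>(1) \<delta> \<epsilon> by (intro mult_right_mono) auto
    finally show ?thesis .
  qed
  then show ?thesis using d(1) s by (intro exI[of _ "min d (R - s)"]) auto
qed

text \<open>
  The second-order expansion of \<open>z \<mapsto> G (\<parallel>y + z\<parallel>\<^sup>2)\<close> at \<open>0\<close>, minus the function. It differs from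
  \<open>bump_rem\<close> at \<open>\<delta> = 2 (y \<bullet> z) + \<parallel>z\<parallel>\<^sup>2\<close> by terms of third order in \<open>z\<close>.
\<close>

definition defect :: "real \<Rightarrow> 'h::real_inner \<Rightarrow> 'h \<Rightarrow> real" where
  "defect R y z = bump R ((norm y)\<^sup>2) + 2 * bump' R ((norm y)\<^sup>2) * (y \<bullet> z) + bump' R ((norm y)\<^sup>2) * (norm z)\<^sup>2
     + 2 * bump'' R ((norm y)\<^sup>2) * (y \<bullet> z)\<^sup>2 - bump R ((norm (y + z))\<^sup>2)"

lemma norm_add_square: "(norm (y + z))\<^sup>2 = (norm y)\<^sup>2 + (2 * (y \<bullet> z) + (norm z)\<^sup>2)" for y z :: "'h::real_inner"
  unfolding power2_norm_eq_inner by (simp add: inner_add_left inner_add_right inner_commute[of z y])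

lemma defect_eq:
  "defect R y z = bump_rem R ((norm y)\<^sup>2) (2 * (y \<bullet> z) + (norm z)\<^sup>2)
     - bump'' R ((norm y)\<^sup>2) * (2 * (y \<bullet> z) * (norm z)\<^sup>2 + (norm z) ^ 4 / 2)"
  unfolding defect_def bump_rem_def norm_add_square by (simp add: algebra_simps power2_eq_square eval_nat_numeral)

text \<open>
  For small \<open>z\<close>, an estimate of the one-dimensional remainder carries over up to a factor, because
  \<open>\<delta> = O \<parallel>z\<parallel>\<close>, and up to a term of third order.
\<close>

lemma defect_small_step:
  fixes y z :: "'h::real_inner"
  assumes r: "0 < r" and y: "norm y < r" and z: "norm z \<le> 1"
    and rem: "bump_rem (r\<^sup>2) ((norm y)\<^sup>2) (2 * (y \<bullet> z) + (norm z)\<^sup>2) \<le> c * (2 * (y \<bullet> z) + (norm z)\<^sup>2)\<^sup>2" and c: "0 \<le> c"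
  shows "\<bar>2 * (y \<bullet> z) + (norm z)\<^sup>2\<bar> \<le> (2 * r + 1) * norm z"
    "defect (r\<^sup>2) y z \<le> (c * (2 * r + 1)\<^sup>2 + 36 * exp 1 / (r\<^sup>2)\<^sup>2 * (2 * r + 1) * norm z) * (norm z)\<^sup>2"
proof -
  have R: "0 < r\<^sup>2" and yR: "(norm y)\<^sup>2 < r\<^sup>2" using r y by (auto intro: power_strict_mono)
  have yz: "\<bar>y \<bullet> z\<bar> \<le> r * norm z"
    using Cauchy_Schwarz_ineq2[of y z] mult_right_mono[of "norm y" r "norm z"] y by auto
  have zz: "(norm z)\<^sup>2 \<le> norm z" using z by (simp add: power2_eq_square mult_left_le)
  show *: "\<bar>2 * (y \<bullet> z) + (norm z)\<^sup>2\<bar> \<le> (2 * r + 1) * norm z"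
    using yz zz zero_le_power2[of "norm z"] unfolding abs_le_iff distrib_right by linarith
  have "(2 * (y \<bullet> z) + (norm z)\<^sup>2)\<^sup>2 \<le> ((2 * r + 1) * norm z)\<^sup>2"
    using * abs_le_square_iff r by (metis abs_ge_self order_trans)
  then have 1: "bump_rem (r\<^sup>2) ((norm y)\<^sup>2) (2 * (y \<bullet> z) + (norm z)\<^sup>2) \<le> c * ((2 * r + 1)\<^sup>2 * (norm z)\<^sup>2)"
    using rem c by (smt (verit) mult_left_mono power_mult_distrib)
  let ?k = "2 * (y \<bullet> z) * (norm z)\<^sup>2 + (norm z) ^ 4 / 2"
  have k: "\<bar>?k\<bar> \<le> (2 * r + 1) * norm z * (norm z)\<^sup>2"
  proof -
    have "?k = (2 * (y \<bullet> z) + (norm z)\<^sup>2 / 2) * (norm z)\<^sup>2" by (simp add: algebra_simps eval_nat_numeral)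
    moreover have "\<bar>2 * (y \<bullet> z) + (norm z)\<^sup>2 / 2\<bar> \<le> (2 * r + 1) * norm z"
      using yz zz zero_le_power2[of "norm z"] unfolding abs_le_iff distrib_right by linarith
    ultimately show ?thesis by (simp add: abs_mult mult_right_mono)
  qed
  have "- (bump'' (r\<^sup>2) ((norm y)\<^sup>2) * ?k) \<le> \<bar>bump'' (r\<^sup>2) ((norm y)\<^sup>2)\<bar> * \<bar>?k\<bar>"
    by (simp only: abs_mult[symmetric] abs_ge_minus_self)
  also have "\<dots> \<le> 36 * exp 1 / (r\<^sup>2)\<^sup>2 * ((2 * r + 1) * norm z * (norm z)\<^sup>2)"
    using bump_bounds(3)[OF R yR] k by (intro mult_mono) auto
  finally have fin: "- (bump'' (r\<^sup>2) ((norm y)\<^sup>2) * ?k)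
    \<le> 36 * exp 1 / (r\<^sup>2)\<^sup>2 * ((2 * r + 1) * norm z * (norm z)\<^sup>2)" .
  show "defect (r\<^sup>2) y z \<le> (c * (2 * r + 1)\<^sup>2 + 36 * exp 1 / (r\<^sup>2)\<^sup>2 * (2 * r + 1) * norm z) * (norm z)\<^sup>2"
  proof -
    have "(c * (2 * r + 1)\<^sup>2 + 36 * exp 1 / (r\<^sup>2)\<^sup>2 * (2 * r + 1) * norm z) * (norm z)\<^sup>2
      = c * ((2 * r + 1)\<^sup>2 * (norm z)\<^sup>2) + 36 * exp 1 / (r\<^sup>2)\<^sup>2 * ((2 * r + 1) * norm z * (norm z)\<^sup>2)"
      by (simp only: distrib_right mult.assoc)
    then show ?thesis using 1 fin unfolding defect_eq by linarith
  qed
qed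

text \<open>
  A bound that is uniform in the base point, for dominated convergence. Large steps are harmless
  because the profile is nonnegative and the coefficients are bounded.
\<close>

lemma defect_bound:
  assumes r: "0 < r"
  shows "\<exists>C\<ge>0. \<forall>(y::'h::real_inner) z. norm y < r \<longrightarrow> defect (r\<^sup>2) y z \<le> C * (norm z)\<^sup>2"
proof -
  let ?R = "r\<^sup>2"
  let ?c = "36 * exp 1 / ?R\<^sup>2"
  define C1 where "C1 = ?c * (2 * r + 1)\<^sup>2 + ?c * (2 * r + 1)"
  define C2 where "C2 = exp 1 + 4 * exp 1 / ?R * r + 2 * exp 1 / ?R + 2 * ?c * r\<^sup>2"
  have C: "0 \<le> C1" "0 \<le> C2" using r by (auto simp: C1_def C2_def)
  have R: "0 < ?R" using r by simp
  have "defect ?R y z \<le> (C1 + C2) * (norm z)\<^sup>2" if y: "norm y < r" for y z :: 'h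
  proof (cases "norm z \<le> 1")
    case True
    have yR: "(norm y)\<^sup>2 < ?R" using y by (intro power_strict_mono) auto
    have "defect ?R y z \<le> (?c * (2 * r + 1)\<^sup>2 + ?c * (2 * r + 1) * norm z) * (norm z)\<^sup>2"
      using bump_rem_bound[OF R yR] by (intro defect_small_step(2)[OF r y True]) auto
    also have "\<dots> \<le> C1 * (norm z)\<^sup>2"
      unfolding C1_def using r True by (intro mult_right_mono add_left_mono mult_left_le) auto
    also have "\<dots> \<le> (C1 + C2) * (norm z)\<^sup>2" using C by (intro mult_right_mono) auto
    finally show ?thesis .
  next
    case False
    have yR: "(norm y)\<^sup>2 < ?R" using y by (intro power_strict_mono) auto
    note b = bump_bounds[OF R yR]
    have z1: "1 \<le> (norm z)\<^sup>2" "norm z \<le> (norm z)\<^sup>2" using False mult_mono[of 1 "norm z" 1 "norm z"] mult_right_mono[of 1 "norm z" "norm z"]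
      by (auto simp: power2_eq_square)
    have yz: "\<bar>y \<bullet> z\<bar> \<le> r * norm z"
      using Cauchy_Schwarz_ineq2[of y z] mult_right_mono[of "norm y" r "norm z"] y by auto
    have "defect ?R y z \<le> bump ?R ((norm y)\<^sup>2) + 2 * bump' ?R ((norm y)\<^sup>2) * (y \<bullet> z) + bump' ?R ((norm y)\<^sup>2) * (norm z)\<^sup>2
     + 2 * bump'' ?R ((norm y)\<^sup>2) * (y \<bullet> z)\<^sup>2"
      unfolding defect_def using bump_nonneg[of ?R] by simp
    also have "\<dots> \<le> exp 1 * (norm z)\<^sup>2 + 4 * exp 1 / ?R * r * (norm z)\<^sup>2 + 2 * exp 1 / ?R * (norm z)\<^sup>2 + 2 * ?c * r\<^sup>2 * (norm z)\<^sup>2"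
    proof (intro add_mono)
      have "exp 1 * 1 \<le> exp 1 * (norm z)\<^sup>2" using z1(1) by (intro mult_left_mono) auto
      then show "bump ?R ((norm y)\<^sup>2) \<le> exp 1 * (norm z)\<^sup>2" using b(1) by linarith
      have "bump' ?R ((norm y)\<^sup>2) * (y \<bullet> z) \<le> \<bar>bump' ?R ((norm y)\<^sup>2)\<bar> * \<bar>y \<bullet> z\<bar>"
        by (simp only: abs_mult[symmetric] abs_ge_self)
      also have "\<dots> \<le> (2 * exp 1 / ?R) * (r * norm z)" using b(2) yz by (intro mult_mono) auto
      also have "\<dots> \<le> (2 * exp 1 / ?R) * (r * (norm z)\<^sup>2)" using z1 r by (intro mult_left_mono) auto
      finally show "2 * bump' ?R ((norm y)\<^sup>2) * (y \<bullet> z) \<le> 4 * exp 1 / ?R * r * (norm z)\<^sup>2" by simp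
      show "bump' ?R ((norm y)\<^sup>2) * (norm z)\<^sup>2 \<le> 2 * exp 1 / ?R * (norm z)\<^sup>2"
        using b(2) by (intro mult_right_mono) auto
      have "(y \<bullet> z)\<^sup>2 \<le> (r * norm z)\<^sup>2" using yz by (simp add: abs_le_square_iff[symmetric])
      then have "bump'' ?R ((norm y)\<^sup>2) * (y \<bullet> z)\<^sup>2 \<le> ?c * (r * norm z)\<^sup>2"
        using b(3) by (intro mult_mono) auto
      then show "2 * bump'' ?R ((norm y)\<^sup>2) * (y \<bullet> z)\<^sup>2 \<le> 2 * ?c * r\<^sup>2 * (norm z)\<^sup>2"
        by (simp add: power_mult_distrib)
    qed
    also have "\<dots> = C2 * (norm z)\<^sup>2" by (simp add: C2_def distrib_right)
    also have "\<dots> \<le> (C1 + C2) * (norm z)\<^sup>2" using C by (intro mult_right_mono) auto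
    finally show ?thesis .
  qed
  then show ?thesis using C by (intro exI[of _ "C1 + C2"]) auto
qed

text \<open>
  At a fixed base point the expansion is exact to second order.
\<close>

lemma defect_little_o:
  fixes y :: "'h::real_inner"
  assumes r: "0 < r" and y: "norm y < r" and \<epsilon>: "0 < \<epsilon>"
  shows "\<exists>d>0. \<forall>z. norm z < d \<longrightarrow> defect (r\<^sup>2) y z \<le> \<epsilon> * (norm z)\<^sup>2"
proof -
  let ?R = "r\<^sup>2"
  let ?k = "2 * r + 1"
  define c0 where "c0 = 36 * exp 1 / ?R\<^sup>2 * ?k"
  have R: "0 < ?R" and yR: "(norm y)\<^sup>2 < ?R" using r y by (auto intro: power_strict_mono)
  have k: "0 < ?k" "0 < c0" using r by (auto simp: c0_def)
  define e where "e = \<epsilon> / (2 * ?k\<^sup>2)"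
  have e: "0 < e" using \<epsilon> k by (simp add: e_def)
  obtain d where d: "d > 0" "\<And>\<delta>. \<bar>\<delta>\<bar> < d \<Longrightarrow> bump_rem ?R ((norm y)\<^sup>2) \<delta> \<le> e * \<delta>\<^sup>2"
    using bump_rem_little_o[OF R yR e] by blast
  define d' where "d' = min 1 (min (d / ?k) (\<epsilon> / (2 * c0)))"
  have d': "0 < d'" unfolding d'_def min_less_iff_conj using d(1) k \<epsilon> by (intro conjI divide_pos_pos mult_pos_pos) auto
  have "defect ?R y z \<le> \<epsilon> * (norm z)\<^sup>2" if z: "norm z < d'" for z
  proof -
    have z1: "norm z \<le> 1" and "norm z < d / ?k" "norm z < \<epsilon> / (2 * c0)"
      using z unfolding d'_def by auto
    then have z2: "norm z * ?k < d" and "norm z * (2 * c0) < \<epsilon>"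
      using k by (simp_all only: pos_less_divide_eq mult_pos_pos zero_less_numeral)
    moreover have "norm z * (2 * c0) = 2 * (c0 * norm z)" by simp
    ultimately have z3: "c0 * norm z \<le> \<epsilon> / 2" by linarith
    have "\<bar>2 * (y \<bullet> z) + (norm z)\<^sup>2\<bar> \<le> ?k * norm z"
      by (rule defect_small_step(1)[OF r y z1, of "36 * exp 1 / ?R\<^sup>2"], rule bump_rem_bound[OF R yR]) simp
    then have "\<bar>2 * (y \<bullet> z) + (norm z)\<^sup>2\<bar> < d" using z2 by (simp add: mult.commute)
    from defect_small_step(2)[OF r y z1 d(2)[OF this], folded c0_def] e
    have "defect ?R y z \<le> (e * ?k\<^sup>2 + c0 * norm z) * (norm z)\<^sup>2" by simp
    also have "\<dots> \<le> \<epsilon> * (norm z)\<^sup>2"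
    proof (rule mult_right_mono)
      have "e * ?k\<^sup>2 = \<epsilon> / 2" using k by (simp add: e_def)
      then show "e * ?k\<^sup>2 + c0 * norm z \<le> \<epsilon>" using z3 by simp
    qed simp
    finally show ?thesis .
  qed
  then show ?thesis using d' by blast
qed

section \<open>The pointwise inequality for the generator\<close>

lemma quadratic_lower: "0 < c \<Longrightarrow> - (a\<^sup>2 / (2 * c)) \<le> c / 2 * x\<^sup>2 - a * (x::real)"
proof -
  assume c: "0 < c"
  have "0 \<le> (c * x - a)\<^sup>2 / (2 * c)" using c by simp
  also have "\<dots> = c / 2 * x\<^sup>2 - a * x + a\<^sup>2 / (2 * c)"
    using c by (simp add: power2_eq_square field_simps)
  finally show ?thesis by simp
qed

text \<open>
  The central inequality. Here \<open>s = \<parallel>Y\<parallel>\<^sup>2\<close>, \<open>n = \<parallel>X - m\<parallel>\<close>, \<open>w = Y \<bullet> (X - m)\<close> and \<open>\<kappa> = Q Y \<bullet> Y\<close>. Divided by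
  the profile, the right-hand side is at least \<open>c n\<^sup>2 u\<^sup>4 - b n\<^sup>2 u\<^sup>2 - a n u\<^sup>2\<close> near the sphere, where the
  coercivity of \<open>Q\<close> enters through \<open>\<kappa> \<ge> lm s\<close>; half of the leading term absorbs each of the others.
\<close>

lemma generator_bump_lower_bound:
  fixes lam \<sigma> r N lm K tr :: real
  assumes pos: "0 < lam" "0 < \<sigma>" "0 < r" "0 < lm" "0 \<le> N" "0 \<le> K" "0 \<le> tr"
  shows "\<exists>p>0. \<forall>s n w \<kappa>. 0 \<le> s \<longrightarrow> s < r\<^sup>2 \<longrightarrow> 0 \<le> n \<longrightarrow> n \<le> N \<longrightarrow> \<bar>w\<bar> \<le> r * n \<longrightarrow> lm * s \<le> \<kappa> \<longrightarrow> \<kappa> \<le> K \<longrightarrow>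
    - p * bump (r\<^sup>2) s \<le> - 2 * lam * bump' (r\<^sup>2) s * w + \<sigma>\<^sup>2 * n\<^sup>2 * (bump' (r\<^sup>2) s * tr + 2 * bump'' (r\<^sup>2) s * \<kappa>)"
proof -
  define R where "R = r\<^sup>2"
  have R: "0 < R" using pos by (simp add: R_def)
  \<comment> \<open>\<open>a\<close> and \<open>b\<close> are the costs of drift and trace term, \<open>c\<close> is the gain from the radial noise\<close>
  define a where "a = 2 * lam * r / R"
  define b where "b = \<sigma>\<^sup>2 * tr / R"
  define c where "c = 3 * \<sigma>\<^sup>2 * lm / (4 * R)"
  have abc: "0 \<le> a" "0 \<le> b" "0 < c" using pos R by (auto simp: a_def b_def c_def)
  define p where "p = 1 + a\<^sup>2 / (2 * c) + N\<^sup>2 * (b\<^sup>2 / (2 * c)) + 16 * a * N + 16 * b * N\<^sup>2 + 256 * \<sigma>\<^sup>2 * N\<^sup>2 * K / R\<^sup>2"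
  have p: "0 < p" unfolding p_def using abc pos by (intro add_pos_nonneg) auto
  have "- p * bump R s \<le> - 2 * lam * bump' R s * w + \<sigma>\<^sup>2 * n\<^sup>2 * (bump' R s * tr + 2 * bump'' R s * \<kappa>)"
    if h: "0 \<le> s" "s < R" "0 \<le> n" "n \<le> N" "\<bar>w\<bar> \<le> r * n" "lm * s \<le> \<kappa>" "\<kappa> \<le> K" for s n w \<kappa>
  proof -
    define u where "u = R / (R - s)"
    have u: "1 \<le> u" using h R by (simp add: u_def)
    have b1: "bump' R s = - bump R s * u\<^sup>2 / R" and b2: "bump'' R s = bump R s * (u ^ 4 - 2 * u ^ 3) / R\<^sup>2"
      using h by (simp_all add: bump'_def bump''_def u_def)
    have \<kappa>0: "0 \<le> \<kappa>" using h pos by (intro order_trans[OF _ h(6)]) auto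
    define E where "E = 2 * lam * u\<^sup>2 / R * w - b * n\<^sup>2 * u\<^sup>2 + 2 * \<sigma>\<^sup>2 * n\<^sup>2 * \<kappa> * (u ^ 4 - 2 * u ^ 3) / R\<^sup>2"
    have eq: "- 2 * lam * bump' R s * w + \<sigma>\<^sup>2 * n\<^sup>2 * (bump' R s * tr + 2 * bump'' R s * \<kappa>) = bump R s * E"
      unfolding b1 b2 E_def b_def using R by (simp add: algebra_simps)
    have first: "- (a * (n * u\<^sup>2)) \<le> 2 * lam * u\<^sup>2 / R * w"
    proof -
      have "2 * lam * u\<^sup>2 / R * (- (r * n)) \<le> 2 * lam * u\<^sup>2 / R * w"
        using pos R h(5) by (intro mult_left_mono) auto
      then show ?thesis by (simp add: a_def ac_simps)
    qed
    have nN: "n\<^sup>2 \<le> N\<^sup>2" using h by (intro power_mono) auto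
    have "- p \<le> E"
    \<comment> \<open>for \<open>u \<ge> 4\<close> we have \<open>s \<ge> 3 R / 4\<close>, so that \<open>\<kappa>\<close> is bounded away from \<open>0\<close>, and \<open>2 u\<^sup>3 \<le> u\<^sup>4 / 2\<close>\<close>
    proof (cases "4 \<le> u")
      case True
      have su: "s = R - R / u" using h R by (simp add: u_def)
      have "R / u \<le> R / 4" using True R by (intro divide_left_mono) auto
      then have "3 / 4 * R \<le> s" using su by simp
      then have "3 / 4 * lm * R \<le> lm * s" using pos mult_left_mono[of "3 / 4 * R" s lm] by (simp add: ac_simps)
      then have \<kappa>: "3 / 4 * lm * R \<le> \<kappa>" using h by simp
      have u4: "u ^ 4 / 2 \<le> u ^ 4 - 2 * u ^ 3"
      proof -
        have "4 * u ^ 3 \<le> u * u ^ 3" using True by (intro mult_right_mono) auto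
        then show ?thesis by (simp add: eval_nat_numeral)
      qed
      have "c * (n\<^sup>2 * u ^ 4) = 2 * \<sigma>\<^sup>2 * n\<^sup>2 / R\<^sup>2 * ((3 / 4 * lm * R) * (u ^ 4 / 2))"
        using R by (simp add: c_def power2_eq_square field_simps)
      also have "\<dots> \<le> 2 * \<sigma>\<^sup>2 * n\<^sup>2 / R\<^sup>2 * (\<kappa> * (u ^ 4 - 2 * u ^ 3))"
        using \<kappa> u4 \<kappa>0 pos R by (intro mult_left_mono mult_mono) auto
      finally have third: "c * (n\<^sup>2 * u ^ 4) \<le> 2 * \<sigma>\<^sup>2 * n\<^sup>2 * \<kappa> * (u ^ 4 - 2 * u ^ 3) / R\<^sup>2"
        by (simp add: ac_simps)
      have q1: "- (a\<^sup>2 / (2 * c)) \<le> c / 2 * (n * u\<^sup>2)\<^sup>2 - a * (n * u\<^sup>2)" by (rule quadratic_lower[OF abc(3)])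
      have "- (N\<^sup>2 * (b\<^sup>2 / (2 * c))) \<le> n\<^sup>2 * (- (b\<^sup>2 / (2 * c)))"
        using mult_right_mono[OF nN, of "b\<^sup>2 / (2 * c)"] abc by simp
      also have "\<dots> \<le> n\<^sup>2 * (c / 2 * (u\<^sup>2)\<^sup>2 - b * u\<^sup>2)" by (intro mult_left_mono quadratic_lower abc) auto
      finally have q2: "- (N\<^sup>2 * (b\<^sup>2 / (2 * c))) \<le> c / 2 * (n * u\<^sup>2)\<^sup>2 - b * n\<^sup>2 * u\<^sup>2"
        by (simp add: algebra_simps power_mult_distrib)
      have "c / 2 * (n * u\<^sup>2)\<^sup>2 + c / 2 * (n * u\<^sup>2)\<^sup>2 = c * (n\<^sup>2 * u ^ 4)"
        by (simp add: power_mult_distrib flip: power_mult)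
      then have "- (a\<^sup>2 / (2 * c)) - (N\<^sup>2 * (b\<^sup>2 / (2 * c))) \<le> E"
        unfolding E_def using first third q1 q2 by linarith
      moreover have "0 \<le> 16 * a * N" "0 \<le> 16 * b * N\<^sup>2" "0 \<le> 256 * \<sigma>\<^sup>2 * N\<^sup>2 * K / R\<^sup>2"
        using abc pos by auto
      ultimately show ?thesis unfolding p_def by linarith
    next
      case False
      have u2: "u\<^sup>2 \<le> 16" using False u power_mono[of u 4 2] by simp
      have u3: "u ^ 3 \<le> 64" using False u power_mono[of u 4 3] by simp
      have f1: "- (16 * a * N) \<le> 2 * lam * u\<^sup>2 / R * w"
      proof -
        have "n * u\<^sup>2 \<le> N * 16" using h u2 pos by (intro mult_mono) auto
        then have "a * (n * u\<^sup>2) \<le> a * (N * 16)" using abc by (intro mult_left_mono) auto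
        then show ?thesis using first by simp
      qed
      have f2: "b * n\<^sup>2 * u\<^sup>2 \<le> 16 * b * N\<^sup>2"
      proof -
        have "n\<^sup>2 * u\<^sup>2 \<le> N\<^sup>2 * 16" using nN u2 by (intro mult_mono) auto
        then have "b * (n\<^sup>2 * u\<^sup>2) \<le> b * (N\<^sup>2 * 16)" using abc by (intro mult_left_mono) auto
        then show ?thesis by (simp add: ac_simps)
      qed
      have f3: "- (256 * \<sigma>\<^sup>2 * N\<^sup>2 * K / R\<^sup>2) \<le> 2 * \<sigma>\<^sup>2 * n\<^sup>2 * \<kappa> * (u ^ 4 - 2 * u ^ 3) / R\<^sup>2"
      proof -
        have "n\<^sup>2 * \<kappa> \<le> N\<^sup>2 * K" using nN h \<kappa>0 by (intro mult_mono) auto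
        then have "(2 * \<sigma>\<^sup>2 / R\<^sup>2 * 128) * (n\<^sup>2 * \<kappa>) \<le> (2 * \<sigma>\<^sup>2 / R\<^sup>2 * 128) * (N\<^sup>2 * K)"
          by (intro mult_left_mono) auto
        moreover have "(2 * \<sigma>\<^sup>2 / R\<^sup>2 * (n\<^sup>2 * \<kappa>)) * (- 128) \<le> (2 * \<sigma>\<^sup>2 / R\<^sup>2 * (n\<^sup>2 * \<kappa>)) * (u ^ 4 - 2 * u ^ 3)"
        proof (rule mult_left_mono)
          have "0 \<le> u ^ 4" using u by simp
          then show "- 128 \<le> u ^ 4 - 2 * u ^ 3" using u3 by linarith
        qed (use \<kappa>0 in auto)
        ultimately show ?thesis by (simp add: ac_simps)
      qed
      have "0 \<le> a\<^sup>2 / (2 * c)" "0 \<le> N\<^sup>2 * (b\<^sup>2 / (2 * c))" using abc by auto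
      then show ?thesis using f1 f2 f3 unfolding E_def p_def by linarith
    qed
    then have "bump R s * (- p) \<le> bump R s * E" by (intro mult_left_mono bump_nonneg)
    then show ?thesis unfolding eq by (simp add: mult.commute)
  qed
  then show ?thesis using p unfolding R_def by blast
qed

section \<open>Differential inequalities for Dini derivatives\<close>

text \<open>
  A continuous function with nonnegative lower right Dini derivative is nondecreasing: for each slope
  \<open>- \<epsilon>\<close>, the line through \<open>v 0\<close> with this slope stays below \<open>v\<close>, since there is no last time at which it
  does.
\<close>

lemma dini_nondecreasing:
  fixes v :: "real \<Rightarrow> real"
  assumes cont: "continuous_on {0..T} v"
    and dini: "\<And>s \<epsilon>. 0 \<le> s \<Longrightarrow> s < T \<Longrightarrow> 0 < \<epsilon> \<Longrightarrow> \<forall>\<^sub>F h in at_right 0. v s - \<epsilon> * h \<le> v (s + h)"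
    and t: "0 \<le> t" "t \<le> T"
  shows "v 0 \<le> v t"
proof -
  have "v 0 - \<epsilon> * t \<le> v t" if \<epsilon>: "0 < \<epsilon>" for \<epsilon>
  proof (rule ccontr)
    assume neg: "\<not> v 0 - \<epsilon> * t \<le> v t"
    define A where "A = {\<tau> \<in> {0..t}. v 0 - \<epsilon> * \<tau> \<le> v \<tau>}"
    have ct: "continuous_on {0..t} v" using cont t by (auto intro: continuous_on_subset)
    have "closed A" unfolding A_def
      by (intro continuous_on_closed_Collect_le continuous_intros ct)
    then have "compact ({0..t} \<inter> A)" by (intro compact_Int_closed compact_Icc)
    moreover have "{0..t} \<inter> A = A" by (auto simp: A_def)
    ultimately have "compact A" by simp
    moreover have "0 \<in> A" using t by (simp add: A_def)
    ultimately obtain c where c: "c \<in> A" "\<And>x. x \<in> A \<Longrightarrow> x \<le> c"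
      using compact_attains_sup[of A] by blast
    have ct: "0 \<le> c" "c < t" "v 0 - \<epsilon> * c \<le> v c" using c(1) neg by (auto simp: A_def less_le)
    have "\<forall>\<^sub>F h in at_right 0. h < t - c" using ct by (auto intro: eventually_at_rightI[of _ "t - c"])
    moreover have "\<forall>\<^sub>F h in at_right 0. v c - \<epsilon> * h \<le> v (c + h)" using ct t \<epsilon> by (intro dini) auto
    moreover have "\<forall>\<^sub>F h in at_right (0::real). 0 < h" by (rule eventually_at_right_less)
    ultimately have "\<forall>\<^sub>F h in at_right (0::real). False"
    proof eventually_elim
      case (elim h)
      then have "c + h \<in> A" using ct by (auto simp: A_def distrib_left)
      then show False using c(2)[of "c + h"] elim by simp
    qed
    then show False by simp
  qed
  then show ?thesis
  proof (cases "t = 0")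
    case False
    then have t0: "0 < t" using t by simp
    show ?thesis
    proof (rule field_le_epsilon)
      fix e :: real assume "0 < e"
      then show "v 0 \<le> v t + e" using \<open>\<And>\<epsilon>. 0 < \<epsilon> \<Longrightarrow> v 0 - \<epsilon> * t \<le> v t\<close>[of "e / t"] t0 by simp
    qed
  qed simp
qed

text \<open>
  The previous lemma for \<open>exp (p t) w t\<close>, using \<open>exp (p h) (1 - p h) \<ge> 1 - p\<^sup>2 h\<^sup>2\<close>.
\<close>

lemma dini_exponential_lower_bound:
  fixes w :: "real \<Rightarrow> real"
  assumes cont: "continuous_on {0..T} w" and w0: "\<And>s. 0 \<le> w s" and p: "0 \<le> p"
    and dini: "\<And>s \<epsilon>. 0 \<le> s \<Longrightarrow> s < T \<Longrightarrow> 0 < \<epsilon> \<Longrightarrow> \<forall>\<^sub>F h in at_right 0. w s - h * (p * w s + \<epsilon>) \<le> w (s + h)"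
    and t: "0 \<le> t" "t \<le> T"
  shows "w 0 * exp (- p * t) \<le> w t"
proof -
  define v where "v t = exp (p * t) * w t" for t
  have "v 0 \<le> v t"
  proof (rule dini_nondecreasing[OF _ _ t])
    show "continuous_on {0..T} v" unfolding v_def by (intro continuous_intros cont)
    fix s \<epsilon> :: real assume s: "0 \<le> s" "s < T" and \<epsilon>: "0 < \<epsilon>"
    define k where "k = exp (p * (s + 1))"
    have k: "0 < k" by (simp add: k_def)
    define e where "e = \<epsilon> / (2 * k)"
    define g where "g = v s * p\<^sup>2"
    have g: "0 \<le> g" using w0 by (simp add: g_def v_def)
    \<comment> \<open>small enough for \<open>p h \<le> 1\<close>, \<open>h \<le> 1\<close> and \<open>g h \<le> \<epsilon> / 2\<close>\<close>
    define d where "d = min (1 / (p + 1)) (\<epsilon> / (2 * (g + 1)))"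
    have d: "0 < d" using \<epsilon> g p by (simp add: d_def)
    have "\<forall>\<^sub>F h in at_right 0. h < d" using d by (auto intro: eventually_at_rightI[of _ d])
    moreover have "\<forall>\<^sub>F h in at_right 0. w s - h * (p * w s + e) \<le> w (s + h)"
      using s \<epsilon> k by (intro dini) (auto simp: e_def)
    moreover have "\<forall>\<^sub>F h in at_right (0::real). 0 < h" by (rule eventually_at_right_less)
    ultimately show "\<forall>\<^sub>F h in at_right 0. v s - \<epsilon> * h \<le> v (s + h)"
    proof eventually_elim
      case (elim h)
      have hp: "h * (p + 1) < 1" using elim p by (simp add: d_def pos_less_divide_eq)
      then have ph: "p * h \<le> 1" using elim by (simp add: algebra_simps)
      have "h * 1 \<le> h * (p + 1)" using elim p by (intro mult_left_mono) auto
      then have h1: "h < 1" using hp by simp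
      have "h * (g + 1) \<le> \<epsilon> / 2" using elim g by (simp add: d_def pos_less_divide_eq algebra_simps)
      then have h2: "g * h \<le> \<epsilon> / 2" using elim by (simp add: algebra_simps)
      have exp1: "exp (p * h) * (1 - p * h) \<ge> 1 - p\<^sup>2 * h * h"
      proof -
        have "(1 + p * h) * (1 - p * h) \<le> exp (p * h) * (1 - p * h)"
          using ph by (intro mult_right_mono exp_ge_add_one_self) auto
        then show ?thesis by (simp add: algebra_simps power2_eq_square)
      qed
      have "v s - \<epsilon> * h \<le> v s - g * h * h - exp (p * (s + h)) * (h * e)"
      proof -
        have "g * h * h \<le> \<epsilon> / 2 * h" using h2 elim by (intro mult_right_mono) auto
        moreover have "exp (p * (s + h)) * (h * e) \<le> k * (h * e)"
          unfolding k_def using elim h1 p \<epsilon> by (intro mult_right_mono) (auto simp: e_def k_def intro!: mult_left_mono)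
        moreover have "k * (h * e) = \<epsilon> / 2 * h" using k by (simp add: e_def)
        ultimately show ?thesis by simp
      qed
      also have "\<dots> \<le> exp (p * (s + h)) * (w s - h * (p * w s + e))"
      proof -
        have "v s * (1 - p\<^sup>2 * h * h) \<le> v s * (exp (p * h) * (1 - p * h))"
          using exp1 w0 by (intro mult_left_mono) (auto simp: v_def)
        then show ?thesis by (simp add: v_def g_def exp_add algebra_simps)
      qed
      also have "\<dots> \<le> v (s + h)" unfolding v_def using elim by (intro mult_left_mono) auto
      finally show ?case .
    qed
  qed
  then have "exp (- p * t) * w 0 \<le> exp (- p * t) * (exp (p * t) * w t)"
    by (intro mult_left_mono) (auto simp: v_def)
  also have "\<dots> = w t" by (simp add: exp_minus)
  finally show ?thesis by (simp add: mult.commute)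
qed

section \<open>Expansion along a leading increment and a small one\<close>

text \<open>
  The positive part of the defect relative to \<open>\<parallel>z\<parallel>\<^sup>2\<close>. It is bounded, and tends to \<open>0\<close> with \<open>z\<close> for each
  fixed \<open>y\<close>.
\<close>

definition defect_ratio :: "real \<Rightarrow> 'h::real_inner \<Rightarrow> 'h \<Rightarrow> real" where
  "defect_ratio r y z = max 0 (defect (r\<^sup>2) y z) / (norm z)\<^sup>2"

lemma defect_ratio_nonneg: "0 \<le> defect_ratio r y z"
  by (simp add: defect_ratio_def)

lemma defect_le_ratio: "defect (r\<^sup>2) y z \<le> defect_ratio r y z * (norm z)\<^sup>2"
proof (cases "z = 0")
  case True
  then show ?thesis by (simp add: defect_def)
next
  case False
  then show ?thesis by (simp add: defect_ratio_def)
qed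

lemma defect_outside:
  assumes "0 < r" "\<not> norm y < r" shows "defect (r\<^sup>2) y z \<le> 0"
proof -
  have "r\<^sup>2 \<le> (norm y)\<^sup>2" using assms by (intro power_mono) auto
  then show ?thesis using bump_nonneg[of "r\<^sup>2"] by (simp add: defect_def bump_def bump'_def bump''_def)
qed

lemma defect_ratio_bound:
  assumes r: "0 < r"
  shows "\<exists>C\<ge>0. \<forall>(y::'h::real_inner) z. defect_ratio r y z \<le> C"
proof -
  obtain C where C: "C \<ge> 0" "\<And>(y::'h) z. norm y < r \<Longrightarrow> defect (r\<^sup>2) y z \<le> C * (norm z)\<^sup>2"
    using defect_bound[OF r, where ?'h = 'h] by blast
  have "defect_ratio r y z \<le> C" for y z :: 'h
  proof (cases "z = 0")
    case True then show ?thesis using C by (simp add: defect_ratio_def)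
  next
    case False
    have "defect (r\<^sup>2) y z \<le> C * (norm z)\<^sup>2"
    proof (cases "norm y < r")
      case True then show ?thesis by (rule C(2))
    next
      case False
      have "0 \<le> C * (norm z)\<^sup>2" using C(1) by simp
      then show ?thesis using defect_outside[OF r False, of z] by linarith
    qed
    then have "max 0 (defect (r\<^sup>2) y z) \<le> C * (norm z)\<^sup>2" using C(1) by simp
    then show ?thesis using False by (simp add: defect_ratio_def pos_divide_le_eq)
  qed
  then show ?thesis using C(1) by blast
qed

lemma defect_ratio_tendsto_0:
  fixes y :: "'h::real_inner"
  assumes r: "0 < r" and z: "z \<longlonglongrightarrow> 0"
  shows "(\<lambda>n. defect_ratio r y (z n)) \<longlonglongrightarrow> 0"
proof (cases "norm y < r")
  case True
  show ?thesis
  proof (rule LIMSEQ_I)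
    fix e :: real assume e: "0 < e"
    obtain d where d: "d > 0" "\<And>z. norm z < d \<Longrightarrow> defect (r\<^sup>2) y z \<le> e / 2 * (norm z)\<^sup>2"
      using defect_little_o[OF r True, of "e / 2"] e by auto
    obtain n0 where n0: "\<And>n. n \<ge> n0 \<Longrightarrow> norm (z n) < d" using LIMSEQ_D[OF z d(1)] by auto
    have "norm (defect_ratio r y (z n) - 0) < e" if "n \<ge> n0" for n
    proof (cases "z n = 0")
      case True then show ?thesis using e by (simp add: defect_ratio_def)
    next
      case False
      have "max 0 (defect (r\<^sup>2) y (z n)) \<le> e / 2 * (norm (z n))\<^sup>2" 
        using d(2)[OF n0[OF that]] e by (intro max.boundedI) auto
      then have "defect_ratio r y (z n) \<le> e / 2" using False by (simp add: defect_ratio_def pos_divide_le_eq)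
      then show ?thesis using defect_ratio_nonneg[of r y "z n"] e by simp
    qed
    then show "\<exists>no. \<forall>n\<ge>no. norm (defect_ratio r y (z n) - 0) < e" by blast
  qed
next
  case False
  then have "defect_ratio r y (z n) = 0" for n
    using defect_outside[OF r False, of "z n"] by (simp add: defect_ratio_def max_def)
  then show ?thesis by simp
qed

text \<open>
  The quadratic part of the expansion.
\<close>

definition curv :: "real \<Rightarrow> 'h::real_inner \<Rightarrow> 'h \<Rightarrow> real" where
  "curv r y z = bump' (r\<^sup>2) ((norm y)\<^sup>2) * (norm z)\<^sup>2 + 2 * bump'' (r\<^sup>2) ((norm y)\<^sup>2) * (y \<bullet> z)\<^sup>2"

text \<open>
  A bound for the quadratic part relative to \<open>\<parallel>z\<parallel>\<^sup>2\<close>: the derivatives of the profile are at most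
  \<open>2 exp 1 / r\<^sup>2\<close> and \<open>36 exp 1 / r\<^sup>4\<close>, and the second one comes with a factor \<open>2 \<parallel>y\<parallel>\<^sup>2 < 2 r\<^sup>2\<close>.
\<close>

definition curv_const :: "real \<Rightarrow> real" where
  "curv_const r = 2 * exp 1 / r\<^sup>2 + 72 * exp 1 / r\<^sup>2"

lemma bump_coefficient_bounds:
  assumes r: "0 < r"
  shows "\<bar>bump' (r\<^sup>2) ((norm y)\<^sup>2)\<bar> \<le> 2 * exp 1 / r\<^sup>2"
    "\<bar>bump' (r\<^sup>2) ((norm y)\<^sup>2)\<bar> * norm y \<le> 2 * exp 1 / r"
    "\<bar>bump'' (r\<^sup>2) ((norm y)\<^sup>2)\<bar> * (norm y)\<^sup>2 \<le> 36 * exp 1 / r\<^sup>2"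
proof -
  have R: "0 < r\<^sup>2" using r by simp
  have "\<bar>bump' (r\<^sup>2) ((norm y)\<^sup>2)\<bar> \<le> 2 * exp 1 / r\<^sup>2 \<and> \<bar>bump' (r\<^sup>2) ((norm y)\<^sup>2)\<bar> * norm y \<le> 2 * exp 1 / r
    \<and> \<bar>bump'' (r\<^sup>2) ((norm y)\<^sup>2)\<bar> * (norm y)\<^sup>2 \<le> 36 * exp 1 / r\<^sup>2"
  proof (cases "norm y < r")
    case True
    then have yR: "(norm y)\<^sup>2 < r\<^sup>2" by (intro power_strict_mono) auto
    note b = bump_bounds[OF R yR]
    have "\<bar>bump' (r\<^sup>2) ((norm y)\<^sup>2)\<bar> * norm y \<le> 2 * exp 1 / r\<^sup>2 * r"
      using b(2) True by (intro mult_mono) auto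
    moreover have "\<bar>bump'' (r\<^sup>2) ((norm y)\<^sup>2)\<bar> * (norm y)\<^sup>2 \<le> 36 * exp 1 / (r\<^sup>2)\<^sup>2 * r\<^sup>2"
      using b(3) yR by (intro mult_mono) auto
    ultimately show ?thesis using b(2) r by (simp add: power2_eq_square)
  next
    case False
    then have "r\<^sup>2 \<le> (norm y)\<^sup>2" using r by (intro power_mono) auto
    then have "bump' (r\<^sup>2) ((norm y)\<^sup>2) = 0" "bump'' (r\<^sup>2) ((norm y)\<^sup>2) = 0"
      unfolding bump'_def bump''_def by (simp_all only: not_less[symmetric] if_False)
    then show ?thesis using r by simp
  qed
  then show "\<bar>bump' (r\<^sup>2) ((norm y)\<^sup>2)\<bar> \<le> 2 * exp 1 / r\<^sup>2"
    "\<bar>bump' (r\<^sup>2) ((norm y)\<^sup>2)\<bar> * norm y \<le> 2 * exp 1 / r"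
    "\<bar>bump'' (r\<^sup>2) ((norm y)\<^sup>2)\<bar> * (norm y)\<^sup>2 \<le> 36 * exp 1 / r\<^sup>2" by auto
qed

lemma curv_bilinear_bound:
  assumes r: "0 < r"
  shows "\<bar>bump' (r\<^sup>2) ((norm y)\<^sup>2) * (a \<bullet> b) + 2 * bump'' (r\<^sup>2) ((norm y)\<^sup>2) * ((y \<bullet> a) * (y \<bullet> b))\<bar>
    \<le> curv_const r * (norm a * norm b)"
proof -
  let ?slope = "bump' (r\<^sup>2) ((norm y)\<^sup>2)" and ?bend = "bump'' (r\<^sup>2) ((norm y)\<^sup>2)"
  have 1: "\<bar>?slope * (a \<bullet> b)\<bar> \<le> 2 * exp 1 / r\<^sup>2 * (norm a * norm b)"
    unfolding abs_mult using bump_coefficient_bounds(1)[OF r, of y] Cauchy_Schwarz_ineq2[of a b]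
    by (intro mult_mono) auto
  have "\<bar>(y \<bullet> a) * (y \<bullet> b)\<bar> \<le> (norm y * norm a) * (norm y * norm b)"
    unfolding abs_mult by (intro mult_mono Cauchy_Schwarz_ineq2) auto
  then have "\<bar>?bend\<bar> * \<bar>(y \<bullet> a) * (y \<bullet> b)\<bar> \<le> \<bar>?bend\<bar> * ((norm y * norm a) * (norm y * norm b))"
    by (intro mult_left_mono) auto
  also have "\<dots> = (\<bar>?bend\<bar> * (norm y)\<^sup>2) * (norm a * norm b)" by (simp add: power2_eq_square)
  also have "\<dots> \<le> (36 * exp 1 / r\<^sup>2) * (norm a * norm b)"
    using bump_coefficient_bounds(3)[OF r, of y] by (intro mult_right_mono) auto
  finally have 2: "\<bar>2 * ?bend * ((y \<bullet> a) * (y \<bullet> b))\<bar> \<le> 72 * exp 1 / r\<^sup>2 * (norm a * norm b)"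
    by (simp add: abs_mult)
  show ?thesis using 1 2 abs_triangle_ineq[of "?slope * (a \<bullet> b)" "2 * ?bend * ((y \<bullet> a) * (y \<bullet> b))"]
    unfolding curv_const_def distrib_right by linarith
qed

lemma curv_bound: "0 < r \<Longrightarrow> \<bar>curv r y a\<bar> \<le> curv_const r * (norm a)\<^sup>2"
  using curv_bilinear_bound[of r y a a] by (simp add: curv_def power2_norm_eq_inner power2_eq_square[symmetric])

lemma curv_const_nonneg: "0 \<le> curv_const r"
  by (simp add: curv_const_def)

lemma curv_perturb:
  assumes r: "0 < r" and \<delta>: "0 < \<delta>"
  shows "curv r y a - curv_const r * \<delta> * (norm a)\<^sup>2 - curv_const r * (1 / \<delta> + 1) * (norm b)\<^sup>2 \<le> curv r y (a + b)"
proof -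
  let ?slope = "bump' (r\<^sup>2) ((norm y)\<^sup>2)" and ?bend = "bump'' (r\<^sup>2) ((norm y)\<^sup>2)"
  let ?B = "?slope * (a \<bullet> b) + 2 * ?bend * ((y \<bullet> a) * (y \<bullet> b))"
  have "(norm (a + b))\<^sup>2 = (norm a)\<^sup>2 + (2 * (a \<bullet> b) + (norm b)\<^sup>2)" by (rule norm_add_square)
  then have eq: "curv r y (a + b) = curv r y a + 2 * ?B + curv r y b"
    unfolding curv_def inner_add_right power2_sum by (simp add: algebra_simps)
  have ab: "2 * (norm a * norm b) \<le> \<delta> * (norm a)\<^sup>2 + 1 / \<delta> * (norm b)\<^sup>2"
  proof -
    have "0 \<le> (\<delta> * norm a - norm b)\<^sup>2 / \<delta>" using \<delta> by simp
    also have "\<dots> = \<delta> * (norm a)\<^sup>2 + 1 / \<delta> * (norm b)\<^sup>2 - 2 * (norm a * norm b)"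
      using \<delta> by (simp add: power2_eq_square field_simps)
    finally show ?thesis by simp
  qed
  have "- 2 * ?B \<le> curv_const r * (2 * (norm a * norm b))"
  proof -
    have "- ?B \<le> curv_const r * (norm a * norm b)"
      by (rule abs_le_D2[OF curv_bilinear_bound[OF r]])
    then show ?thesis by simp
  qed
  also have "\<dots> \<le> curv_const r * (\<delta> * (norm a)\<^sup>2 + 1 / \<delta> * (norm b)\<^sup>2)"
    using ab curv_const_nonneg by (intro mult_left_mono)
  finally have "- 2 * ?B \<le> curv_const r * (\<delta> * (norm a)\<^sup>2 + 1 / \<delta> * (norm b)\<^sup>2)" .
  moreover have "- curv r y b \<le> curv_const r * (norm b)\<^sup>2" using curv_bound[OF r, of y b] by linarith
  moreover have "curv_const r * (\<delta> * (norm a)\<^sup>2 + 1 / \<delta> * (norm b)\<^sup>2) + curv_const r * (norm b)\<^sup>2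
    = curv_const r * \<delta> * (norm a)\<^sup>2 + curv_const r * (1 / \<delta> + 1) * (norm b)\<^sup>2"
    by (simp only: distrib_left distrib_right mult.assoc mult_1_left)
  ultimately show ?thesis unfolding eq by linarith
qed

text \<open>
  The form of the expansion that is used for an increment \<open>a + b\<close> of the process, where \<open>a\<close> is the
  frozen noise and \<open>b\<close> is small in mean square. The quadratic part is evaluated at \<open>a\<close> only. What is lost
  is a small multiple of \<open>\<parallel>a\<parallel>\<^sup>2\<close>, a large multiple of \<open>\<parallel>b\<parallel>\<^sup>2\<close>, and \<open>\<parallel>a\<parallel>\<^sup>2\<close> times a factor that tends to \<open>0\<close>.
\<close>

theorem bump_increment_lower_bound:
  fixes y a b :: "'h::real_inner"
  assumes r: "0 < r" and \<delta>: "0 < \<delta>" and C: "\<And>(y::'h) z. defect_ratio r y z \<le> C"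
  shows "bump (r\<^sup>2) ((norm y)\<^sup>2) + 2 * bump' (r\<^sup>2) ((norm y)\<^sup>2) * (y \<bullet> (a + b)) + curv r y a
      - curv_const r * \<delta> * (norm a)\<^sup>2 - (curv_const r * (1 / \<delta> + 1) + 2 * C) * (norm b)\<^sup>2 - 2 * (defect_ratio r y (a + b) * (norm a)\<^sup>2)
    \<le> bump (r\<^sup>2) ((norm (y + (a + b)))\<^sup>2)"
proof -
  let ?\<rho> = "defect_ratio r y (a + b)"
  have "bump (r\<^sup>2) ((norm y)\<^sup>2) + 2 * bump' (r\<^sup>2) ((norm y)\<^sup>2) * (y \<bullet> (a + b)) + curv r y (a + b) - ?\<rho> * (norm (a + b))\<^sup>2
    \<le> bump (r\<^sup>2) ((norm (y + (a + b)))\<^sup>2)"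
    using defect_le_ratio[of r y "a + b"] unfolding defect_def curv_def by linarith
  moreover have "?\<rho> * (norm (a + b))\<^sup>2 \<le> 2 * (?\<rho> * (norm a)\<^sup>2) + 2 * C * (norm b)\<^sup>2"
  proof -
    have "(norm (a + b))\<^sup>2 \<le> (norm a + norm b)\<^sup>2" by (intro power_mono norm_triangle_ineq) auto
    also have "\<dots> \<le> 2 * (norm a)\<^sup>2 + 2 * (norm b)\<^sup>2" using sum_squares_bound[of "norm a" "norm b"] by (simp add: power2_sum)
    finally have "?\<rho> * (norm (a + b))\<^sup>2 \<le> ?\<rho> * (2 * (norm a)\<^sup>2 + 2 * (norm b)\<^sup>2)"
      by (intro mult_left_mono defect_ratio_nonneg)
    also have "\<dots> = 2 * (?\<rho> * (norm a)\<^sup>2) + ?\<rho> * (2 * (norm b)\<^sup>2)" by (simp add: algebra_simps)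
    also have "?\<rho> * (2 * (norm b)\<^sup>2) \<le> C * (2 * (norm b)\<^sup>2)" using C by (intro mult_right_mono) auto
    finally show ?thesis by simp
  qed
  ultimately show ?thesis using curv_perturb[OF r \<delta>, of y a b] by (simp add: distrib_right)
qed

section \<open>Averages over shrinking intervals\<close>

lemma average_tendsto_0:
  fixes g :: "real \<Rightarrow> real"
  assumes g: "(g \<longlongrightarrow> 0) (at_right s)" and h: "\<And>n. 0 < h n" "h \<longlonglongrightarrow> 0"
  shows "(\<lambda>n. ennreal (1 / h n) * (\<integral>\<^sup>+u. indicator {s<..s + h n} u * ennreal (g u) \<partial>lborel)) \<longlonglongrightarrow> 0"
proof (rule order_tendstoI)
  fix a :: ennreal assume "0 < a"
  then obtain b where b: "0 < b" "b < a" using dense by blast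
  define \<epsilon> where "\<epsilon> = enn2real b"
  have \<epsilon>: "0 < \<epsilon>" "ennreal \<epsilon> < a"
  proof -
    have "b < \<top>" by (rule less_le_trans[OF b(2) top_greatest])
    then show "0 < \<epsilon>" "ennreal \<epsilon> < a" using b by (simp_all add: \<epsilon>_def enn2real_positive_iff)
  qed
  have "\<forall>\<^sub>F u in at_right s. g u < \<epsilon>" using g \<epsilon>(1) by (rule order_tendstoD(2))
  then obtain c where c: "s < c" "\<And>u. s < u \<Longrightarrow> u < c \<Longrightarrow> g u < \<epsilon>"
    unfolding eventually_at_right_field by blast
  have "\<forall>\<^sub>F n in sequentially. h n < c - s" using h(2) c(1) by (intro order_tendstoD(2)) auto
  then show "\<forall>\<^sub>F n in sequentially. ennreal (1 / h n) * (\<integral>\<^sup>+u. indicator {s<..s + h n} u * ennreal (g u) \<partial>lborel) < a"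
  proof eventually_elim
    case (elim n)
    have "indicator {s<..s + h n} u * ennreal (g u) \<le> ennreal \<epsilon> * indicator {s<..s + h n} u" for u
    proof (cases "u \<in> {s<..s + h n}")
      case True
      then have "g u \<le> \<epsilon>" using c(2)[of u] elim by auto
      then show ?thesis using True by (simp add: ennreal_leI)
    qed simp
    then have "(\<integral>\<^sup>+u. indicator {s<..s + h n} u * ennreal (g u) \<partial>lborel) \<le> (\<integral>\<^sup>+u. ennreal \<epsilon> * indicator {s<..s + h n} u \<partial>lborel)"
      by (intro nn_integral_mono)
    also have "\<dots> = ennreal \<epsilon> * ennreal (h n)"
      using h(1)[of n] by (subst nn_integral_cmult_indicator) auto
    finally have "ennreal (1 / h n) * (\<integral>\<^sup>+u. indicator {s<..s + h n} u * ennreal (g u) \<partial>lborel)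
      \<le> ennreal (1 / h n) * (ennreal \<epsilon> * ennreal (h n))"
      by (rule mult_left_mono) simp
    also have "\<dots> = ennreal \<epsilon>"
      using h(1)[of n] \<epsilon>(1) by (simp flip: ennreal_mult)
    finally show ?case using \<epsilon>(2) by (rule le_less_trans)
  qed
qed simp

lemma set_integral_near_constant:
  fixes f :: "real \<Rightarrow> 'b::{banach, second_countable_topology}"
  assumes st: "s < t" and f: "continuous_on {s..t} f" and \<epsilon>: "\<And>u. s \<le> u \<Longrightarrow> u \<le> t \<Longrightarrow> norm (f u - c) \<le> \<epsilon>"
  shows "norm ((LINT u:{s..t}|lborel. f u) - (t - s) *\<^sub>R c) \<le> \<epsilon> * (t - s)"
proof -
  have i: "set_integrable lborel {s..t} f" "set_integrable lborel {s..t} (\<lambda>_. c)" "set_integrable lborel {s..t} (\<lambda>_. \<epsilon>)"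
    "set_integrable lborel {s..t} (\<lambda>u. f u - c)" "set_integrable lborel {s..t} (\<lambda>u. norm (f u - c))"
    by (intro borel_integrable_atLeastAtMost' continuous_intros f)+
  have const: "(LINT u:{s..t}|lborel. d) = (t - s) *\<^sub>R d" for d :: "'d::{banach, second_countable_topology}"
    using st by (simp add: set_lebesgue_integral_def)
  have "norm ((LINT u:{s..t}|lborel. f u) - (t - s) *\<^sub>R c) = norm (LINT u:{s..t}|lborel. f u - c)"
    by (subst set_integral_diff(2)[OF i(1,2)], subst const) simp
  also have "\<dots> \<le> (LINT u:{s..t}|lborel. norm (f u - c))" by (rule set_integral_norm_bound[OF i(4)])
  also have "\<dots> \<le> (LINT u:{s..t}|lborel. \<epsilon>)" by (rule set_integral_mono[OF i(5,3)]) (use \<epsilon> in auto)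
  also have "\<dots> = \<epsilon> * (t - s)" by (subst const) simp
  finally show ?thesis .
qed

lemma set_integral_increment:
  fixes f :: "real \<Rightarrow> 'b::{banach, second_countable_topology}"
  assumes st: "a \<le> s" "s \<le> t" and f: "continuous_on {a..t} f"
  shows "(LINT u:{a..t}|lborel. f u) - (LINT u:{a..s}|lborel. f u) = (LINT u:{s..t}|lborel. f u)"
proof -
  have i: "set_integrable lborel {a..t} f" by (rule borel_integrable_atLeastAtMost'[OF f])
  have i1: "set_integrable lborel {a..s} f" "set_integrable lborel {s<..t} f" "set_integrable lborel {s..t} f"
    using st by (auto intro!: set_integrable_subset[OF i])
  have "{a..t} = {a..s} \<union> {s<..t}" using st by auto
  then have "(LINT u:{a..t}|lborel. f u) = (LINT u:{a..s}|lborel. f u) + (LINT u:{s<..t}|lborel. f u)"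
    using set_integral_Un[OF _ i1(1,2)] by (simp add: ivl_disj_int)
  moreover have "(LINT u:{s<..t}|lborel. f u) = (LINT u:{s..t}|lborel. f u)"
  proof (rule set_integral_cong_set)
    show "set_borel_measurable lborel {s<..t} f" "set_borel_measurable lborel {s..t} f"
      using i1 by (auto simp: set_integrable_def set_borel_measurable_def)
    have "AE u in lborel. u \<noteq> s" by (rule AE_lborel_singleton)
    then show "AE u in lborel. (u \<in> {s..t}) = (u \<in> {s<..t})"
      by eventually_elim auto
  qed
  ultimately show ?thesis by simp
qed

section \<open>Continuous paths on a compact interval\<close>

lemma closure_rationals_Icc:
  fixes T :: real assumes "0 < T"
  shows "closure (\<rat> \<inter> {0..T}) = {0..T}"
proof
  show "closure (\<rat> \<inter> {0..T}) \<subseteq> {0..T}" by (intro closure_minimal) auto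
  have "{0<..<T} \<inter> closure \<rat> \<subseteq> closure ({0<..<T} \<inter> (\<rat> :: real set))"
    by (rule open_Int_closure_subset) simp
  then have "{0<..<T} \<subseteq> closure ({0<..<T} \<inter> (\<rat> :: real set))" by (simp add: Rats_closure_real)
  also have "\<dots> \<subseteq> closure (\<rat> \<inter> {0..T})" by (intro closure_mono) auto
  finally have "closure {0<..<T} \<subseteq> closure (\<rat> \<inter> {0..T})" by (rule closure_minimal) simp
  then show "{0..T} \<subseteq> closure (\<rat> \<inter> {0..T})" using assms by simp
qed

text \<open>
  A closed condition on a continuous path follows from its validity at rational times. So almost sure
  statements at each time become almost sure statements at all times.
\<close>

lemma continuous_in_closed_from_rationals:
  fixes f :: "real \<Rightarrow> 'b::topological_space"
  assumes "0 < T" "continuous_on {0..T} f" "closed S" "\<And>q. q \<in> \<rat> \<Longrightarrow> q \<in> {0..T} \<Longrightarrow> f q \<in> S" and t: "t \<in> {0..T}"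
  shows "f t \<in> S"
proof -
  have "f ` closure (\<rat> \<inter> {0..T}) \<subseteq> S"
    using assms by (intro image_closure_subset) (auto simp: closure_rationals_Icc)
  then show ?thesis using t by (auto simp: closure_rationals_Icc[OF assms(1)])
qed

text \<open>
  Gronwall's lemma without initial value: \<open>exp (- c t)\<close> times the integral of \<open>n\<close> is nonincreasing.
\<close>

lemma gronwall_zero:
  fixes n :: "real \<Rightarrow> real"
  assumes cont: "continuous_on {0..T} n" and c: "0 \<le> c"
    and le: "\<And>t. t \<in> {0..T} \<Longrightarrow> n t \<le> c * integral {0..t} n" and t: "t \<in> {0..T}"
  shows "n t \<le> 0"
proof -
  define N where "N = (\<lambda>t. integral {0..t} n)"
  have N: "(N has_real_derivative n x) (at x within {0..T})" if "x \<in> {0..T}" for x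
    unfolding N_def by (rule integral_has_real_derivative[OF cont that])
  have Nc: "continuous_on {0..t} (\<lambda>u. - (exp (- c * u) * N u))"
  proof -
    have "continuous_on {0..T} N" using N by (rule DERIV_continuous_on)
    then have "continuous_on {0..t} N" using t by (auto intro: continuous_on_subset)
    then show ?thesis by (intro continuous_intros)
  qed
  have "- (exp (- c * 0) * N 0) \<le> - (exp (- c * t) * N t)"
  proof (rule DERIV_nonneg_imp_increasing_open[OF _ _ Nc])
    show "0 \<le> t" using t by simp
    fix x assume x: "0 < x" "x < t"
    then have "x \<in> interior {0..T}" using t by simp
    then have "at x within {0..T} = at x" by (rule at_within_interior)
    moreover have "x \<in> {0..T}" using x t by simp
    ultimately have "(N has_real_derivative n x) (at x)" using N[of x] by simp
    then have "((\<lambda>u. - (exp (- c * u) * N u)) has_real_derivative exp (- c * x) * (c * N x - n x)) (at x)"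
      by (auto intro!: derivative_eq_intros simp: algebra_simps)
    moreover have "0 \<le> exp (- c * x) * (c * N x - n x)"
      using le[of x] x t by (simp add: N_def)
    ultimately show "\<exists>y. ((\<lambda>u. - (exp (- c * u) * N u)) has_real_derivative y) (at x) \<and> 0 \<le> y" by blast
  qed
  then have "N t \<le> 0" by (simp add: N_def mult_le_0_iff)
  then have "c * N t \<le> 0" using c by (simp add: mult_le_0_iff)
  then show ?thesis using le[OF t] by (simp add: N_def)
qed

section \<open>The consensus-based process\<close>

text \<open>
  The hypotheses on the process in the form in which they are used: \<open>basis\<close> is an orthonormal basis of \<open>V\<close>
  and \<open>I\<close> is the stochastic integral in the equation.
\<close>

locale cbo_setting = wiener_filtration M F Q W
  for M :: "'a measure" and F :: "real \<Rightarrow> 'a measure"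
    and Q :: "'h::{real_inner, banach, polish_space} \<Rightarrow>\<^sub>L 'h"
    and W :: "real \<Rightarrow> 'a \<Rightarrow> 'h" +
  fixes X I :: "real \<Rightarrow> 'a \<Rightarrow> 'h" and \<xi> :: "'a \<Rightarrow> 'h" and V :: "'h set" and \<E> :: "'h \<Rightarrow> real"
    and xstar :: 'h and \<alpha> lam \<sigma> T B :: real and basis :: "'h set" and lmin :: real
  assumes inf: "infinite_dimensional TYPE('h)"
    and E_cont: "continuous_on UNIV \<E>"
    and pos: "\<alpha> > 0" "lam > 0" "\<sigma> > 0" "T > 0" "B > 0" "lmin > 0"
    and basis: "finite basis" "orthonormal_set basis" "V = span basis"
    and E_min: "\<And>x. \<E> xstar \<le> \<E> x" and xstar: "xstar \<in> V"
    and xi_V: "AE \<omega> in M. \<xi> \<omega> \<in> V"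
    and lmin: "\<And>v. v \<in> V \<Longrightarrow> lmin * (norm v)\<^sup>2 \<le> v \<bullet> Q v"
    and X_pred: "predictable F T X"
    and X_cont: "AE \<omega> in M. continuous_on {0..T} (\<lambda>t. X t \<omega>)"
    and X_sup_finite: "(\<integral>\<^sup>+\<omega>. (SUP t\<in>{0..T}. ennreal ((norm (X t \<omega>))\<^sup>2)) \<partial>M) < \<infinity>"
    and ito: "ito_integral M F Q W T
      (\<lambda>t \<omega>. \<sigma> *\<^sub>R diffusion_op V (X t \<omega> - consensus_point \<E> \<alpha> (distr M borel (X t)))) I"
    and X_eq: "AE \<omega> in M. \<forall>t\<in>{0..T}. X t \<omega> = \<xi> \<omega>
        + (LINT s:{0..t}|lborel. - lam *\<^sub>R (X s \<omega> - consensus_point \<E> \<alpha> (distr M borel (X s)))) + I t \<omega>"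
    and m_bound: "\<And>t. t \<in> {0..T} \<Longrightarrow> norm (xstar - consensus_point \<E> \<alpha> (distr M borel (X t))) \<le> B"
begin

definition m :: "real \<Rightarrow> 'h" where "m t = consensus_point \<E> \<alpha> (distr M borel (X t))"

definition P :: "'h \<Rightarrow>\<^sub>L 'h" where "P = orth_proj V"

lemma P_eq: "P x = (\<Sum>v\<in>basis. (x \<bullet> v) *\<^sub>R v)"
  using orth_proj_eq[OF basis(1,2), of x] unfolding basis(3)[symmetric] P_def[symmetric] .

lemma P_sym: "P x \<bullet> y = x \<bullet> P y"
  unfolding P_eq inner_sum_left inner_sum_right by (simp add: inner_commute mult.commute)

lemma P_basis: "v \<in> basis \<Longrightarrow> P v = v"
proof -
  assume v: "v \<in> basis"
  have "P v = (\<Sum>w\<in>basis. if w = v then v else 0)"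
    unfolding P_eq using basis(2) v by (intro sum.cong) (auto simp: orthonormal_set_def)
  then show ?thesis using v basis(1) by simp
qed

lemma P_in_V: "P x \<in> V"
proof -
  have "P x \<in> span basis" unfolding P_eq by (intro span_sum span_mul span_base)
  then show ?thesis unfolding basis(3)[symmetric] .
qed

lemma P_V: "x \<in> V \<Longrightarrow> P x = x"
proof -
  assume "x \<in> V"
  then have "x \<in> span basis" by (simp only: basis(3)[symmetric])
  then show "P x = x"
  proof (induction rule: span_induct_alt)
    case base show ?case by (simp add: blinfun.zero_right)
  next
    case (step c x y) then show ?case by (simp add: blinfun.add_right blinfun.scaleR_right P_basis)
  qed
qed

lemma V_iff: "x \<in> V \<longleftrightarrow> P x = x"
  using P_V P_in_V by metis

lemma P_idem: "P (P x) = P x"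
  by (rule P_V[OF P_in_V])

lemma closed_V: "closed V"
proof -
  have "V = {x. P x = x}" using V_iff by blast
  moreover have "closed {x. P x = x}"
    by (intro closed_Collect_eq continuous_intros linear_continuous_on blinfun.bounded_linear_right)
  ultimately show ?thesis by simp
qed

lemma norm_P_square: "(norm (P x))\<^sup>2 = (\<Sum>v\<in>basis. (x \<bullet> v)\<^sup>2)"
proof -
  have "P x \<bullet> P x = x \<bullet> P x" unfolding P_sym P_idem by simp
  also have "\<dots> = (\<Sum>v\<in>basis. (x \<bullet> v)\<^sup>2)" unfolding P_eq[of x] inner_sum_right by (simp add: power2_eq_square)
  finally show ?thesis by (simp add: power2_norm_eq_inner)
qed

lemma basis_norm: "v \<in> basis \<Longrightarrow> norm v = 1"
  using basis(2) by (simp add: orthonormal_set_def norm_eq_1)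

text \<open>
  The predictable \<open>\<sigma>\<close>-algebra is generated by subsets of \<open>[0, T] \<times> \<Omega>\<close>, which makes maps into it
  measurable as soon as preimages of the generators are.
\<close>

lemma predictable_generators_subset:
  "{{s<..u} \<times> A |s u A. 0 \<le> s \<and> s < u \<and> u \<le> T \<and> A \<in> sets (F s)} \<union> {{0} \<times> A |A. A \<in> sets (F 0)}
    \<subseteq> Pow ({0..T} \<times> space (F 0))"
proof -
  have "A \<subseteq> space (F 0)" if "0 \<le> s" "A \<in> sets (F s)" for s A
    using sets.sets_into_space[OF that(2)] that(1) by (simp add: space_F)
  then show ?thesis using pos by fastforce
qed

lemma X_measurable_F:
  assumes t: "t \<in> {0..T}"
  shows "X t \<in> F t \<rightarrow>\<^sub>M borel"
proof -
  have "(\<lambda>\<omega>. (t, \<omega>)) \<in> F t \<rightarrow>\<^sub>M predictable_sigma F T"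
    unfolding predictable_sigma_def
  proof (rule measurable_measure_of[OF predictable_generators_subset])
    show "(\<lambda>\<omega>. (t, \<omega>)) \<in> space (F t) \<rightarrow> {0..T} \<times> space (F 0)" using t by (auto simp: space_F)
    fix C assume "C \<in> {{s<..u} \<times> A |s u A. 0 \<le> s \<and> s < u \<and> u \<le> T \<and> A \<in> sets (F s)} \<union> {{0} \<times> A |A. A \<in> sets (F 0)}"
    then consider s u A where "C = {s<..u} \<times> A" "0 \<le> s" "A \<in> sets (F s)" | A where "C = {0} \<times> A" "A \<in> sets (F 0)" by blast
    then show "(\<lambda>\<omega>. (t, \<omega>)) -` C \<inter> space (F t) \<in> sets (F t)"
    proof cases
      case (1 s u A)
      show ?thesis
      proof (cases "t \<in> {s<..u}")
        case True
        then have "A \<in> sets (F t)" using F_mono[OF 1(2), of t] 1(3) by (auto simp: subalgebra_def)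
        moreover have "(\<lambda>\<omega>. (t, \<omega>)) -` C \<inter> space (F t) = A \<inter> space (F t)" using True 1(1) by auto
        ultimately show ?thesis by simp
      next
        case False
        then have "(\<lambda>\<omega>. (t, \<omega>)) -` C \<inter> space (F t) = {}" using 1(1) by auto
        then show ?thesis by simp
      qed
    next
      case (2 A)
      show ?thesis
      proof (cases "t = 0")
        case True
        then have "(\<lambda>\<omega>. (t, \<omega>)) -` C \<inter> space (F t) = A \<inter> space (F t)" using 2(1) by auto
        then show ?thesis using 2(2) True by simp
      next
        case False
        then have "(\<lambda>\<omega>. (t, \<omega>)) -` C \<inter> space (F t) = {}" using 2(1) by auto
        then show ?thesis by simp
      qed
    qed
  qed
  from measurable_compose[OF this X_pred[unfolded predictable_def]] show ?thesis by simp
qed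

lemma X_measurable: "t \<in> {0..T} \<Longrightarrow> X t \<in> M \<rightarrow>\<^sub>M borel"
  using measurable_F[OF _ X_measurable_F] by simp

text \<open>
  Outside \<open>[0, T]\<close> the process is unconstrained; there it is replaced by \<open>0\<close>.
\<close>

lemma X_joint: "(\<lambda>(\<omega>, u). indicat_real {0..T} u *\<^sub>R X u \<omega>) \<in> M \<Otimes>\<^sub>M lborel \<rightarrow>\<^sub>M borel"
proof -
  let ?S = "space M \<times> {0..T}"
  have S: "?S \<in> sets (M \<Otimes>\<^sub>M lborel)" by (intro pair_measureI) auto
  have "(\<lambda>(\<omega>, u). (u, \<omega>)) \<in> restrict_space (M \<Otimes>\<^sub>M lborel) ?S \<rightarrow>\<^sub>M predictable_sigma F T"
    unfolding predictable_sigma_def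
  proof (rule measurable_measure_of[OF predictable_generators_subset])
    show "(\<lambda>(\<omega>, u). (u, \<omega>)) \<in> space (restrict_space (M \<Otimes>\<^sub>M lborel) ?S) \<rightarrow> {0..T} \<times> space (F 0)"
      by (auto simp: space_restrict_space space_F)
    fix C assume "C \<in> {{s<..u} \<times> A |s u A. 0 \<le> s \<and> s < u \<and> u \<le> T \<and> A \<in> sets (F s)} \<union> {{0} \<times> A |A. A \<in> sets (F 0)}"
    then consider s u A where "C = {s<..u} \<times> A" "0 \<le> s" "A \<in> sets (F s)" | A where "C = {0} \<times> A" "A \<in> sets (F 0)" by blast
    then obtain J A s where C: "C = J \<times> A" "J \<in> sets borel" "0 \<le> s" "A \<in> sets (F s)"
    proof cases
      case (1 s u A)
      show thesis by (rule that[OF 1(1) _ 1(2,3)]) simp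
    next
      case (2 A)
      show thesis by (rule that[OF 2(1) _ order_refl 2(2)]) simp
    qed
    have "A \<in> sets M" using F_subalgebra[OF C(3)] C(4) by (auto simp: subalgebra_def)
    then have "(A \<times> J) \<in> sets (M \<Otimes>\<^sub>M lborel)" using C by (intro pair_measureI) auto
    then have "?S \<inter> (A \<times> J) \<in> sets (restrict_space (M \<Otimes>\<^sub>M lborel) ?S)"
      by (auto simp: sets_restrict_space)
    moreover have "(\<lambda>(\<omega>, u). (u, \<omega>)) -` C \<inter> space (restrict_space (M \<Otimes>\<^sub>M lborel) ?S) = ?S \<inter> (A \<times> J)"
      using C(1) by (auto simp: space_restrict_space space_pair_measure)
    ultimately show "(\<lambda>(\<omega>, u). (u, \<omega>)) -` C \<inter> space (restrict_space (M \<Otimes>\<^sub>M lborel) ?S) \<in> sets (restrict_space (M \<Otimes>\<^sub>M lborel) ?S)"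
      by simp
  qed
  from measurable_compose[OF this X_pred[unfolded predictable_def]]
  have "(\<lambda>z. X (snd z) (fst z)) \<in> restrict_space (M \<Otimes>\<^sub>M lborel) ?S \<rightarrow>\<^sub>M borel"
    by (simp add: split_beta')
  then have "(\<lambda>z. indicat_real ?S z *\<^sub>R X (snd z) (fst z)) \<in> M \<Otimes>\<^sub>M lborel \<rightarrow>\<^sub>M borel"
    using S by (subst (asm) borel_measurable_restrict_space_iff) (auto simp: Int_absorb2 space_pair_measure)
  also have "(\<lambda>z. indicat_real ?S z *\<^sub>R X (snd z) (fst z)) \<in> M \<Otimes>\<^sub>M lborel \<rightarrow>\<^sub>M borel
    \<longleftrightarrow> (\<lambda>(\<omega>, u). indicat_real {0..T} u *\<^sub>R X u \<omega>) \<in> M \<Otimes>\<^sub>M lborel \<rightarrow>\<^sub>M borel"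
    by (intro measurable_cong) (auto simp: space_pair_measure indicator_def)
  finally show ?thesis .
qed

text \<open>
  A measurable square integrable bound for the paths. The supremum over rational times is measurable,
  and by continuity it is the supremum over all times almost surely.
\<close>

lemma dominator_exists:
  obtains X_sup where "X_sup \<in> borel_measurable M" "\<And>\<omega>. 0 \<le> X_sup \<omega>" "integrable M (\<lambda>\<omega>. (X_sup \<omega>)\<^sup>2)"
    "AE \<omega> in M. \<forall>t\<in>{0..T}. norm (X t \<omega>) \<le> X_sup \<omega>"
proof -
  define q where "q \<omega> = (SUP t\<in>\<rat> \<inter> {0..T}. ennreal ((norm (X t \<omega>))\<^sup>2))" for \<omega>
  have cnt: "countable (\<rat> \<inter> {0..T})" using countable_rat by (rule countable_subset[rotated]) auto
  have [measurable]: "q \<in> borel_measurable M" unfolding q_def[abs_def]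
  proof (rule borel_measurable_SUP[OF cnt])
    fix t assume "t \<in> \<rat> \<inter> {0..T}"
    then have [measurable]: "X t \<in> M \<rightarrow>\<^sub>M borel" by (intro X_measurable) auto
    show "(\<lambda>\<omega>. ennreal ((norm (X t \<omega>))\<^sup>2)) \<in> borel_measurable M" by measurable
  qed
  have "(\<integral>\<^sup>+\<omega>. q \<omega> \<partial>M) \<le> (\<integral>\<^sup>+\<omega>. (SUP t\<in>{0..T}. ennreal ((norm (X t \<omega>))\<^sup>2)) \<partial>M)"
    unfolding q_def by (intro nn_integral_mono SUP_subset_mono) auto
  then have fin: "(\<integral>\<^sup>+\<omega>. q \<omega> \<partial>M) < \<infinity>" using X_sup_finite by (rule le_less_trans)
  then have qfin: "AE \<omega> in M. q \<omega> \<noteq> \<infinity>" by (intro nn_integral_PInf_AE) auto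
  define X_sup where "X_sup \<omega> = sqrt (enn2real (q \<omega>))" for \<omega>
  have [measurable]: "X_sup \<in> borel_measurable M" unfolding X_sup_def[abs_def] by measurable
  have "integrable M (\<lambda>\<omega>. (X_sup \<omega>)\<^sup>2)"
  proof (rule integrableI_bounded)
    have "(\<integral>\<^sup>+\<omega>. ennreal (norm ((X_sup \<omega>)\<^sup>2)) \<partial>M) = (\<integral>\<^sup>+\<omega>. q \<omega> \<partial>M)"
      using qfin by (intro nn_integral_cong_AE) (auto simp: X_sup_def less_top)
    then show "(\<integral>\<^sup>+\<omega>. ennreal (norm ((X_sup \<omega>)\<^sup>2)) \<partial>M) < \<infinity>" using fin by simp
  qed measurable
  moreover have "AE \<omega> in M. \<forall>t\<in>{0..T}. norm (X t \<omega>) \<le> X_sup \<omega>"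
    using qfin X_cont
  proof eventually_elim
    case (elim \<omega>)
    have "X t \<omega> \<in> cball 0 (X_sup \<omega>)" if "t \<in> {0..T}" for t
    proof (rule continuous_in_closed_from_rationals[OF pos(4) elim(2) _ _ that])
      fix s :: real assume s: "s \<in> \<rat>" "s \<in> {0..T}"
      have "ennreal ((norm (X s \<omega>))\<^sup>2) \<le> q \<omega>" unfolding q_def using s by (intro SUP_upper) auto
      also have "q \<omega> = ennreal ((X_sup \<omega>)\<^sup>2)" using elim(1) by (simp add: X_sup_def less_top)
      finally have "(norm (X s \<omega>))\<^sup>2 \<le> (X_sup \<omega>)\<^sup>2" by simp
      then have "norm (X s \<omega>) \<le> X_sup \<omega>" by (rule power2_le_imp_le) (simp add: X_sup_def)
      then show "X s \<omega> \<in> cball 0 (X_sup \<omega>)" by simp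
    qed simp
    then show ?case by auto
  qed
  moreover have "0 \<le> X_sup \<omega>" for \<omega> by (simp add: X_sup_def)
  ultimately show thesis by (intro that[of X_sup]) auto
qed

text \<open>
  A fixed choice of such a bound.
\<close>

definition X_sup :: "'a \<Rightarrow> real" where
  "X_sup = (SOME X_sup. X_sup \<in> borel_measurable M \<and> (\<forall>\<omega>. 0 \<le> X_sup \<omega>) \<and> integrable M (\<lambda>\<omega>. (X_sup \<omega>)\<^sup>2) \<and>
    (AE \<omega> in M. \<forall>t\<in>{0..T}. norm (X t \<omega>) \<le> X_sup \<omega>))"

lemma X_sup_measurable [measurable]: "X_sup \<in> borel_measurable M" and X_sup_nonneg: "0 \<le> X_sup \<omega>"
  and X_sup_square_integrable: "integrable M (\<lambda>\<omega>. (X_sup \<omega>)\<^sup>2)" and X_le_X_sup: "AE \<omega> in M. \<forall>t\<in>{0..T}. norm (X t \<omega>) \<le> X_sup \<omega>"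
proof -
  have "\<exists>X_sup. X_sup \<in> borel_measurable M \<and> (\<forall>\<omega>. 0 \<le> X_sup \<omega>) \<and> integrable M (\<lambda>\<omega>. (X_sup \<omega>)\<^sup>2) \<and>
    (AE \<omega> in M. \<forall>t\<in>{0..T}. norm (X t \<omega>) \<le> X_sup \<omega>)"
    by (rule dominator_exists) blast
  from someI_ex[OF this] have "X_sup \<in> borel_measurable M \<and> (\<forall>\<omega>. 0 \<le> X_sup \<omega>) \<and> integrable M (\<lambda>\<omega>. (X_sup \<omega>)\<^sup>2) \<and>
    (AE \<omega> in M. \<forall>t\<in>{0..T}. norm (X t \<omega>) \<le> X_sup \<omega>)" unfolding X_sup_def .
  then show "X_sup \<in> borel_measurable M" "0 \<le> X_sup \<omega>" "integrable M (\<lambda>\<omega>. (X_sup \<omega>)\<^sup>2)" "AE \<omega> in M. \<forall>t\<in>{0..T}. norm (X t \<omega>) \<le> X_sup \<omega>"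
    by auto
qed

lemma X_sup_integrable: "integrable M X_sup"
proof (rule Bochner_Integration.integrable_bound)
  show "integrable M (\<lambda>\<omega>. 1 + (X_sup \<omega>)\<^sup>2)" using X_sup_square_integrable by simp
  have "X_sup \<omega> \<le> 1 + (X_sup \<omega>)\<^sup>2" for \<omega>
  proof -
    have "0 \<le> (X_sup \<omega> - 1)\<^sup>2" "0 \<le> X_sup \<omega>" using X_sup_nonneg by auto
    then show ?thesis unfolding power2_diff by simp
  qed
  then show "AE \<omega> in M. norm (X_sup \<omega>) \<le> norm (1 + (X_sup \<omega>)\<^sup>2)" using X_sup_nonneg by simp
qed measurable

definition weight :: "'h \<Rightarrow> real" where "weight x = exp (- \<alpha> * \<E> x)"

text \<open>
  The weights are bounded because \<open>x\<^sup>*\<close> is a global minimizer. So the consensus point of every \<open>X t\<close> is a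
  quotient of convergent integrals with positive denominator.
\<close>

lemma weight_bounds: "0 < weight x" "weight x \<le> exp (- \<alpha> * \<E> xstar)"
  using E_min[of x] pos by (auto simp: weight_def)

lemma norm_weight_le: "norm (weight x) \<le> exp (- \<alpha> * \<E> xstar)"
  using weight_bounds[of x] by simp

lemma weight_continuous: "continuous_on UNIV weight"
  unfolding weight_def by (intro continuous_intros E_cont)

lemma weight_measurable [measurable]: "weight \<in> borel_measurable borel"
  using weight_continuous by (rule borel_measurable_continuous_onI)

lemma weight_integrable:
  assumes t: "t \<in> {0..T}"
  shows "integrable M (\<lambda>\<omega>. weight (X t \<omega>))" "integrable M (\<lambda>\<omega>. weight (X t \<omega>) *\<^sub>R X t \<omega>)" "0 < (\<integral>\<omega>. weight (X t \<omega>) \<partial>M)"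
proof -
  have [measurable]: "X t \<in> M \<rightarrow>\<^sub>M borel" by (rule X_measurable[OF t])
  show i: "integrable M (\<lambda>\<omega>. weight (X t \<omega>))"
    by (rule integrable_const_bound[OF AE_I2[OF norm_weight_le]]) measurable
  show "integrable M (\<lambda>\<omega>. weight (X t \<omega>) *\<^sub>R X t \<omega>)"
  proof (rule Bochner_Integration.integrable_bound)
    show "integrable M (\<lambda>\<omega>. exp (- \<alpha> * \<E> xstar) * X_sup \<omega>)" using X_sup_integrable by simp
    show "AE \<omega> in M. norm (weight (X t \<omega>) *\<^sub>R X t \<omega>) \<le> norm (exp (- \<alpha> * \<E> xstar) * X_sup \<omega>)"
      using X_le_X_sup
    proof eventually_elim
      case (elim \<omega>)
      then have "norm (X t \<omega>) \<le> X_sup \<omega>" using t by blast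
      then have "weight (X t \<omega>) * norm (X t \<omega>) \<le> exp (- \<alpha> * \<E> xstar) * X_sup \<omega>"
        using weight_bounds by (intro mult_mono) auto
      then show ?case using weight_bounds(1)[of "X t \<omega>"] X_sup_nonneg by (simp add: abs_of_pos)
    qed
  qed measurable
  have "0 \<noteq> (\<integral>\<omega>. weight (X t \<omega>) \<partial>M)"
  proof
    assume "0 = (\<integral>\<omega>. weight (X t \<omega>) \<partial>M)"
    then have "AE \<omega> in M. weight (X t \<omega>) = 0"
      using integral_nonneg_eq_0_iff_AE[OF i] weight_bounds(1) by (simp add: less_imp_le)
    then have "AE \<omega> in M. False" by eventually_elim (use weight_bounds(1) in \<open>metis less_irrefl\<close>)
    then show False by simp
  qed
  moreover have "0 \<le> (\<integral>\<omega>. weight (X t \<omega>) \<partial>M)" using weight_bounds(1) by (intro integral_nonneg_AE) (auto simp: less_imp_le)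
  ultimately show "0 < (\<integral>\<omega>. weight (X t \<omega>) \<partial>M)" by simp
qed

lemma m_eq:
  assumes t: "t \<in> {0..T}"
  shows "m t = (\<integral>\<omega>. weight (X t \<omega>) *\<^sub>R X t \<omega> \<partial>M) /\<^sub>R (\<integral>\<omega>. weight (X t \<omega>) \<partial>M)"
proof -
  have [measurable]: "X t \<in> M \<rightarrow>\<^sub>M borel" by (rule X_measurable[OF t])
  show ?thesis unfolding m_def consensus_point_def weight_def[symmetric]
    by (subst (1 2) integral_distr) measurable
qed

text \<open>
  By dominated convergence, as the paths are continuous and dominated by \<open>X_sup\<close>. Therefore drift and
  noise amplitude have continuous paths too, which justifies freezing them.
\<close>

lemma m_continuous: "continuous_on {0..T} m"
  unfolding continuous_on_sequentially
proof (intro ballI allI impI, elim conjE)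
  fix t and s :: "nat \<Rightarrow> real"
  assume t: "t \<in> {0..T}" and s: "\<forall>n. s n \<in> {0..T}" "s \<longlonglongrightarrow> t"
  have [measurable]: "X t \<in> M \<rightarrow>\<^sub>M borel" "\<And>n. X (s n) \<in> M \<rightarrow>\<^sub>M borel" using X_measurable t s by auto
  let ?C = "exp (- \<alpha> * \<E> xstar)"
  have lim: "AE \<omega> in M. (\<lambda>n. X (s n) \<omega>) \<longlonglongrightarrow> X t \<omega>"
    using X_cont
  proof eventually_elim
    case (elim \<omega>)
    then show ?case using s t unfolding continuous_on_sequentially by (auto simp: o_def)
  qed
  have wlim: "AE \<omega> in M. (\<lambda>n. weight (X (s n) \<omega>)) \<longlonglongrightarrow> weight (X t \<omega>)"
    using lim
  proof eventually_elim
    case (elim \<omega>)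
    then show ?case
      using weight_continuous continuous_on_tendsto_compose[of UNIV weight "\<lambda>n. X (s n) \<omega>" "X t \<omega>" sequentially] by simp
  qed
  have "(\<lambda>n. \<integral>\<omega>. weight (X (s n) \<omega>) \<partial>M) \<longlonglongrightarrow> (\<integral>\<omega>. weight (X t \<omega>) \<partial>M)"
    by (rule integral_dominated_convergence[where w = "\<lambda>_. ?C", OF _ _ _ wlim AE_I2[OF norm_weight_le]]) auto
  moreover have "(\<lambda>n. \<integral>\<omega>. weight (X (s n) \<omega>) *\<^sub>R X (s n) \<omega> \<partial>M) \<longlonglongrightarrow> (\<integral>\<omega>. weight (X t \<omega>) *\<^sub>R X t \<omega> \<partial>M)"
  proof (rule integral_dominated_convergence[where w = "\<lambda>\<omega>. ?C * X_sup \<omega>"])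
    show "integrable M (\<lambda>\<omega>. ?C * X_sup \<omega>)" using X_sup_integrable by simp
    show "AE \<omega> in M. (\<lambda>n. weight (X (s n) \<omega>) *\<^sub>R X (s n) \<omega>) \<longlonglongrightarrow> weight (X t \<omega>) *\<^sub>R X t \<omega>"
      using lim wlim by eventually_elim (intro tendsto_intros)
    fix n
    show "AE \<omega> in M. norm (weight (X (s n) \<omega>) *\<^sub>R X (s n) \<omega>) \<le> ?C * X_sup \<omega>"
      using X_le_X_sup
    proof eventually_elim
      case (elim \<omega>)
      then have "norm (X (s n) \<omega>) \<le> X_sup \<omega>" using s by blast
      then have "weight (X (s n) \<omega>) * norm (X (s n) \<omega>) \<le> ?C * X_sup \<omega>"
        using weight_bounds by (intro mult_mono) auto
      then show ?case using weight_bounds(1)[of "X (s n) \<omega>"] by simp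
    qed
  qed measurable
  ultimately have "(\<lambda>n. (\<integral>\<omega>. weight (X (s n) \<omega>) *\<^sub>R X (s n) \<omega> \<partial>M) /\<^sub>R (\<integral>\<omega>. weight (X (s n) \<omega>) \<partial>M))
    \<longlonglongrightarrow> (\<integral>\<omega>. weight (X t \<omega>) *\<^sub>R X t \<omega> \<partial>M) /\<^sub>R (\<integral>\<omega>. weight (X t \<omega>) \<partial>M)"
    using weight_integrable(3)[OF t] by (intro tendsto_intros) auto
  then show "(m \<circ> s) \<longlonglongrightarrow> m t" using m_eq s t by (simp add: o_def)
qed

definition m_sup :: real where "m_sup = norm xstar + B"

lemma norm_m: "t \<in> {0..T} \<Longrightarrow> norm (m t) \<le> m_sup"
  using m_bound[of t] norm_triangle_ineq2[of "m t" xstar] by (simp add: m_sup_def m_def norm_minus_commute)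

definition amp :: "real \<Rightarrow> 'a \<Rightarrow> real" where "amp t \<omega> = \<sigma> * norm (X t \<omega> - m t)"

definition drift :: "real \<Rightarrow> 'a \<Rightarrow> 'h" where "drift t \<omega> = - lam *\<^sub>R (X t \<omega> - m t)"

lemma amp_measurable_F: "t \<in> {0..T} \<Longrightarrow> amp t \<in> borel_measurable (F t)"
  unfolding amp_def[abs_def] using X_measurable_F[of t] by measurable

lemma amp_drift_bounds: "AE \<omega> in M. \<forall>t\<in>{0..T}. 0 \<le> amp t \<omega> \<and> amp t \<omega> \<le> \<sigma> * (X_sup \<omega> + m_sup) \<and> norm (drift t \<omega>) \<le> lam * (X_sup \<omega> + m_sup)"
  using X_le_X_sup
proof eventually_elim
  case (elim \<omega>)
  show ?case
  proof
    fix t assume t: "t \<in> {0..T}"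
    have "norm (X t \<omega> - m t) \<le> X_sup \<omega> + m_sup"
      using norm_triangle_ineq4[of "X t \<omega>" "m t"] elim t norm_m[OF t] by fastforce
    then show "0 \<le> amp t \<omega> \<and> amp t \<omega> \<le> \<sigma> * (X_sup \<omega> + m_sup) \<and> norm (drift t \<omega>) \<le> lam * (X_sup \<omega> + m_sup)"
      using pos by (simp add: amp_def drift_def)
  qed
qed

lemma X_sup_m_sup_integrable: "integrable M (\<lambda>\<omega>. (X_sup \<omega> + m_sup)\<^sup>2)"
  unfolding power2_sum using X_sup_square_integrable X_sup_integrable by simp

lemma amp_square_integrable:
  assumes t: "t \<in> {0..T}"
  shows "integrable M (\<lambda>\<omega>. (amp t \<omega>)\<^sup>2)"
proof (rule Bochner_Integration.integrable_bound)
  show "integrable M (\<lambda>\<omega>. \<sigma>\<^sup>2 * (X_sup \<omega> + m_sup)\<^sup>2)" using X_sup_m_sup_integrable by simp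
  have [measurable]: "amp t \<in> borel_measurable M" using measurable_F[OF _ amp_measurable_F[OF t]] t by simp
  show "(\<lambda>\<omega>. (amp t \<omega>)\<^sup>2) \<in> borel_measurable M" by measurable
  show "AE \<omega> in M. norm ((amp t \<omega>)\<^sup>2) \<le> norm (\<sigma>\<^sup>2 * (X_sup \<omega> + m_sup)\<^sup>2)"
    using amp_drift_bounds
  proof eventually_elim
    case (elim \<omega>)
    then have "(amp t \<omega>)\<^sup>2 \<le> (\<sigma> * (X_sup \<omega> + m_sup))\<^sup>2" using t by (intro power_mono) auto
    then show ?case by (simp add: power_mult_distrib)
  qed
qed

lemma m_indicator_measurable [measurable]: "(\<lambda>u. indicat_real {0..T} u *\<^sub>R m u) \<in> borel_measurable borel"
  by (rule borel_measurable_continuous_on_indicator[OF _ m_continuous]) simp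

text \<open>
  \<open>amp\<close> on \<open>[0, T]\<close>, and \<open>0\<close> elsewhere, so that it is jointly measurable on the whole line.
\<close>

definition amp0 :: "real \<Rightarrow> 'a \<Rightarrow> real" where
  "amp0 u \<omega> = \<sigma> * norm (indicat_real {0..T} u *\<^sub>R X u \<omega> - indicat_real {0..T} u *\<^sub>R m u)"

lemma amp0_joint [measurable]: "(\<lambda>(\<omega>, u). amp0 u \<omega>) \<in> borel_measurable (M \<Otimes>\<^sub>M lborel)"
proof -
  have [measurable]: "(\<lambda>z. indicat_real {0..T} (snd z) *\<^sub>R X (snd z) (fst z)) \<in> M \<Otimes>\<^sub>M lborel \<rightarrow>\<^sub>M borel"
    using X_joint by (simp add: split_beta')
  have [measurable]: "(\<lambda>z. indicat_real {0..T} (snd z) *\<^sub>R m (snd z)) \<in> M \<Otimes>\<^sub>M lborel \<rightarrow>\<^sub>M borel"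
    by (rule measurable_compose[OF measurable_snd, where g = "\<lambda>u. indicat_real {0..T} u *\<^sub>R m u"]) simp
  show ?thesis unfolding amp0_def split_beta' by measurable
qed

lemma amp0_eq: "u \<in> {0..T} \<Longrightarrow> amp0 u \<omega> = amp u \<omega>"
  by (simp add: amp0_def amp_def)

text \<open>
  The integrand applied to \<open>v\<close> is \<open>amp u\<close> times \<open>P v\<close>, as the diffusion operator is a multiple of the
  self-adjoint projection. So the error of freezing is governed by the oscillation of the scalar \<open>amp\<close>.
\<close>

theorem noise_freezing_error:
  assumes st: "0 \<le> s" "s \<le> t" "t \<le> T" and v: "norm v \<le> 1"
  shows "(\<integral>\<^sup>+\<omega>. ennreal (((I t \<omega> - I s \<omega>) \<bullet> v - amp s \<omega> * (incr s t \<omega> \<bullet> P v))\<^sup>2) \<partial>M)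
    \<le> 4 * (\<integral>\<^sup>+\<omega>. (\<integral>\<^sup>+u. indicator {s<..t} u * ennreal ((amp0 u \<omega> - amp s \<omega>)\<^sup>2 * (Q (P v) \<bullet> P v)) \<partial>lborel) \<partial>M)"
proof -
  have s: "s \<in> {0..T}" using st by simp
  have [measurable]: "amp s \<in> borel_measurable (F s)" by (rule amp_measurable_F[OF s])
  have "(\<integral>\<^sup>+\<omega>. ennreal (((I t \<omega> - I s \<omega>) \<bullet> v - incr s t \<omega> \<bullet> (amp s \<omega> *\<^sub>R P v))\<^sup>2) \<partial>M)
    \<le> 4 * (\<integral>\<^sup>+\<omega>. (\<integral>\<^sup>+u. indicator {s<..t} u *
      ennreal (Q (amp0 u \<omega> *\<^sub>R P v - amp s \<omega> *\<^sub>R P v) \<bullet> (amp0 u \<omega> *\<^sub>R P v - amp s \<omega> *\<^sub>R P v)) \<partial>lborel) \<partial>M)"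
  proof (rule ito_integral_increment_error[OF inf ito st v])
    show "(\<lambda>\<omega>. amp s \<omega> *\<^sub>R P v) \<in> F s \<rightarrow>\<^sub>M borel" by measurable
    have "integrable M (\<lambda>\<omega>. (amp s \<omega>)\<^sup>2 * (Q (P v) \<bullet> P v))" using amp_square_integrable[OF s] by simp
    then show "integrable M (\<lambda>\<omega>. Q (amp s \<omega> *\<^sub>R P v) \<bullet> (amp s \<omega> *\<^sub>R P v))"
      by (simp add: blinfun.scaleR_right power2_eq_square mult.assoc)
    show "(\<lambda>(\<omega>, u). amp0 u \<omega> *\<^sub>R P v) \<in> M \<Otimes>\<^sub>M lborel \<rightarrow>\<^sub>M borel"
      using amp0_joint by (simp add: split_beta')
    fix u \<omega> assume u: "u \<in> {0..T}"
    show "adjoint (blinfun_apply (\<sigma> *\<^sub>R diffusion_op V (X u \<omega> - consensus_point \<E> \<alpha> (distr M borel (X u))))) v = amp0 u \<omega> *\<^sub>R P v"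
      by (rule adjoint_blinfun_eqI)
        (simp add: amp0_eq[OF u] amp_def m_def diffusion_op_def blinfun.scaleR_left P_def[symmetric] P_sym)
  qed
  moreover have "Q (a *\<^sub>R P v - b *\<^sub>R P v) \<bullet> (a *\<^sub>R P v - b *\<^sub>R P v) = (a - b)\<^sup>2 * (Q (P v) \<bullet> P v)" for a b
    by (simp add: scaleR_diff_left[symmetric] blinfun.scaleR_right power2_eq_square mult.assoc)
  ultimately show ?thesis by simp
qed

section \<open>The process stays in the active subspace\<close>

lemma I_measurable: "t \<in> {0..T} \<Longrightarrow> I t \<in> M \<rightarrow>\<^sub>M borel"
  using ito unfolding ito_integral_def by (auto intro: measurable_F)

lemma I_continuous: "AE \<omega> in M. continuous_on {0..T} (\<lambda>t. I t \<omega>)"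
  using ito unfolding ito_integral_def by blast

text \<open>
  All elementary integrals vanish at time \<open>0\<close>.
\<close>

lemma I_zero: "AE \<omega> in M. I 0 \<omega> = 0"
proof -
  have [measurable]: "I 0 \<in> M \<rightarrow>\<^sub>M borel" using pos by (intro I_measurable) auto
  obtain N \<tau> G where e: "\<And>i. elementary F T (N i) (\<tau> i) (G i)"
    and J: "\<And>t. t \<in> {0..T} \<Longrightarrow> (\<lambda>i. \<integral>\<^sup>+\<omega>. ennreal ((norm (I t \<omega> - elem_integral W (N i) (\<tau> i) (G i) t \<omega>))\<^sup>2) \<partial>M) \<longlonglongrightarrow> 0"
    using ito unfolding ito_integral_def by blast
  have "elem_integral W (N i) (\<tau> i) (G i) 0 \<omega> = 0" for i \<omega>
    unfolding elem_integral_def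
  proof (intro sum.neutral ballI)
    fix j assume "j \<in> {..<N i}"
    then have "0 \<le> \<tau> i j" "0 \<le> \<tau> i (Suc j)"
      using elementary_times(3)[OF e[of i], of 0 j] elementary_times(3)[OF e[of i], of 0 "Suc j"] elementary_times(1)[OF e[of i]] by auto
    then show "blinfun_apply (G i j \<omega>) (W (min 0 (\<tau> i (Suc j))) \<omega> - W (min 0 (\<tau> i j)) \<omega>) = 0"
      by (simp add: blinfun.zero_right)
  qed
  then have "(\<lambda>i::nat. \<integral>\<^sup>+\<omega>. ennreal ((norm (I 0 \<omega>))\<^sup>2) \<partial>M) \<longlonglongrightarrow> 0" using J[of 0] pos by simp
  then have "(\<integral>\<^sup>+\<omega>. ennreal ((norm (I 0 \<omega>))\<^sup>2) \<partial>M) = 0" by (simp add: LIMSEQ_const_iff)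
  then show ?thesis by (subst (asm) nn_integral_0_iff_AE) auto
qed

text \<open>
  If \<open>P v = 0\<close>, the estimate above says that \<open>I t \<bullet> v\<close> vanishes almost surely. Applied to \<open>v = x - P x\<close> for
  \<open>x\<close> in a countable dense set, this gives \<open>I t = P (I t)\<close>.
\<close>

lemma I_in_V: "AE \<omega> in M. \<forall>t\<in>{0..T}. I t \<omega> \<in> V"
proof -
  obtain S :: "'h set" where S: "countable S" "\<And>U. open U \<Longrightarrow> U \<noteq> {} \<Longrightarrow> \<exists>d\<in>S. d \<in> U"
    using countable_dense_exists by blast
  have orth: "AE \<omega> in M. I t \<omega> \<bullet> (x - P x) = 0" if t: "t \<in> {0..T}" for t x
  proof -
    have [measurable]: "I t \<in> M \<rightarrow>\<^sub>M borel" "I 0 \<in> M \<rightarrow>\<^sub>M borel" using I_measurable t by auto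
    \<comment> \<open>the estimate is for vectors in the unit ball; adding \<open>1\<close> avoids a case distinction\<close>
    define v where "v = (x - P x) /\<^sub>R (norm (x - P x) + 1)"
    have n: "0 < norm (x - P x) + 1" by (simp add: add_nonneg_pos)
    have v: "norm v \<le> 1" using n by (simp add: v_def divide_simps)
    have Pv: "P v = 0" by (simp add: v_def blinfun.scaleR_right blinfun.diff_right P_idem)
    have "(\<integral>\<^sup>+\<omega>. ennreal (((I t \<omega> - I 0 \<omega>) \<bullet> v)\<^sup>2) \<partial>M) \<le> 0"
      using noise_freezing_error[of 0 t v] t v by (simp add: Pv blinfun.zero_right)
    then have "AE \<omega> in M. ennreal (((I t \<omega> - I 0 \<omega>) \<bullet> v)\<^sup>2) = 0"
      by (subst (asm) le_zero_eq, subst (asm) nn_integral_0_iff_AE) auto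
    then show ?thesis using I_zero
    proof eventually_elim
      case (elim \<omega>)
      then show ?case using n by (simp add: v_def)
    qed
  qed
  have "AE \<omega> in M. I t \<omega> \<in> V" if t: "t \<in> {0..T}" for t
  proof -
    have "AE \<omega> in M. \<forall>x\<in>S. I t \<omega> \<bullet> (x - P x) = 0"
      using S(1) orth[OF t] by (simp add: AE_ball_countable)
    then show ?thesis
    proof eventually_elim
      case (elim \<omega>)
      let ?y = "I t \<omega> - P (I t \<omega>)"
      have "closed {x. x \<bullet> ?y = 0}" by (intro closed_Collect_eq continuous_intros)
      moreover have "S \<subseteq> {x. x \<bullet> ?y = 0}"
      proof
        fix x assume "x \<in> S"
        then have "I t \<omega> \<bullet> (x - P x) = 0" using elim by blast
        moreover have "x \<bullet> P (I t \<omega>) = P x \<bullet> I t \<omega>" by (rule P_sym[symmetric])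
        ultimately show "x \<in> {x. x \<bullet> ?y = 0}"
          by (simp add: inner_diff_right inner_commute[of "I t \<omega>"])
      qed
      ultimately have "closure S \<subseteq> {x. x \<bullet> ?y = 0}" by (intro closure_minimal)
      moreover have "closure S = UNIV"
      proof (rule ccontr)
        assume "closure S \<noteq> UNIV"
        then have "- closure S \<noteq> {}" by auto
        then obtain d where "d \<in> S" "d \<in> - closure S" using S(2)[of "- closure S"] by auto
        then show False using closure_subset by blast
      qed
      ultimately have "?y \<bullet> ?y = 0" by blast
      then show ?case by (simp add: V_iff)
    qed
  qed
  then have "AE \<omega> in M. \<forall>t\<in>\<rat> \<inter> {0..T}. I t \<omega> \<in> V"
    using countable_rat by (subst AE_ball_countable) (auto intro: countable_subset)
  then show ?thesis using I_continuous
  proof eventually_elim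
    case (elim \<omega>)
    show ?case
    proof
      fix t assume t: "t \<in> {0..T}"
      show "I t \<omega> \<in> V"
        using elim by (intro continuous_in_closed_from_rationals[OF pos(4) elim(2) closed_V _ t]) auto
    qed
  qed
qed

text \<open>
  Projecting the equation onto the orthogonal complement of \<open>V\<close> removes the noise and the initial
  value.
\<close>

lemma off_V_component_equation:
  assumes c: "continuous_on {0..T} x" and I: "\<And>t. t \<in> {0..T} \<Longrightarrow> i t \<in> V" and z: "z \<in> V"
    and eq: "\<And>t. t \<in> {0..T} \<Longrightarrow> x t = z + (LINT s:{0..t}|lborel. - lam *\<^sub>R (x s - m s)) + i t" and t: "t \<in> {0..T}"
  shows "x t - P (x t) = (LINT s:{0..t}|lborel. - lam *\<^sub>R ((x s - P (x s)) - (m s - P (m s))))"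
proof -
  have "continuous_on {0..t} (\<lambda>s. - lam *\<^sub>R (x s - m s))"
    using c m_continuous t by (intro continuous_intros) (auto intro: continuous_on_subset)
  then have i: "set_integrable lborel {0..t} (\<lambda>s. - lam *\<^sub>R (x s - m s))"
    by (rule borel_integrable_atLeastAtMost')
  have Pc: "bounded_linear (\<lambda>y. y - P y)"
    by (intro bounded_linear_sub bounded_linear_ident blinfun.bounded_linear_right)
  have "x t - P (x t) = (LINT s:{0..t}|lborel. - lam *\<^sub>R (x s - m s)) - P (LINT s:{0..t}|lborel. - lam *\<^sub>R (x s - m s))"
    by (subst (1 2) eq[OF t]) (simp add: blinfun.add_right P_V[OF z] P_V[OF I[OF t]])
  also have "\<dots> = (LINT s:{0..t}|lborel. (- lam *\<^sub>R (x s - m s)) - P (- lam *\<^sub>R (x s - m s)))"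
  proof -
    define g where "g s = - lam *\<^sub>R (x s - m s)" for s
    have "integrable lborel (\<lambda>s. indicat_real {0..t} s *\<^sub>R g s)"
      using i unfolding set_integrable_def g_def .
    from integral_bounded_linear[OF Pc this]
    have "(LINT s:{0..t}|lborel. g s) - P (LINT s:{0..t}|lborel. g s) = (LINT s:{0..t}|lborel. g s - P (g s))"
      by (simp add: set_lebesgue_integral_def blinfun.scaleR_right scaleR_diff_right)
    then show ?thesis unfolding g_def .
  qed
  also have "\<dots> = (LINT s:{0..t}|lborel. - lam *\<^sub>R ((x s - P (x s)) - (m s - P (m s))))"
    by (simp add: blinfun.scaleR_right blinfun.diff_right blinfun.minus_right algebra_simps)
  finally show ?thesis .
qed

text \<open>
  The difference of two solutions satisfies \<open>d t = - lam * (\<integral> d)\<close>, in which the inhomogeneity \<open>k\<close> has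
  cancelled.
\<close>

lemma off_V_component_unique:
  assumes x: "continuous_on {0..T} x" and y: "continuous_on {0..T} y"
    and xe: "\<And>t. t \<in> {0..T} \<Longrightarrow> x t = (LINT s:{0..t}|lborel. - lam *\<^sub>R (x s - k s))"
    and ye: "\<And>t. t \<in> {0..T} \<Longrightarrow> y t = (LINT s:{0..t}|lborel. - lam *\<^sub>R (y s - k s))"
    and k: "continuous_on {0..T} k" and t: "t \<in> {0..T}"
  shows "x t = (y t :: 'h)"
proof -
  have "norm (x t - y t) \<le> 0"
  proof (rule gronwall_zero[of T "\<lambda>t. norm (x t - y t)" lam])
    show "continuous_on {0..T} (\<lambda>t. norm (x t - y t))" by (intro continuous_intros x y)
    fix t assume t: "t \<in> {0..T}"
    have sub: "continuous_on {0..t} x" "continuous_on {0..t} y" "continuous_on {0..t} k"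
      using x y k t by (auto intro: continuous_on_subset)
    have ix: "set_integrable lborel {0..t} (\<lambda>s. - lam *\<^sub>R (x s - k s))"
      and iy: "set_integrable lborel {0..t} (\<lambda>s. - lam *\<^sub>R (y s - k s))"
      and ixy: "set_integrable lborel {0..t} (\<lambda>s. - lam *\<^sub>R (x s - y s))"
      and in_: "set_integrable lborel {0..t} (\<lambda>s. lam * norm (x s - y s))"
      and in1: "set_integrable lborel {0..t} (\<lambda>s. norm (x s - y s))"
      by (intro borel_integrable_atLeastAtMost' continuous_intros sub)+
    have "x t - y t = (LINT s:{0..t}|lborel. - lam *\<^sub>R (x s - k s) - - lam *\<^sub>R (y s - k s))"
      by (subst xe[OF t], subst ye[OF t], subst set_integral_diff(2)[OF ix iy]) simp
    also have "\<dots> = (LINT s:{0..t}|lborel. - lam *\<^sub>R (x s - y s))"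
      by (simp add: algebra_simps)
    finally have "norm (x t - y t) \<le> (LINT s:{0..t}|lborel. norm (- lam *\<^sub>R (x s - y s)))"
      using set_integral_norm_bound[OF ixy] by simp
    also have "\<dots> = lam * (LINT s:{0..t}|lborel. norm (x s - y s))"
      using pos by simp
    also have "\<dots> = lam * integral {0..t} (\<lambda>s. norm (x s - y s))"
      using in1 by (simp add: set_borel_integral_eq_integral)
    finally show "norm (x t - y t) \<le> lam * integral {0..t} (\<lambda>s. norm (x s - y s))" .
  qed (use pos t in auto)
  then show ?thesis by simp
qed

text \<open>
  By uniqueness, the component \<open>R\<close> of \<open>X\<close> orthogonal to \<open>V\<close> is the same for almost all sample points. The
  corresponding component \<open>k\<close> of the consensus point is a weighted mean of it, hence equal to it. So
  \<open>R - k\<close>, and with it the right-hand side of the equation for \<open>R\<close>, vanishes.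
\<close>

theorem X_in_V: "AE \<omega> in M. \<forall>t\<in>{0..T}. X t \<omega> \<in> V"
proof -
  define R where "R t \<omega> = X t \<omega> - P (X t \<omega>)" for t \<omega>
  define k where "k t = m t - P (m t)" for t
  have Pcont: "continuous_on {0..T} (\<lambda>t. y t - P (y t))" if "continuous_on {0..T} y" for y
    using that by (intro continuous_intros)
  have kc: "continuous_on {0..T} k" unfolding k_def by (rule Pcont[OF m_continuous])
  have good: "AE \<omega> in M. continuous_on {0..T} (\<lambda>t. R t \<omega>) \<and>
    (\<forall>t\<in>{0..T}. R t \<omega> = (LINT s:{0..t}|lborel. - lam *\<^sub>R (R s \<omega> - k s)))"
    using X_cont I_in_V xi_V X_eq
  proof eventually_elim
    case (elim \<omega>)
    then have "continuous_on {0..T} (\<lambda>t. R t \<omega>)" unfolding R_def by (intro Pcont)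
    moreover have "R t \<omega> = (LINT s:{0..t}|lborel. - lam *\<^sub>R (R s \<omega> - k s))" if "t \<in> {0..T}" for t
      unfolding R_def k_def using elim that unfolding m_def[symmetric]
      by (intro off_V_component_equation[where i = "\<lambda>t. I t \<omega>" and z = "\<xi> \<omega>"]) auto
    ultimately show ?case by blast
  qed
  then obtain \<omega>0 where w0: "continuous_on {0..T} (\<lambda>t. R t \<omega>0)"
    "\<And>t. t \<in> {0..T} \<Longrightarrow> R t \<omega>0 = (LINT s:{0..t}|lborel. - lam *\<^sub>R (R s \<omega>0 - k s))"
    using eventually_happens'[OF _ good] by (auto simp: trivial_limit_def)
  have same: "AE \<omega> in M. \<forall>t\<in>{0..T}. R t \<omega> = R t \<omega>0"
    using good
  proof eventually_elim
    case (elim \<omega>)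
    then show ?case using w0 kc
      by (intro ballI off_V_component_unique[of "\<lambda>t. R t \<omega>" "\<lambda>t. R t \<omega>0" k]) auto
  qed
  have k_eq: "k t = R t \<omega>0" if t: "t \<in> {0..T}" for t
  proof -
    have [measurable]: "X t \<in> M \<rightarrow>\<^sub>M borel" by (rule X_measurable[OF t])
    let ?w = "\<integral>\<omega>. weight (X t \<omega>) \<partial>M"
    have Pc: "bounded_linear (\<lambda>y. y - P y)"
      by (intro bounded_linear_sub bounded_linear_ident blinfun.bounded_linear_right)
    have "k t = ((\<integral>\<omega>. weight (X t \<omega>) *\<^sub>R X t \<omega> \<partial>M) - P (\<integral>\<omega>. weight (X t \<omega>) *\<^sub>R X t \<omega> \<partial>M)) /\<^sub>R ?w"
      unfolding k_def m_eq[OF t] by (simp add: blinfun.scaleR_right scaleR_diff_right)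
    also have "(\<integral>\<omega>. weight (X t \<omega>) *\<^sub>R X t \<omega> \<partial>M) - P (\<integral>\<omega>. weight (X t \<omega>) *\<^sub>R X t \<omega> \<partial>M)
      = (\<integral>\<omega>. weight (X t \<omega>) *\<^sub>R X t \<omega> - P (weight (X t \<omega>) *\<^sub>R X t \<omega>) \<partial>M)"
      by (rule integral_bounded_linear[OF Pc weight_integrable(2)[OF t], symmetric])
    also have "\<dots> = (\<integral>\<omega>. weight (X t \<omega>) *\<^sub>R R t \<omega>0 \<partial>M)"
    proof (rule integral_cong_AE)
      show "AE \<omega> in M. weight (X t \<omega>) *\<^sub>R X t \<omega> - P (weight (X t \<omega>) *\<^sub>R X t \<omega>) = weight (X t \<omega>) *\<^sub>R R t \<omega>0"
        using same
      proof eventually_elim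
        case (elim \<omega>)
        then have "R t \<omega>0 = X t \<omega> - P (X t \<omega>)" using t by (simp add: R_def)
        then show ?case by (simp add: blinfun.scaleR_right scaleR_diff_right)
      qed
    qed measurable
    also have "\<dots> = ?w *\<^sub>R R t \<omega>0" by (rule integral_scaleR_left) (rule weight_integrable(1)[OF t])
    finally show ?thesis using weight_integrable(3)[OF t] by simp
  qed
  have "R t \<omega>0 = 0" if t: "t \<in> {0..T}" for t
  proof -
    have "R t \<omega>0 = (LINT s:{0..t}|lborel. - lam *\<^sub>R (R s \<omega>0 - k s))" by (rule w0(2)[OF t])
    also have "\<dots> = (LINT s:{0..t}|lborel. 0)"
      using t by (intro set_lebesgue_integral_cong) (auto simp: k_eq)
    finally show ?thesis by simp
  qed
  then show ?thesis using same by (auto simp: R_def V_iff elim!: eventually_mono)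
qed

end

section \<open>The expected increment of the mollifier over a short step\<close>

lemma mult_fraction_le:
  fixes k \<epsilon> c :: real
  assumes "0 \<le> k" "0 \<le> \<epsilon>" "0 < c"
  shows "k * (\<epsilon> / (c * (k + 1))) \<le> \<epsilon> / c"
proof -
  have "k * (\<epsilon> / (c * (k + 1))) = (\<epsilon> / c) * (k / (k + 1))" by simp
  also have "\<dots> \<le> (\<epsilon> / c) * 1" using assms by (intro mult_left_mono) (auto simp: divide_le_eq_1)
  finally show ?thesis by simp
qed

lemma bump_measurable [measurable]: "0 < R \<Longrightarrow> bump R \<in> borel_measurable borel"
  using continuous_bump by (intro borel_measurable_continuous_onI continuous_at_imp_continuous_on) auto

lemma bump'_measurable [measurable]: "0 < R \<Longrightarrow> bump' R \<in> borel_measurable borel"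
proof -
  assume R: "0 < R"
  note [measurable] = bump_measurable[OF R]
  show ?thesis unfolding bump'_def[abs_def] by measurable
qed

lemma bump''_measurable [measurable]: "0 < R \<Longrightarrow> bump'' R \<in> borel_measurable borel"
proof -
  assume R: "0 < R"
  note [measurable] = bump_measurable[OF R]
  show ?thesis unfolding bump''_def[abs_def] by measurable
qed

lemma defect_ratio_measurable [measurable]:
  fixes y z :: "'a \<Rightarrow> 'h::{real_inner, second_countable_topology}"
  assumes "0 < r" and [measurable]: "y \<in> M \<rightarrow>\<^sub>M borel" "z \<in> M \<rightarrow>\<^sub>M borel"
  shows "(\<lambda>\<omega>. defect_ratio r (y \<omega>) (z \<omega>)) \<in> borel_measurable M"
proof -
  have "0 < r\<^sup>2" using assms by simp
  note [measurable] = bump_measurable[OF this] bump'_measurable[OF this] bump''_measurable[OF this]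
  show ?thesis unfolding defect_ratio_def defect_def by measurable
qed

context cbo_setting
begin

text \<open>
  The trace of \<open>P\<^sub>V Q P\<^sub>V\<close>.
\<close>

definition trace_V :: real where "trace_V = (\<Sum>v\<in>basis. Q v \<bullet> v)"

text \<open>
  Chosen such that \<open>h\<^sup>2\<close> times it bounds the fourth moment of a projected increment over time \<open>h\<close>.
\<close>

definition fourth_const :: real where "fourth_const = (\<Sum>v\<in>basis. 3 * (Q v \<bullet> v)\<^sup>2) * real (card basis)"

lemma trace_V_nonneg: "0 \<le> trace_V" and fourth_const_nonneg: "0 \<le> fourth_const"
  unfolding trace_V_def fourth_const_def using Q_nonneg by (auto intro!: sum_nonneg mult_nonneg_nonneg)

lemma P_incr_moments:
  assumes st: "0 \<le> s" "s \<le> t"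
  shows "integrable M (\<lambda>\<omega>. (norm (P (incr s t \<omega>)))\<^sup>2)" "(\<integral>\<omega>. (norm (P (incr s t \<omega>)))\<^sup>2 \<partial>M) = (t - s) * trace_V"
    "integrable M (\<lambda>\<omega>. (norm (P (incr s t \<omega>))) ^ 4)" "(\<integral>\<omega>. (norm (P (incr s t \<omega>))) ^ 4 \<partial>M) \<le> (t - s)\<^sup>2 * fourth_const"
proof -
  note mom = incr_moments[OF st]
  have [measurable]: "incr s t \<in> M \<rightarrow>\<^sub>M borel" by (rule measurable_incr'[OF st])
  show "integrable M (\<lambda>\<omega>. (norm (P (incr s t \<omega>)))\<^sup>2)" "(\<integral>\<omega>. (norm (P (incr s t \<omega>)))\<^sup>2 \<partial>M) = (t - s) * trace_V"
    unfolding norm_P_square using mom by (simp_all add: trace_V_def sum_distrib_left)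
  have le: "(norm (P x)) ^ 4 \<le> (\<Sum>v\<in>basis. (x \<bullet> v) ^ 4) * real (card basis)" for x
  proof -
    have "(norm (P x)) ^ 4 = (\<Sum>v\<in>basis. (x \<bullet> v)\<^sup>2)\<^sup>2" unfolding norm_P_square[symmetric] by simp
    also have "\<dots> \<le> (\<Sum>v\<in>basis. ((x \<bullet> v)\<^sup>2)\<^sup>2) * real (card basis)" by (rule sum_squared_le_sum_of_squares)
    finally show ?thesis by simp
  qed
  have i: "integrable M (\<lambda>\<omega>. (\<Sum>v\<in>basis. (incr s t \<omega> \<bullet> v) ^ 4) * real (card basis))" using mom by simp
  show i4: "integrable M (\<lambda>\<omega>. (norm (P (incr s t \<omega>))) ^ 4)"
    by (rule Bochner_Integration.integrable_bound[OF i]) (use le in \<open>auto intro!: AE_I2 order_trans[OF _ abs_ge_self]\<close>)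
  have "(\<integral>\<omega>. (norm (P (incr s t \<omega>))) ^ 4 \<partial>M) \<le> (\<integral>\<omega>. (\<Sum>v\<in>basis. (incr s t \<omega> \<bullet> v) ^ 4) * real (card basis) \<partial>M)"
    by (rule integral_mono[OF i4 i le])
  also have "\<dots> = (\<Sum>v\<in>basis. 3 * ((t - s) * (Q v \<bullet> v))\<^sup>2) * real (card basis)"
    using mom by (simp add: Bochner_Integration.integral_sum)
  also have "\<dots> = (t - s)\<^sup>2 * fourth_const"
    by (simp add: fourth_const_def power_mult_distrib sum_distrib_left mult.assoc mult.left_commute)
  finally show "(\<integral>\<omega>. (norm (P (incr s t \<omega>))) ^ 4 \<partial>M) \<le> (t - s)\<^sup>2 * fourth_const" .
qed

text \<open>
  A factor known at the start of the interval and a function of the increment are independent.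
\<close>

lemma integral_mult_incr_function:
  fixes \<phi> :: "'a \<Rightarrow> real" and \<psi> :: "'h \<Rightarrow> real"
  assumes st: "0 \<le> s" "s \<le> t" and [measurable]: "\<phi> \<in> borel_measurable (F s)" "\<psi> \<in> borel_measurable borel"
    and i: "integrable M \<phi>" "integrable M (\<lambda>\<omega>. \<psi> (incr s t \<omega>))"
  shows "integrable M (\<lambda>\<omega>. \<phi> \<omega> * \<psi> (incr s t \<omega>))"
    "(\<integral>\<omega>. \<phi> \<omega> * \<psi> (incr s t \<omega>) \<partial>M) = (\<integral>\<omega>. \<phi> \<omega> \<partial>M) * (\<integral>\<omega>. \<psi> (incr s t \<omega>) \<partial>M)"
proof -
  have [measurable]: "incr s t \<in> M \<rightarrow>\<^sub>M borel" "\<phi> \<in> borel_measurable M"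
    using measurable_incr'[OF st] i by auto
  show int: "integrable M (\<lambda>\<omega>. \<phi> \<omega> * \<psi> (incr s t \<omega>))"
  proof (rule integrableI_bounded)
    have "(\<integral>\<^sup>+\<omega>. ennreal (norm (\<phi> \<omega> * \<psi> (incr s t \<omega>))) \<partial>M) = (\<integral>\<^sup>+\<omega>. (\<integral>\<^sup>+\<omega>'. ennreal (norm (\<phi> \<omega> * \<psi> (incr s t \<omega>'))) \<partial>M) \<partial>M)"
      using nn_integral_freeze[OF st, of "\<lambda>(\<omega>, w). ennreal (norm (\<phi> \<omega> * \<psi> w))"] by simp
    also have "\<dots> = (\<integral>\<^sup>+\<omega>. ennreal (norm (\<phi> \<omega>)) * (\<integral>\<^sup>+\<omega>'. ennreal (norm (\<psi> (incr s t \<omega>'))) \<partial>M) \<partial>M)"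
      by (simp add: abs_mult ennreal_mult nn_integral_cmult)
    also have "\<dots> = (\<integral>\<^sup>+\<omega>. ennreal (norm (\<phi> \<omega>)) \<partial>M) * (\<integral>\<^sup>+\<omega>'. ennreal (norm (\<psi> (incr s t \<omega>'))) \<partial>M)"
      by (rule nn_integral_multc) measurable
    also have "\<dots> < \<infinity>" using i unfolding integrable_iff_bounded by (simp add: ennreal_mult_less_top)
    finally show "(\<integral>\<^sup>+\<omega>. ennreal (norm (\<phi> \<omega> * \<psi> (incr s t \<omega>))) \<partial>M) < \<infinity>" .
  qed measurable
  show "(\<integral>\<omega>. \<phi> \<omega> * \<psi> (incr s t \<omega>) \<partial>M) = (\<integral>\<omega>. \<phi> \<omega> \<partial>M) * (\<integral>\<omega>. \<psi> (incr s t \<omega>) \<partial>M)"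
    using integral_freeze[OF st, of "\<lambda>(\<omega>, w). \<phi> \<omega> * \<psi> w"] int by simp
qed

lemma continuous_amp: "AE \<omega> in M. continuous_on {0..T} (\<lambda>u. amp u \<omega>) \<and> continuous_on {0..T} (\<lambda>u. drift u \<omega>)"
  using X_cont
  by eventually_elim (auto simp: amp_def drift_def intro!: continuous_intros m_continuous)

lemma increment_without_noise:
  "AE \<omega> in M. \<forall>s t. 0 \<le> s \<longrightarrow> s \<le> t \<longrightarrow> t \<le> T \<longrightarrow>
    (X t \<omega> - X s \<omega>) - (I t \<omega> - I s \<omega>) = (LINT u:{s..t}|lborel. drift u \<omega>)"
  using X_eq continuous_amp
proof eventually_elim
  case (elim \<omega>)
  show ?case
  proof (intro allI impI)
    fix s t :: real assume st: "0 \<le> s" "s \<le> t" "t \<le> T"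
    have e: "X u \<omega> = \<xi> \<omega> + (LINT u:{0..u}|lborel. drift u \<omega>) + I u \<omega>" if "u \<in> {0..T}" for u
      using elim(1) that unfolding drift_def m_def by blast
    have "continuous_on {0..t} (\<lambda>u. drift u \<omega>)" using elim(2) st by (auto intro: continuous_on_subset)
    from set_integral_increment[OF st(1,2) this]
    show "(X t \<omega> - X s \<omega>) - (I t \<omega> - I s \<omega>) = (LINT u:{s..t}|lborel. drift u \<omega>)"
      using e[of s] e[of t] st by simp
  qed
qed

text \<open>
  One step from time \<open>s\<close> along a sequence of step lengths. The increment \<open>step\<close> of \<open>X\<close> is split in two
  ways: into \<open>drift_part\<close> and \<open>noise\<close>, for the first-order term, and into \<open>frozen\<close>, the noise with the
  amplitude at time \<open>s\<close>, and \<open>err\<close>, for the second-order term. The coefficients \<open>slope\<close> and \<open>bend\<close> are the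
  derivatives of the profile at the squared length of \<open>offset\<close>.
\<close>

context
  fixes r s :: real and h :: "nat \<Rightarrow> real"
  assumes r: "0 < r" and s: "0 \<le> s" "s < T"
    and h: "\<And>n. 0 < h n" "\<And>n. s + h n \<le> T" "h \<longlonglongrightarrow> 0"
begin

definition offset :: "'a \<Rightarrow> 'h" where "offset \<omega> = X s \<omega> - xstar"
definition step :: "nat \<Rightarrow> 'a \<Rightarrow> 'h" where "step n \<omega> = X (s + h n) \<omega> - X s \<omega>"
definition noise :: "nat \<Rightarrow> 'a \<Rightarrow> 'h" where "noise n \<omega> = I (s + h n) \<omega> - I s \<omega>"
definition drift_part :: "nat \<Rightarrow> 'a \<Rightarrow> 'h" where "drift_part n \<omega> = step n \<omega> - noise n \<omega>"
definition frozen :: "nat \<Rightarrow> 'a \<Rightarrow> 'h" where "frozen n \<omega> = amp s \<omega> *\<^sub>R P (incr s (s + h n) \<omega>)"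
definition err :: "nat \<Rightarrow> 'a \<Rightarrow> 'h" where "err n \<omega> = step n \<omega> - frozen n \<omega>"
definition slope :: "'a \<Rightarrow> real" where "slope \<omega> = bump' (r\<^sup>2) ((norm (offset \<omega>))\<^sup>2)"
definition bend :: "'a \<Rightarrow> real" where "bend \<omega> = bump'' (r\<^sup>2) ((norm (offset \<omega>))\<^sup>2)"

lemma times: "s \<in> {0..T}" "s + h n \<in> {0..T}" "s \<le> s + h n"
  using s h(1,2)[of n] by auto

lemma step_measurable [measurable]:
  "X s \<in> M \<rightarrow>\<^sub>M borel" "X (s + h n) \<in> M \<rightarrow>\<^sub>M borel"
  "offset \<in> M \<rightarrow>\<^sub>M borel" "step n \<in> M \<rightarrow>\<^sub>M borel" "noise n \<in> M \<rightarrow>\<^sub>M borel" "drift_part n \<in> M \<rightarrow>\<^sub>M borel" "frozen n \<in> M \<rightarrow>\<^sub>M borel"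
  "err n \<in> M \<rightarrow>\<^sub>M borel" "slope \<in> borel_measurable M" "bend \<in> borel_measurable M" "amp s \<in> borel_measurable M"
  "drift s \<in> M \<rightarrow>\<^sub>M borel" "incr s (s + h n) \<in> M \<rightarrow>\<^sub>M borel"
proof -
  have R: "0 < r\<^sup>2" using r by simp
  show [measurable]: "X s \<in> M \<rightarrow>\<^sub>M borel" "X (s + h n) \<in> M \<rightarrow>\<^sub>M borel" using X_measurable times by auto
  have [measurable]: "I s \<in> M \<rightarrow>\<^sub>M borel" "I (s + h n) \<in> M \<rightarrow>\<^sub>M borel" using I_measurable times by auto
  show [measurable]: "incr s (s + h n) \<in> M \<rightarrow>\<^sub>M borel" using measurable_incr' times s by auto
  show [measurable]: "amp s \<in> borel_measurable M" "drift s \<in> M \<rightarrow>\<^sub>M borel"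
    unfolding amp_def[abs_def] drift_def[abs_def] by measurable
  show [measurable]: "offset \<in> M \<rightarrow>\<^sub>M borel" "step n \<in> M \<rightarrow>\<^sub>M borel" "noise n \<in> M \<rightarrow>\<^sub>M borel" "frozen n \<in> M \<rightarrow>\<^sub>M borel"
    unfolding offset_def[abs_def] step_def[abs_def] noise_def[abs_def] frozen_def[abs_def] by measurable
  show "drift_part n \<in> M \<rightarrow>\<^sub>M borel" "err n \<in> M \<rightarrow>\<^sub>M borel" unfolding drift_part_def[abs_def] err_def[abs_def] by measurable
  note [measurable] = bump'_measurable[OF R] bump''_measurable[OF R]
  show "slope \<in> borel_measurable M" "bend \<in> borel_measurable M" unfolding slope_def[abs_def] bend_def[abs_def] by measurable
qed

lemma step_measurable_F [measurable]:
  "offset \<in> F s \<rightarrow>\<^sub>M borel" "slope \<in> borel_measurable (F s)" "bend \<in> borel_measurable (F s)" "amp s \<in> borel_measurable (F s)"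
proof -
  have R: "0 < r\<^sup>2" using r by simp
  have [measurable]: "X s \<in> F s \<rightarrow>\<^sub>M borel" using X_measurable_F times by auto
  show [measurable]: "offset \<in> F s \<rightarrow>\<^sub>M borel" unfolding offset_def[abs_def] by measurable
  show "amp s \<in> borel_measurable (F s)" using amp_measurable_F times by auto
  note [measurable] = bump'_measurable[OF R] bump''_measurable[OF R]
  show "slope \<in> borel_measurable (F s)" "bend \<in> borel_measurable (F s)" unfolding slope_def[abs_def] bend_def[abs_def] by measurable
qed

definition oscillation :: "nat \<Rightarrow> 'a \<Rightarrow> ennreal" where
  "oscillation n \<omega> = (\<integral>\<^sup>+u. indicator {s<..s + h n} u * ennreal ((amp0 u \<omega> - amp s \<omega>)\<^sup>2) \<partial>lborel)"

lemma oscillation_measurable [measurable]: "oscillation n \<in> borel_measurable M"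
  unfolding oscillation_def[abs_def] by measurable

text \<open>
  Along almost every path \<open>amp\<close> is right continuous at \<open>s\<close>, so that the average of its squared
  oscillation over \<open>[s, s + h]\<close> tends to \<open>0\<close>; the averages are dominated.
\<close>

lemma oscillation_small:
  assumes \<epsilon>: "0 < \<epsilon>"
  shows "\<forall>\<^sub>F n in sequentially. (\<integral>\<^sup>+\<omega>. oscillation n \<omega> \<partial>M) \<le> ennreal (\<epsilon> * h n)"
proof -
  let ?c = "\<lambda>\<omega>. (\<sigma> * (X_sup \<omega> + m_sup))\<^sup>2"
  have "(\<lambda>n. \<integral>\<^sup>+\<omega>. ennreal (1 / h n) * oscillation n \<omega> \<partial>M) \<longlonglongrightarrow> (\<integral>\<^sup>+\<omega>. 0 \<partial>M)"
  proof (rule nn_integral_dominated_convergence[where w = "\<lambda>\<omega>. ennreal (?c \<omega>)"])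
    have "integrable M ?c" using X_sup_m_sup_integrable by (simp add: power_mult_distrib)
    then show "(\<integral>\<^sup>+\<omega>. ennreal (?c \<omega>) \<partial>M) < \<infinity>" unfolding integrable_iff_bounded by simp
    show "AE \<omega> in M. ennreal (1 / h n) * oscillation n \<omega> \<le> ennreal (?c \<omega>)" for n
      using amp_drift_bounds
    proof eventually_elim
      case (elim \<omega>)
      have "indicator {s<..s + h n} u * ennreal ((amp0 u \<omega> - amp s \<omega>)\<^sup>2) \<le> ennreal (?c \<omega>) * indicator {s<..s + h n} u" for u
      proof (cases "u \<in> {s<..s + h n}")
        case True
        then have u: "u \<in> {0..T}" using times(1) h(2)[of n] by auto
        have "\<bar>amp0 u \<omega> - amp s \<omega>\<bar> \<le> \<sigma> * (X_sup \<omega> + m_sup)"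
          using elim u times(1) unfolding amp0_eq[OF u] by (smt (verit))
        then have "(amp0 u \<omega> - amp s \<omega>)\<^sup>2 \<le> ?c \<omega>"
          using power_mono[of "\<bar>amp0 u \<omega> - amp s \<omega>\<bar>" "\<sigma> * (X_sup \<omega> + m_sup)" 2] by simp
        then show ?thesis using True by (simp add: ennreal_leI)
      qed simp
      then have "oscillation n \<omega> \<le> (\<integral>\<^sup>+u. ennreal (?c \<omega>) * indicator {s<..s + h n} u \<partial>lborel)"
        unfolding oscillation_def by (intro nn_integral_mono)
      also have "\<dots> = ennreal (?c \<omega>) * ennreal (h n)"
        using h(1)[of n] by (subst nn_integral_cmult_indicator) auto
      finally have "ennreal (1 / h n) * oscillation n \<omega> \<le> ennreal (1 / h n) * (ennreal (?c \<omega>) * ennreal (h n))"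
        by (rule mult_left_mono) simp
      also have "\<dots> = ennreal (?c \<omega>)" using h(1)[of n] by (simp flip: ennreal_mult)
      finally show ?case .
    qed
    show "AE \<omega> in M. (\<lambda>n. ennreal (1 / h n) * oscillation n \<omega>) \<longlonglongrightarrow> 0"
      using continuous_amp
    proof eventually_elim
      case (elim \<omega>)
      have "continuous_on {s..T} (\<lambda>u. amp u \<omega>)" using elim s by (auto intro: continuous_on_subset)
      then have "((\<lambda>u. amp u \<omega>) \<longlongrightarrow> amp s \<omega>) (at s within {s..T})" using s unfolding continuous_on_def by simp
      then have "((\<lambda>u. amp u \<omega>) \<longlongrightarrow> amp s \<omega>) (at_right s)" by (simp add: at_within_Icc_at_right s)
      then have "((\<lambda>u. (amp u \<omega> - amp s \<omega>)\<^sup>2) \<longlongrightarrow> (amp s \<omega> - amp s \<omega>)\<^sup>2) (at_right s)" by (intro tendsto_intros)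
      moreover have "\<forall>\<^sub>F u in at_right s. (amp u \<omega> - amp s \<omega>)\<^sup>2 = (amp0 u \<omega> - amp s \<omega>)\<^sup>2"
        using s by (auto simp: amp0_eq intro!: eventually_at_rightI[of _ T])
      ultimately have "((\<lambda>u. (amp0 u \<omega> - amp s \<omega>)\<^sup>2) \<longlongrightarrow> 0) (at_right s)"
        by (simp add: tendsto_cong)
      then show ?case unfolding oscillation_def by (rule average_tendsto_0[OF _ h(1,3)])
    qed
  qed auto
  then have "\<forall>\<^sub>F n in sequentially. (\<integral>\<^sup>+\<omega>. ennreal (1 / h n) * oscillation n \<omega> \<partial>M) < ennreal \<epsilon>"
    using \<epsilon> by (intro order_tendstoD(2)) auto
  then show ?thesis
  proof eventually_elim
    case (elim n)
    have "(\<integral>\<^sup>+\<omega>. oscillation n \<omega> \<partial>M) = ennreal (h n) * (ennreal (1 / h n) * (\<integral>\<^sup>+\<omega>. oscillation n \<omega> \<partial>M))"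
      using h(1)[of n] by (simp add: mult.assoc[symmetric] flip: ennreal_mult)
    also have "\<dots> \<le> ennreal (h n) * ennreal \<epsilon>"
      using elim by (intro mult_left_mono) (auto simp: nn_integral_cmult)
    also have "\<dots> = ennreal (\<epsilon> * h n)" using \<epsilon> h(1)[of n] by (simp add: ennreal_mult[symmetric] mult.commute)
    finally show ?case .
  qed
qed

lemma drift_part_bound: "AE \<omega> in M. norm (drift_part n \<omega>) \<le> lam * (X_sup \<omega> + m_sup) * h n"
  using increment_without_noise continuous_amp amp_drift_bounds
proof eventually_elim
  case (elim \<omega>)
  have "drift_part n \<omega> = (LINT u:{s..s + h n}|lborel. drift u \<omega>)"
    using elim(1) times(1) times(2,3)[of n] by (auto simp: drift_part_def step_def noise_def)
  moreover have "norm ((LINT u:{s..s + h n}|lborel. drift u \<omega>) - (s + h n - s) *\<^sub>R 0) \<le> lam * (X_sup \<omega> + m_sup) * (s + h n - s)"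
  proof (rule set_integral_near_constant)
    show "s < s + h n" using h(1) by simp
    have sub: "{s..s + h n} \<subseteq> {0..T}" using times(1) times(2)[of n] by auto
    then show "continuous_on {s..s + h n} (\<lambda>u. drift u \<omega>)" using elim(2) continuous_on_subset by blast
    fix u assume "s \<le> u" "u \<le> s + h n"
    then have "u \<in> {0..T}" using sub by auto
    then show "norm (drift u \<omega> - 0) \<le> lam * (X_sup \<omega> + m_sup)" using elim(3) by simp
  qed
  ultimately show ?case by simp
qed

lemma drift_part_average_limit: "AE \<omega> in M. (\<lambda>n. (1 / h n) *\<^sub>R drift_part n \<omega>) \<longlonglongrightarrow> drift s \<omega>"
  using increment_without_noise continuous_amp
proof eventually_elim
  case (elim \<omega>)
  show ?case
  proof (rule LIMSEQ_I)
    fix e :: real assume e: "0 < e"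
    have "\<exists>d>0. \<forall>u\<in>{0..T}. dist u s < d \<longrightarrow> dist (drift u \<omega>) (drift s \<omega>) < e / 2"
      using elim(2) times(1) e unfolding continuous_on_iff by (meson half_gt_zero)
    then obtain d where d: "d > 0" "\<And>u. u \<in> {0..T} \<Longrightarrow> dist u s < d \<Longrightarrow> dist (drift u \<omega>) (drift s \<omega>) < e / 2" by blast
    obtain n0 where "\<forall>n\<ge>n0. norm (h n - 0) < d" using LIMSEQ_D[OF h(3) d(1)] by blast
    then have n0: "h n < d" if "n \<ge> n0" for n using that by fastforce
    have "norm ((1 / h n) *\<^sub>R drift_part n \<omega> - drift s \<omega>) < e" if n: "n \<ge> n0" for n
    proof -
      have J: "drift_part n \<omega> = (LINT u:{s..s + h n}|lborel. drift u \<omega>)"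
        using elim(1) times(1) times(2,3)[of n] by (auto simp: drift_part_def step_def noise_def)
      have "norm ((LINT u:{s..s + h n}|lborel. drift u \<omega>) - (s + h n - s) *\<^sub>R drift s \<omega>) \<le> e / 2 * (s + h n - s)"
      proof (rule set_integral_near_constant)
        show "s < s + h n" using h(1) by simp
        show "continuous_on {s..s + h n} (\<lambda>u. drift u \<omega>)"
          using elim(2) times(1) times(2,3)[of n] by (auto intro: continuous_on_subset)
        fix u assume u: "s \<le> u" "u \<le> s + h n"
        have "u \<in> {0..T}" "dist u s < d" using u times(1) times(2,3)[of n] n0[OF n] by (auto simp: dist_real_def)
        from d(2)[OF this] show "norm (drift u \<omega> - drift s \<omega>) \<le> e / 2" by (simp add: dist_norm)
      qed
      then have le: "norm (drift_part n \<omega> - h n *\<^sub>R drift s \<omega>) \<le> e / 2 * h n" by (simp add: J)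
      have "(1 / h n) *\<^sub>R drift_part n \<omega> - drift s \<omega> = (1 / h n) *\<^sub>R (drift_part n \<omega> - h n *\<^sub>R drift s \<omega>)"
        using h(1)[of n] by (simp add: scaleR_diff_right)
      then have "norm ((1 / h n) *\<^sub>R drift_part n \<omega> - drift s \<omega>) = (1 / h n) * norm (drift_part n \<omega> - h n *\<^sub>R drift s \<omega>)"
        using h(1)[of n] by simp
      also have "\<dots> \<le> (1 / h n) * (e / 2 * h n)" using le h(1)[of n] by (intro mult_left_mono) auto
      also have "\<dots> < e" using h(1)[of n] e by simp
      finally show ?thesis .
    qed
    then show "\<exists>no. \<forall>n\<ge>no. norm ((1 / h n) *\<^sub>R drift_part n \<omega> - drift s \<omega>) < e" by blast
  qed
qed

text \<open>
  Both vectors lie in \<open>V\<close>, so that the norm is a sum over the finitely many coordinates in \<open>basis\<close>, to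
  each of which the scalar estimate applies.
\<close>

lemma freezing_error_coordinates:
  "AE \<omega> in M. (norm (noise n \<omega> - frozen n \<omega>))\<^sup>2 = (\<Sum>v\<in>basis. (noise n \<omega> \<bullet> v - amp s \<omega> * (incr s (s + h n) \<omega> \<bullet> P v))\<^sup>2)"
  using I_in_V
proof eventually_elim
  case (elim \<omega>)
  then have "P (I (s + h n) \<omega>) = I (s + h n) \<omega>" "P (I s \<omega>) = I s \<omega>" using times by (auto simp: V_iff)
  then have "P (noise n \<omega> - frozen n \<omega>) = noise n \<omega> - frozen n \<omega>"
    by (simp add: noise_def frozen_def blinfun.diff_right blinfun.scaleR_right P_idem)
  then have "(norm (noise n \<omega> - frozen n \<omega>))\<^sup>2 = (\<Sum>v\<in>basis. ((noise n \<omega> - frozen n \<omega>) \<bullet> v)\<^sup>2)"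
    using norm_P_square[of "noise n \<omega> - frozen n \<omega>"] by simp
  also have "\<dots> = (\<Sum>v\<in>basis. (noise n \<omega> \<bullet> v - amp s \<omega> * (incr s (s + h n) \<omega> \<bullet> P v))\<^sup>2)"
    by (simp add: inner_diff_left frozen_def P_sym)
  finally show ?case .
qed

lemma freezing_error_bound: "(\<integral>\<^sup>+\<omega>. ennreal ((norm (noise n \<omega> - frozen n \<omega>))\<^sup>2) \<partial>M) \<le> ennreal (4 * trace_V) * (\<integral>\<^sup>+\<omega>. oscillation n \<omega> \<partial>M)"
proof -
  let ?f = "\<lambda>v \<omega>. (noise n \<omega> \<bullet> v - amp s \<omega> * (incr s (s + h n) \<omega> \<bullet> P v))\<^sup>2"
  have "(\<integral>\<^sup>+\<omega>. ennreal ((norm (noise n \<omega> - frozen n \<omega>))\<^sup>2) \<partial>M) = (\<integral>\<^sup>+\<omega>. (\<Sum>v\<in>basis. ennreal (?f v \<omega>)) \<partial>M)"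
    using freezing_error_coordinates[of n] by (intro nn_integral_cong_AE) (auto simp: sum_nonneg)
  also have "\<dots> = (\<Sum>v\<in>basis. (\<integral>\<^sup>+\<omega>. ennreal (?f v \<omega>) \<partial>M))"
    by (rule nn_integral_sum) measurable
  also have "\<dots> \<le> (\<Sum>v\<in>basis. ennreal (4 * (Q v \<bullet> v)) * (\<integral>\<^sup>+\<omega>. oscillation n \<omega> \<partial>M))"
  proof (rule sum_mono)
    fix v assume v: "v \<in> basis"
    have q: "0 \<le> Q v \<bullet> v" by (rule Q_nonneg)
    have "(\<integral>\<^sup>+\<omega>. ennreal (?f v \<omega>) \<partial>M) \<le> 4 * (\<integral>\<^sup>+\<omega>. (\<integral>\<^sup>+u. indicator {s<..s + h n} u * ennreal ((amp0 u \<omega> - amp s \<omega>)\<^sup>2 * (Q (P v) \<bullet> P v)) \<partial>lborel) \<partial>M)"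
      unfolding noise_def using times(1) times(2,3)[of n] basis_norm[OF v] s by (intro noise_freezing_error) auto
    also have "\<dots> = 4 * (\<integral>\<^sup>+\<omega>. ennreal (Q v \<bullet> v) * oscillation n \<omega> \<partial>M)"
    proof -
      have "(\<integral>\<^sup>+u. indicator {s<..s + h n} u * ennreal ((amp0 u \<omega> - amp s \<omega>)\<^sup>2 * (Q (P v) \<bullet> P v)) \<partial>lborel)
        = ennreal (Q v \<bullet> v) * oscillation n \<omega>" if "\<omega> \<in> space M" for \<omega>
      proof -
        have [measurable]: "(\<lambda>u. amp0 u \<omega>) \<in> borel_measurable lborel"
          using measurable_compose_Pair1[OF that amp0_joint] by simp
        have "(\<integral>\<^sup>+u. indicator {s<..s + h n} u * ennreal ((amp0 u \<omega> - amp s \<omega>)\<^sup>2 * (Q (P v) \<bullet> P v)) \<partial>lborel)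
          = (\<integral>\<^sup>+u. ennreal (Q v \<bullet> v) * (indicator {s<..s + h n} u * ennreal ((amp0 u \<omega> - amp s \<omega>)\<^sup>2)) \<partial>lborel)"
          unfolding P_basis[OF v] using q by (intro nn_integral_cong) (simp add: ennreal_mult ac_simps)
        also have "\<dots> = ennreal (Q v \<bullet> v) * oscillation n \<omega>" unfolding oscillation_def by (rule nn_integral_cmult) measurable
        finally show ?thesis .
      qed
      then show ?thesis by (intro arg_cong[where f = "\<lambda>x. 4 * x"] nn_integral_cong)
    qed
    also have "\<dots> = ennreal (4 * (Q v \<bullet> v)) * (\<integral>\<^sup>+\<omega>. oscillation n \<omega> \<partial>M)"
      using q by (simp add: nn_integral_cmult ennreal_mult mult.assoc)
    finally show "(\<integral>\<^sup>+\<omega>. ennreal (?f v \<omega>) \<partial>M) \<le> ennreal (4 * (Q v \<bullet> v)) * (\<integral>\<^sup>+\<omega>. oscillation n \<omega> \<partial>M)" .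
  qed
  also have "\<dots> = ennreal (4 * trace_V) * (\<integral>\<^sup>+\<omega>. oscillation n \<omega> \<partial>M)"
    unfolding sum_distrib_right[symmetric] trace_V_def sum_distrib_left using Q_nonneg by (subst sum_ennreal) auto
  finally show ?thesis .
qed

text \<open>
  The drift contributes \<open>O (h\<^sup>2)\<close> to the mean square error, and freezing the noise contributes \<open>o h\<close>.
\<close>

lemma err_small:
  assumes \<epsilon>: "0 < \<epsilon>"
  shows "\<forall>\<^sub>F n in sequentially. integrable M (\<lambda>\<omega>. (norm (err n \<omega>))\<^sup>2) \<and> (\<integral>\<omega>. (norm (err n \<omega>))\<^sup>2 \<partial>M) \<le> \<epsilon> * h n"
proof -
  define c where "c = (\<integral>\<omega>. (lam * (X_sup \<omega> + m_sup))\<^sup>2 \<partial>M)"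
  have ci: "integrable M (\<lambda>\<omega>. (lam * (X_sup \<omega> + m_sup))\<^sup>2)" using X_sup_m_sup_integrable by (simp add: power_mult_distrib)
  have c0: "0 \<le> c" unfolding c_def by (intro integral_nonneg_AE) auto
  define \<delta> where "\<delta> = \<epsilon> / (16 * (trace_V + 1))"
  have \<delta>: "0 < \<delta>" using \<epsilon> trace_V_nonneg by (simp add: \<delta>_def)
  have "\<forall>\<^sub>F n in sequentially. h n < \<epsilon> / (4 * (c + 1))"
    using h(3) \<epsilon> c0 by (intro order_tendstoD(2)) auto
  then show ?thesis using oscillation_small[OF \<delta>]
  proof eventually_elim
    case (elim n)
    have hn: "0 < h n" by (rule h(1))
    have "AE \<omega> in M. (norm (err n \<omega>))\<^sup>2 \<le> 2 * (lam * (X_sup \<omega> + m_sup) * h n)\<^sup>2 + 2 * (norm (noise n \<omega> - frozen n \<omega>))\<^sup>2"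
      using drift_part_bound[of n]
    proof eventually_elim
      case (elim \<omega>)
      have "err n \<omega> = drift_part n \<omega> + (noise n \<omega> - frozen n \<omega>)" by (simp add: err_def drift_part_def)
      then have "(norm (err n \<omega>))\<^sup>2 \<le> (norm (drift_part n \<omega>) + norm (noise n \<omega> - frozen n \<omega>))\<^sup>2"
        by (simp add: norm_triangle_ineq power_mono)
      also have "\<dots> \<le> 2 * (norm (drift_part n \<omega>))\<^sup>2 + 2 * (norm (noise n \<omega> - frozen n \<omega>))\<^sup>2" by (rule square_add_le)
      also have "(norm (drift_part n \<omega>))\<^sup>2 \<le> (lam * (X_sup \<omega> + m_sup) * h n)\<^sup>2" using elim by (intro power_mono) auto
      finally show ?case by simp
    qed
    then have "(\<integral>\<^sup>+\<omega>. ennreal ((norm (err n \<omega>))\<^sup>2) \<partial>M)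
      \<le> (\<integral>\<^sup>+\<omega>. 2 * ennreal ((lam * (X_sup \<omega> + m_sup) * h n)\<^sup>2) + 2 * ennreal ((norm (noise n \<omega> - frozen n \<omega>))\<^sup>2) \<partial>M)"
      by (intro nn_integral_mono_AE) (auto elim!: eventually_mono intro!: ennreal_two_squares)
    also have "\<dots> = 2 * (\<integral>\<^sup>+\<omega>. ennreal ((lam * (X_sup \<omega> + m_sup) * h n)\<^sup>2) \<partial>M) + 2 * (\<integral>\<^sup>+\<omega>. ennreal ((norm (noise n \<omega> - frozen n \<omega>))\<^sup>2) \<partial>M)"
      by (subst nn_integral_add) (auto simp: nn_integral_cmult)
    also have "(\<integral>\<^sup>+\<omega>. ennreal ((lam * (X_sup \<omega> + m_sup) * h n)\<^sup>2) \<partial>M) = ennreal (c * (h n)\<^sup>2)"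
    proof -
      have "(\<integral>\<^sup>+\<omega>. ennreal ((lam * (X_sup \<omega> + m_sup) * h n)\<^sup>2) \<partial>M) = ennreal (\<integral>\<omega>. (lam * (X_sup \<omega> + m_sup) * h n)\<^sup>2 \<partial>M)"
        using ci by (intro nn_integral_eq_integral) (auto simp: power_mult_distrib)
      then show ?thesis by (simp add: c_def power_mult_distrib)
    qed
    also have "2 * ennreal (c * (h n)\<^sup>2) + 2 * (\<integral>\<^sup>+\<omega>. ennreal ((norm (noise n \<omega> - frozen n \<omega>))\<^sup>2) \<partial>M)
      \<le> 2 * ennreal (c * (h n)\<^sup>2) + 2 * (ennreal (4 * trace_V) * ennreal (\<delta> * h n))"
      using order_trans[OF freezing_error_bound mult_left_mono[OF elim(2), of "ennreal (4 * trace_V)"]]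
      by (intro add_left_mono mult_left_mono) auto
    also have "\<dots> = ennreal (2 * (c * (h n)\<^sup>2) + 2 * (4 * trace_V * (\<delta> * h n)))"
    proof -
      have "2 * ennreal x + 2 * (ennreal y * ennreal z) = ennreal (2 * x + 2 * (y * z))" if "0 \<le> x" "0 \<le> y" "0 \<le> z" for x y z
      proof -
        have "ennreal (2 * x + 2 * (y * z)) = ennreal 2 * ennreal x + ennreal 2 * (ennreal y * ennreal z)"
          using that by (subst ennreal_plus) (simp_all only: ennreal_mult mult_nonneg_nonneg zero_le_numeral)
        then show ?thesis by simp
      qed
      then show ?thesis using c0 trace_V_nonneg \<delta> hn by simp
    qed
    also have "\<dots> \<le> ennreal (\<epsilon> * h n)"
    proof (rule ennreal_leI)
      have "h n * (4 * (c + 1)) < \<epsilon>" using elim(1) c0 by (simp add: pos_less_divide_eq)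
      moreover have "c * h n \<le> (c + 1) * h n" using hn by (intro mult_right_mono) auto
      ultimately have "2 * (c * h n) \<le> \<epsilon> / 2" using hn by (simp add: algebra_simps)
      then have 1: "2 * (c * h n) * h n \<le> \<epsilon> / 2 * h n" using hn by (intro mult_right_mono) auto
      have "trace_V * \<delta> \<le> \<epsilon> / 16" unfolding \<delta>_def using trace_V_nonneg \<epsilon> by (intro mult_fraction_le) auto
      then have "8 * (trace_V * \<delta>) \<le> \<epsilon> / 2" by simp
      then have 2: "8 * (trace_V * \<delta>) * h n \<le> \<epsilon> / 2 * h n" using hn by (intro mult_right_mono) auto
      show "2 * (c * (h n)\<^sup>2) + 2 * (4 * trace_V * (\<delta> * h n)) \<le> \<epsilon> * h n"
        using 1 2 by (simp add: power2_eq_square mult.assoc)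
    qed
    finally have le: "(\<integral>\<^sup>+\<omega>. ennreal ((norm (err n \<omega>))\<^sup>2) \<partial>M) \<le> ennreal (\<epsilon> * h n)" .
    have int: "integrable M (\<lambda>\<omega>. (norm (err n \<omega>))\<^sup>2)"
      using le_less_trans[OF le ennreal_less_top] by (intro integrableI_bounded) auto
    moreover have "(\<integral>\<omega>. (norm (err n \<omega>))\<^sup>2 \<partial>M) \<le> \<epsilon> * h n"
      using le int \<epsilon> hn by (subst (asm) nn_integral_eq_integral) auto
    ultimately show ?case by simp
  qed
qed

text \<open>
  The generator of the equation applied to the mollifier, at \<open>X s\<close>.
\<close>

definition generator :: "'a \<Rightarrow> real" where
  "generator \<omega> = 2 * slope \<omega> * (offset \<omega> \<bullet> drift s \<omega>) + (amp s \<omega>)\<^sup>2 * (slope \<omega> * trace_V + 2 * bend \<omega> * (Q (P (offset \<omega>)) \<bullet> P (offset \<omega>)))"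

text \<open>
  The coefficient \<open>slope\<close> vanishes outside the ball, so that the unbounded vector \<open>offset\<close> does no harm.
\<close>

lemma slope_offset_bound: "\<bar>2 * slope \<omega> * (offset \<omega> \<bullet> v)\<bar> \<le> 4 * exp 1 / r * norm v"
proof -
  have "\<bar>slope \<omega> * (offset \<omega> \<bullet> v)\<bar> \<le> \<bar>slope \<omega>\<bar> * (norm (offset \<omega>) * norm v)"
    unfolding abs_mult by (intro mult_left_mono Cauchy_Schwarz_ineq2) auto
  also have "\<dots> = (\<bar>slope \<omega>\<bar> * norm (offset \<omega>)) * norm v" by simp
  also have "\<dots> \<le> 2 * exp 1 / r * norm v"
    using bump_coefficient_bounds(2)[OF r, of "offset \<omega>"] unfolding slope_def by (intro mult_right_mono) auto
  finally show ?thesis by (simp add: abs_mult)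
qed

lemma first_order_drift_integrable:
  "integrable M (\<lambda>\<omega>. 2 * slope \<omega> * (offset \<omega> \<bullet> drift_part n \<omega>))"
proof (rule Bochner_Integration.integrable_bound)
  let ?w = "\<lambda>\<omega>. 4 * exp 1 / r * (lam * (X_sup \<omega> + m_sup) * h n)"
  show "integrable M ?w" using X_sup_integrable by simp
  show "AE \<omega> in M. norm (2 * slope \<omega> * (offset \<omega> \<bullet> drift_part n \<omega>)) \<le> norm (?w \<omega>)"
    using drift_part_bound[of n]
  proof eventually_elim
    case (elim \<omega>)
    have "\<bar>2 * slope \<omega> * (offset \<omega> \<bullet> drift_part n \<omega>)\<bar> \<le> 4 * exp 1 / r * norm (drift_part n \<omega>)" by (rule slope_offset_bound)
    also have "\<dots> \<le> ?w \<omega>" using elim r by (intro mult_left_mono) auto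
    finally show ?case by (simp only: real_norm_def)
  qed
qed measurable

text \<open>
  In each coordinate the increment of the integral meets a bounded function of the past, to which it is
  orthogonal.
\<close>

lemma noise_first_order:
  "integrable M (\<lambda>\<omega>. 2 * slope \<omega> * (offset \<omega> \<bullet> noise n \<omega>))" "(\<integral>\<omega>. 2 * slope \<omega> * (offset \<omega> \<bullet> noise n \<omega>) \<partial>M) = 0"
proof -
  define \<eta> where "\<eta> v \<omega> = 2 * slope \<omega> * (offset \<omega> \<bullet> v)" for v \<omega>
  have \<eta>: "integrable M (\<lambda>\<omega>. \<eta> v \<omega> * (noise n \<omega> \<bullet> v))" "(\<integral>\<omega>. \<eta> v \<omega> * (noise n \<omega> \<bullet> v) \<partial>M) = 0" if v: "v \<in> basis" for v
  proof -
    have m: "\<eta> v \<in> borel_measurable (F s)" unfolding \<eta>_def[abs_def] by measurable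
    have b: "\<forall>\<omega>. \<bar>\<eta> v \<omega>\<bar> \<le> 4 * exp 1 / r" using slope_offset_bound[of _ v] basis_norm[OF v] unfolding \<eta>_def by simp
    have nv: "norm v \<le> 1" using basis_norm[OF v] by simp
    have t: "s + h n \<le> T" "s \<le> s + h n" using times(2,3)[of n] by auto
    show "integrable M (\<lambda>\<omega>. \<eta> v \<omega> * (noise n \<omega> \<bullet> v))" "(\<integral>\<omega>. \<eta> v \<omega> * (noise n \<omega> \<bullet> v) \<partial>M) = 0"
      unfolding noise_def using ito_integral_increment_mean_zero(2,3)[OF ito s(1) t(2,1) nv m b] by auto
  qed
  have eq: "AE \<omega> in M. 2 * slope \<omega> * (offset \<omega> \<bullet> noise n \<omega>) = (\<Sum>v\<in>basis. \<eta> v \<omega> * (noise n \<omega> \<bullet> v))"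
    using I_in_V
  proof eventually_elim
    case (elim \<omega>)
    then have "P (noise n \<omega>) = noise n \<omega>" using times by (simp add: noise_def blinfun.diff_right P_V)
    then have "offset \<omega> \<bullet> noise n \<omega> = offset \<omega> \<bullet> (\<Sum>v\<in>basis. (noise n \<omega> \<bullet> v) *\<^sub>R v)" using P_eq[of "noise n \<omega>"] by simp
    then show ?case by (simp add: inner_sum_right \<eta>_def sum_distrib_left ac_simps)
  qed
  have i: "integrable M (\<lambda>\<omega>. \<Sum>v\<in>basis. \<eta> v \<omega> * (noise n \<omega> \<bullet> v))" using \<eta> by simp
  have [measurable]: "\<eta> v \<in> borel_measurable M" for v unfolding \<eta>_def[abs_def] by measurable
  show "integrable M (\<lambda>\<omega>. 2 * slope \<omega> * (offset \<omega> \<bullet> noise n \<omega>))"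
    using i by (subst integrable_cong_AE[OF _ _ eq]) auto
  have "(\<integral>\<omega>. 2 * slope \<omega> * (offset \<omega> \<bullet> noise n \<omega>) \<partial>M) = (\<integral>\<omega>. (\<Sum>v\<in>basis. \<eta> v \<omega> * (noise n \<omega> \<bullet> v)) \<partial>M)"
    by (rule integral_cong_AE[OF _ _ eq]) auto
  also have "\<dots> = 0" using \<eta> by (simp add: Bochner_Integration.integral_sum)
  finally show "(\<integral>\<omega>. 2 * slope \<omega> * (offset \<omega> \<bullet> noise n \<omega>) \<partial>M) = 0" .
qed

lemma first_order_limit:
  "integrable M (\<lambda>\<omega>. 2 * slope \<omega> * (offset \<omega> \<bullet> drift s \<omega>))"
  "(\<lambda>n. (\<integral>\<omega>. 2 * slope \<omega> * (offset \<omega> \<bullet> drift_part n \<omega>) \<partial>M) / h n) \<longlonglongrightarrow> (\<integral>\<omega>. 2 * slope \<omega> * (offset \<omega> \<bullet> drift s \<omega>) \<partial>M)"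
proof -
  let ?w = "\<lambda>\<omega>. 4 * exp 1 / r * (lam * (X_sup \<omega> + m_sup))"
  have wi: "integrable M ?w" using X_sup_integrable by simp
  have lim: "AE \<omega> in M. (\<lambda>n. 2 * slope \<omega> * (offset \<omega> \<bullet> ((1 / h n) *\<^sub>R drift_part n \<omega>))) \<longlonglongrightarrow> 2 * slope \<omega> * (offset \<omega> \<bullet> drift s \<omega>)"
    using drift_part_average_limit by eventually_elim (intro tendsto_intros)
  have bd: "AE \<omega> in M. norm (2 * slope \<omega> * (offset \<omega> \<bullet> ((1 / h n) *\<^sub>R drift_part n \<omega>))) \<le> ?w \<omega>" for n
    using drift_part_bound[of n]
  proof eventually_elim
    case (elim \<omega>)
    have "\<bar>2 * slope \<omega> * (offset \<omega> \<bullet> ((1 / h n) *\<^sub>R drift_part n \<omega>))\<bar> \<le> 4 * exp 1 / r * norm ((1 / h n) *\<^sub>R drift_part n \<omega>)" by (rule slope_offset_bound)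
    also have "norm ((1 / h n) *\<^sub>R drift_part n \<omega>) \<le> lam * (X_sup \<omega> + m_sup)"
      using elim h(1)[of n] by (simp add: pos_divide_le_eq)
    then have "4 * exp 1 / r * norm ((1 / h n) *\<^sub>R drift_part n \<omega>) \<le> ?w \<omega>" using r by (intro mult_left_mono) auto
    finally show ?case by (simp only: real_norm_def)
  qed
  have "(\<lambda>n. \<integral>\<omega>. 2 * slope \<omega> * (offset \<omega> \<bullet> ((1 / h n) *\<^sub>R drift_part n \<omega>)) \<partial>M) \<longlonglongrightarrow> (\<integral>\<omega>. 2 * slope \<omega> * (offset \<omega> \<bullet> drift s \<omega>) \<partial>M)"
    by (rule integral_dominated_convergence[OF _ _ wi lim bd]) measurable
  then show "(\<lambda>n. (\<integral>\<omega>. 2 * slope \<omega> * (offset \<omega> \<bullet> drift_part n \<omega>) \<partial>M) / h n) \<longlonglongrightarrow> (\<integral>\<omega>. 2 * slope \<omega> * (offset \<omega> \<bullet> drift s \<omega>) \<partial>M)"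
    by simp
  show "integrable M (\<lambda>\<omega>. 2 * slope \<omega> * (offset \<omega> \<bullet> drift s \<omega>))"
    by (rule integrable_dominated_convergence[OF _ _ wi lim bd]) measurable
qed

definition amp_sq :: real where "amp_sq = (\<integral>\<omega>. (amp s \<omega>)\<^sup>2 \<partial>M)"

lemma amp_sq_nonneg: "0 \<le> amp_sq"
  unfolding amp_sq_def by (intro integral_nonneg_AE) auto

text \<open>
  Second and weighted fourth moment of the frozen noise, by independence. The fourth moment replaces
  uniform integrability of the squared increments divided by \<open>h\<close>.
\<close>

lemma frozen_moments:
  "integrable M (\<lambda>\<omega>. (norm (frozen n \<omega>))\<^sup>2)" "(\<integral>\<omega>. (norm (frozen n \<omega>))\<^sup>2 \<partial>M) = h n * (amp_sq * trace_V)"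
  "integrable M (\<lambda>\<omega>. (amp s \<omega>)\<^sup>2 * (norm (P (incr s (s + h n) \<omega>))) ^ 4)"
  "(\<integral>\<omega>. (amp s \<omega>)\<^sup>2 * (norm (P (incr s (s + h n) \<omega>))) ^ 4 \<partial>M) \<le> (h n)\<^sup>2 * (amp_sq * fourth_const)"
proof -
  have t: "0 \<le> s" "s \<le> s + h n" using times(1) times(3)[of n] by auto
  note mom = P_incr_moments[OF t]
  have a: "integrable M (\<lambda>\<omega>. (amp s \<omega>)\<^sup>2)" by (rule amp_square_integrable[OF times(1)])
  have eq: "(norm (frozen n \<omega>))\<^sup>2 = (amp s \<omega>)\<^sup>2 * (norm (P (incr s (s + h n) \<omega>)))\<^sup>2" for \<omega>
    by (simp add: frozen_def power_mult_distrib)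
  note f2 = integral_mult_incr_function[OF t, of "\<lambda>\<omega>. (amp s \<omega>)\<^sup>2" "\<lambda>w. (norm (P w))\<^sup>2", OF _ _ a mom(1)]
  note f4 = integral_mult_incr_function[OF t, of "\<lambda>\<omega>. (amp s \<omega>)\<^sup>2" "\<lambda>w. (norm (P w)) ^ 4", OF _ _ a mom(3)]
  show "integrable M (\<lambda>\<omega>. (norm (frozen n \<omega>))\<^sup>2)" unfolding eq by (rule f2(1)) measurable
  show "(\<integral>\<omega>. (norm (frozen n \<omega>))\<^sup>2 \<partial>M) = h n * (amp_sq * trace_V)"
    unfolding eq by (subst f2(2)) (auto simp: mom(2) amp_sq_def)
  show "integrable M (\<lambda>\<omega>. (amp s \<omega>)\<^sup>2 * (norm (P (incr s (s + h n) \<omega>))) ^ 4)" by (rule f4(1)) measurable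
  have "(\<integral>\<omega>. (amp s \<omega>)\<^sup>2 * (norm (P (incr s (s + h n) \<omega>))) ^ 4 \<partial>M) = amp_sq * (\<integral>\<omega>. (norm (P (incr s (s + h n) \<omega>))) ^ 4 \<partial>M)"
    by (subst f4(2)) (auto simp: amp_sq_def)
  also have "\<dots> \<le> amp_sq * ((h n)\<^sup>2 * fourth_const)" using mom(4) amp_sq_nonneg by (intro mult_left_mono) auto
  finally show "(\<integral>\<omega>. (amp s \<omega>)\<^sup>2 * (norm (P (incr s (s + h n) \<omega>))) ^ 4 \<partial>M) \<le> (h n)\<^sup>2 * (amp_sq * fourth_const)" by (simp add: ac_simps)
qed

lemma curv_eq: "curv r (offset \<omega>) z = slope \<omega> * (norm z)\<^sup>2 + 2 * bend \<omega> * (offset \<omega> \<bullet> z)\<^sup>2"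
  by (simp add: curv_def slope_def bend_def)

text \<open>
  Freezing the past leaves second moments of a Gaussian increment, which are linear in \<open>h\<close>. So the
  second-order part of the generator appears without an error term.
\<close>

lemma curv_frozen:
  "integrable M (\<lambda>\<omega>. curv r (offset \<omega>) (frozen n \<omega>))"
  "(\<integral>\<omega>. curv r (offset \<omega>) (frozen n \<omega>) \<partial>M) = h n * (\<integral>\<omega>. (amp s \<omega>)\<^sup>2 * (slope \<omega> * trace_V + 2 * bend \<omega> * (Q (P (offset \<omega>)) \<bullet> P (offset \<omega>))) \<partial>M)"
proof -
  have t: "0 \<le> s" "s \<le> s + h n" using times(1) times(3)[of n] by auto
  show i: "integrable M (\<lambda>\<omega>. curv r (offset \<omega>) (frozen n \<omega>))"
  proof (rule Bochner_Integration.integrable_bound)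
    show "integrable M (\<lambda>\<omega>. curv_const r * (norm (frozen n \<omega>))\<^sup>2)" using frozen_moments(1) by simp
    show "(\<lambda>\<omega>. curv r (offset \<omega>) (frozen n \<omega>)) \<in> borel_measurable M" unfolding curv_eq by measurable
    show "AE \<omega> in M. norm (curv r (offset \<omega>) (frozen n \<omega>)) \<le> norm (curv_const r * (norm (frozen n \<omega>))\<^sup>2)"
      using curv_bound[OF r] curv_const_nonneg[of r] by (intro AE_I2) (simp add: abs_mult)
  qed
  let ?g = "\<lambda>(\<omega>, w). slope \<omega> * (norm (amp s \<omega> *\<^sub>R P w))\<^sup>2 + 2 * bend \<omega> * (offset \<omega> \<bullet> (amp s \<omega> *\<^sub>R P w))\<^sup>2"
  have eq: "curv r (offset \<omega>) (frozen n \<omega>) = ?g (\<omega>, incr s (s + h n) \<omega>)" for \<omega>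
    by (simp add: curv_eq frozen_def)
  have "(\<integral>\<omega>. ?g (\<omega>, incr s (s + h n) \<omega>) \<partial>M) = (\<integral>\<omega>. (\<integral>\<omega>'. ?g (\<omega>, incr s (s + h n) \<omega>') \<partial>M) \<partial>M)"
    using i unfolding eq by (intro integral_freeze[OF t]) measurable
  also have "\<dots> = (\<integral>\<omega>. h n * ((amp s \<omega>)\<^sup>2 * (slope \<omega> * trace_V + 2 * bend \<omega> * (Q (P (offset \<omega>)) \<bullet> P (offset \<omega>)))) \<partial>M)"
  proof (rule Bochner_Integration.integral_cong[OF refl])
    fix \<omega>
    have "?g (\<omega>, w) = (slope \<omega> * (amp s \<omega>)\<^sup>2) * (norm (P w))\<^sup>2 + (2 * bend \<omega> * (amp s \<omega>)\<^sup>2) * (w \<bullet> P (offset \<omega>))\<^sup>2" for w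
    proof -
      have "offset \<omega> \<bullet> P w = w \<bullet> P (offset \<omega>)" by (metis P_sym inner_commute)
      then show ?thesis by (simp add: power_mult_distrib)
    qed
    then have "(\<integral>\<omega>'. ?g (\<omega>, incr s (s + h n) \<omega>') \<partial>M)
      = (slope \<omega> * (amp s \<omega>)\<^sup>2) * (h n * trace_V) + (2 * bend \<omega> * (amp s \<omega>)\<^sup>2) * (h n * (Q (P (offset \<omega>)) \<bullet> P (offset \<omega>)))"
      using P_incr_moments(1,2)[OF t] incr_moments(1,3)[OF t, of "P (offset \<omega>)"] by simp
    then show "(\<integral>\<omega>'. ?g (\<omega>, incr s (s + h n) \<omega>') \<partial>M)
      = h n * ((amp s \<omega>)\<^sup>2 * (slope \<omega> * trace_V + 2 * bend \<omega> * (Q (P (offset \<omega>)) \<bullet> P (offset \<omega>))))"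
      by (simp add: algebra_simps)
  qed
  finally show "(\<integral>\<omega>. curv r (offset \<omega>) (frozen n \<omega>) \<partial>M) = h n * (\<integral>\<omega>. (amp s \<omega>)\<^sup>2 * (slope \<omega> * trace_V + 2 * bend \<omega> * (Q (P (offset \<omega>)) \<bullet> P (offset \<omega>))) \<partial>M)"
    unfolding eq by simp
qed

lemma defect_ratio_frozen_integrable: "integrable M (\<lambda>\<omega>. defect_ratio r (offset \<omega>) (step n \<omega>) * (norm (frozen n \<omega>))\<^sup>2)"
proof -
  obtain C where C: "C \<ge> 0" "\<And>(y::'h) z. defect_ratio r y z \<le> C" using defect_ratio_bound[OF r] by blast
  have [measurable]: "(\<lambda>\<omega>. defect_ratio r (offset \<omega>) (step n \<omega>)) \<in> borel_measurable M"
    using r by (intro defect_ratio_measurable) measurable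
  have i: "integrable M (\<lambda>\<omega>. C * (norm (frozen n \<omega>))\<^sup>2)" using frozen_moments(1) by simp
  show ?thesis
  proof (rule Bochner_Integration.integrable_bound[OF i])
    have "norm (defect_ratio r (offset \<omega>) (step n \<omega>) * (norm (frozen n \<omega>))\<^sup>2) \<le> norm (C * (norm (frozen n \<omega>))\<^sup>2)" for \<omega>
      using C defect_ratio_nonneg[of r "offset \<omega>" "step n \<omega>"] by (auto simp: abs_mult intro!: mult_right_mono)
    then show "AE \<omega> in M. norm (defect_ratio r (offset \<omega>) (step n \<omega>) * (norm (frozen n \<omega>))\<^sup>2) \<le> norm (C * (norm (frozen n \<omega>))\<^sup>2)" by simp
  qed measurable
qed

text \<open>
  The ratio tends to \<open>0\<close> along each path, but \<open>\<parallel>frozen\<parallel>\<^sup>2 / h\<close> is not dominated. Young's inequality separates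
  the two: a small multiple of the fourth moment, which is \<open>O (h\<^sup>2)\<close>, and the square of the ratio, to
  which dominated convergence applies.
\<close>

lemma defect_ratio_frozen_small:
  assumes \<epsilon>: "0 < \<epsilon>"
  shows "\<forall>\<^sub>F n in sequentially. (\<integral>\<omega>. defect_ratio r (offset \<omega>) (step n \<omega>) * (norm (frozen n \<omega>))\<^sup>2 \<partial>M) \<le> \<epsilon> * h n"
proof -
  obtain C where C: "C \<ge> 0" "\<And>(y::'h) z. defect_ratio r y z \<le> C" using defect_ratio_bound[OF r] by blast
  have [measurable]: "(\<lambda>\<omega>. defect_ratio r (offset \<omega>) (step n \<omega>)) \<in> borel_measurable M" for n
    using r by (intro defect_ratio_measurable) measurable
  have a: "integrable M (\<lambda>\<omega>. (amp s \<omega>)\<^sup>2)" by (rule amp_square_integrable[OF times(1)])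
  define \<delta> where "\<delta> = \<epsilon> / (2 * (amp_sq * fourth_const + 1))"
  have Ac: "0 \<le> amp_sq * fourth_const" using amp_sq_nonneg fourth_const_nonneg by simp
  have \<delta>: "0 < \<delta>" using \<epsilon> Ac by (simp add: \<delta>_def)
  have Xlim: "AE \<omega> in M. (\<lambda>n. defect_ratio r (offset \<omega>) (step n \<omega>)) \<longlonglongrightarrow> 0"
    using X_cont
  proof eventually_elim
    case (elim \<omega>)
    have "(\<lambda>n. s + h n) \<longlonglongrightarrow> s + 0" by (intro tendsto_intros h(3))
    then have "(\<lambda>n. X (s + h n) \<omega>) \<longlonglongrightarrow> X s \<omega>"
      using elim times unfolding continuous_on_sequentially by (auto simp: o_def)
    then have "(\<lambda>n. step n \<omega>) \<longlonglongrightarrow> X s \<omega> - X s \<omega>" unfolding step_def by (intro tendsto_intros)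
    then show ?case by (intro defect_ratio_tendsto_0[OF r]) simp
  qed
  have r2: "(defect_ratio r y z)\<^sup>2 \<le> C\<^sup>2" for y z :: 'h using C defect_ratio_nonneg by (intro power_mono) auto
  have ia: "integrable M (\<lambda>\<omega>. (amp s \<omega>)\<^sup>2 * (defect_ratio r (offset \<omega>) (step n \<omega>))\<^sup>2)" for n
  proof (rule Bochner_Integration.integrable_bound)
    show "integrable M (\<lambda>\<omega>. (amp s \<omega>)\<^sup>2 * C\<^sup>2)" using a by simp
    show "AE \<omega> in M. norm ((amp s \<omega>)\<^sup>2 * (defect_ratio r (offset \<omega>) (step n \<omega>))\<^sup>2) \<le> norm ((amp s \<omega>)\<^sup>2 * C\<^sup>2)"
      using r2 by (intro AE_I2) (auto simp: abs_mult intro!: mult_left_mono)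
  qed measurable
  have "(\<lambda>n. \<integral>\<omega>. (amp s \<omega>)\<^sup>2 * (defect_ratio r (offset \<omega>) (step n \<omega>))\<^sup>2 \<partial>M) \<longlonglongrightarrow> (\<integral>\<omega>. (0::real) \<partial>M)"
  proof (rule integral_dominated_convergence[where w = "\<lambda>\<omega>. (amp s \<omega>)\<^sup>2 * C\<^sup>2"])
    show "integrable M (\<lambda>\<omega>. (amp s \<omega>)\<^sup>2 * C\<^sup>2)" using a by simp
    show "AE \<omega> in M. norm ((amp s \<omega>)\<^sup>2 * (defect_ratio r (offset \<omega>) (step n \<omega>))\<^sup>2) \<le> (amp s \<omega>)\<^sup>2 * C\<^sup>2" for n
      using r2 by (intro AE_I2) (auto simp: abs_mult intro!: mult_left_mono)
    show "AE \<omega> in M. (\<lambda>n. (amp s \<omega>)\<^sup>2 * (defect_ratio r (offset \<omega>) (step n \<omega>))\<^sup>2) \<longlonglongrightarrow> 0"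
      using Xlim
    proof eventually_elim
      case (elim \<omega>)
      then have "(\<lambda>n. (amp s \<omega>)\<^sup>2 * (defect_ratio r (offset \<omega>) (step n \<omega>))\<^sup>2) \<longlonglongrightarrow> (amp s \<omega>)\<^sup>2 * 0\<^sup>2" by (intro tendsto_intros)
      then show ?case by simp
    qed
  qed measurable
  then have "\<forall>\<^sub>F n in sequentially. (\<integral>\<omega>. (amp s \<omega>)\<^sup>2 * (defect_ratio r (offset \<omega>) (step n \<omega>))\<^sup>2 \<partial>M) < 2 * \<delta> * \<epsilon>"
    using \<delta> \<epsilon> by (intro order_tendstoD(2)) auto
  then show ?thesis
  proof eventually_elim
    case (elim n)
    have hn: "0 < h n" by (rule h(1))
    let ?p = "\<lambda>\<omega>. norm (P (incr s (s + h n) \<omega>))"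
    let ?\<rho> = "\<lambda>\<omega>. defect_ratio r (offset \<omega>) (step n \<omega>)"
    let ?w = "\<lambda>\<omega>. (\<delta> / h n) * ((amp s \<omega>)\<^sup>2 * (?p \<omega>) ^ 4) + (h n / (4 * \<delta>)) * ((amp s \<omega>)\<^sup>2 * (?\<rho> \<omega>)\<^sup>2)"
    have wi: "integrable M ?w" using frozen_moments(3)[of n] ia[of n] by simp
    have young: "?\<rho> \<omega> * (norm (frozen n \<omega>))\<^sup>2 \<le> ?w \<omega>" for \<omega>
    proof -
      have "?\<rho> \<omega> * (?p \<omega>)\<^sup>2 \<le> (\<delta> / h n) * ((?p \<omega>) ^ 4) + (h n / (4 * \<delta>)) * (?\<rho> \<omega>)\<^sup>2"
      proof -
        let ?a = "(?p \<omega>)\<^sup>2" and ?b = "?\<rho> \<omega>"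
        have "0 \<le> (2 * \<delta> * ?a - h n * ?b)\<^sup>2 / (4 * \<delta> * h n)" using \<delta> hn by simp
        also have "\<dots> = (\<delta> / h n) * ?a\<^sup>2 + (h n / (4 * \<delta>)) * ?b\<^sup>2 - ?b * ?a"
          using \<delta> hn by (simp add: power2_eq_square field_simps)
        finally show ?thesis by simp
      qed
      then have "(amp s \<omega>)\<^sup>2 * (?\<rho> \<omega> * (?p \<omega>)\<^sup>2) \<le> (amp s \<omega>)\<^sup>2 * ((\<delta> / h n) * ((?p \<omega>) ^ 4) + (h n / (4 * \<delta>)) * (?\<rho> \<omega>)\<^sup>2)"
        by (intro mult_left_mono) auto
      then show ?thesis by (simp add: frozen_def power_mult_distrib distrib_left ac_simps)
    qed
    have \<rho>i: "integrable M (\<lambda>\<omega>. ?\<rho> \<omega> * (norm (frozen n \<omega>))\<^sup>2)" by (rule defect_ratio_frozen_integrable)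
    have "(\<integral>\<omega>. ?\<rho> \<omega> * (norm (frozen n \<omega>))\<^sup>2 \<partial>M) \<le> (\<integral>\<omega>. ?w \<omega> \<partial>M)" by (rule integral_mono[OF \<rho>i wi young])
    also have "\<dots> = (\<delta> / h n) * (\<integral>\<omega>. (amp s \<omega>)\<^sup>2 * (?p \<omega>) ^ 4 \<partial>M) + (h n / (4 * \<delta>)) * (\<integral>\<omega>. (amp s \<omega>)\<^sup>2 * (?\<rho> \<omega>)\<^sup>2 \<partial>M)"
      using frozen_moments(3)[of n] ia[of n] by simp
    also have "\<dots> \<le> (\<delta> / h n) * ((h n)\<^sup>2 * (amp_sq * fourth_const)) + (h n / (4 * \<delta>)) * (2 * \<delta> * \<epsilon>)"
      using elim \<delta> hn by (intro add_mono mult_left_mono frozen_moments(4)) auto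
    also have "\<dots> = \<delta> * (amp_sq * fourth_const) * h n + \<epsilon> / 2 * h n"
      using \<delta> hn by (simp add: power2_eq_square field_simps)
    also have "\<dots> \<le> \<epsilon> / 2 * h n + \<epsilon> / 2 * h n"
    proof -
      have "amp_sq * fourth_const * \<delta> \<le> \<epsilon> / 2" unfolding \<delta>_def using Ac \<epsilon> by (intro mult_fraction_le) auto
      then have "\<delta> * (amp_sq * fourth_const) \<le> \<epsilon> / 2" by (simp add: mult.commute)
      then show ?thesis using hn by (intro add_right_mono mult_right_mono) auto
    qed
    finally show ?case by simp
  qed
qed

lemma offset_in_V: "AE \<omega> in M. offset \<omega> \<in> V"
  using X_in_V
proof eventually_elim
  case (elim \<omega>)
  then have "P (X s \<omega>) = X s \<omega>" using times(1) by (simp add: P_V)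
  then have "P (offset \<omega>) = offset \<omega>" by (simp add: offset_def blinfun.diff_right P_V[OF xstar])
  then show ?case by (simp add: V_iff)
qed

lemma second_order_integrable:
  "integrable M (\<lambda>\<omega>. (amp s \<omega>)\<^sup>2 * (slope \<omega> * trace_V + 2 * bend \<omega> * (Q (P (offset \<omega>)) \<bullet> P (offset \<omega>))))"
proof (rule Bochner_Integration.integrable_bound)
  let ?c = "2 * exp 1 / r\<^sup>2 * trace_V + 72 * exp 1 / r\<^sup>2 * norm Q"
  show "integrable M (\<lambda>\<omega>. (amp s \<omega>)\<^sup>2 * ?c)" using amp_square_integrable[OF times(1)] by simp
  show "AE \<omega> in M. norm ((amp s \<omega>)\<^sup>2 * (slope \<omega> * trace_V + 2 * bend \<omega> * (Q (P (offset \<omega>)) \<bullet> P (offset \<omega>)))) \<le> norm ((amp s \<omega>)\<^sup>2 * ?c)"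
    using offset_in_V
  proof eventually_elim
    case (elim \<omega>)
    have q: "\<bar>Q (offset \<omega>) \<bullet> offset \<omega>\<bar> \<le> norm Q * (norm (offset \<omega>))\<^sup>2"
    proof -
      have "\<bar>Q (offset \<omega>) \<bullet> offset \<omega>\<bar> \<le> norm (Q (offset \<omega>)) * norm (offset \<omega>)" by (rule Cauchy_Schwarz_ineq2)
      also have "\<dots> \<le> norm Q * norm (offset \<omega>) * norm (offset \<omega>)" by (intro mult_right_mono norm_blinfun) auto
      finally show ?thesis by (simp add: power2_eq_square mult.assoc)
    qed
    have 1: "\<bar>slope \<omega> * trace_V\<bar> \<le> 2 * exp 1 / r\<^sup>2 * trace_V"
      using bump_coefficient_bounds(1)[OF r, of "offset \<omega>"] trace_V_nonneg unfolding abs_mult slope_def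
      by (intro mult_mono) auto
    have "\<bar>bend \<omega>\<bar> * \<bar>Q (offset \<omega>) \<bullet> offset \<omega>\<bar> \<le> \<bar>bend \<omega>\<bar> * (norm Q * (norm (offset \<omega>))\<^sup>2)" by (intro mult_left_mono q) auto
    also have "\<dots> = norm Q * (\<bar>bend \<omega>\<bar> * (norm (offset \<omega>))\<^sup>2)" by simp
    also have "\<dots> \<le> norm Q * (36 * exp 1 / r\<^sup>2)"
      using bump_coefficient_bounds(3)[OF r, of "offset \<omega>"] unfolding bend_def by (intro mult_left_mono) auto
    finally have le36: "\<bar>bend \<omega>\<bar> * \<bar>Q (offset \<omega>) \<bullet> offset \<omega>\<bar> \<le> norm Q * (36 * exp 1 / r\<^sup>2)" .
    have 2: "\<bar>2 * bend \<omega> * (Q (offset \<omega>) \<bullet> offset \<omega>)\<bar> \<le> 72 * exp 1 / r\<^sup>2 * norm Q"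
    proof -
      have "\<bar>2 * bend \<omega> * (Q (offset \<omega>) \<bullet> offset \<omega>)\<bar> = 2 * (\<bar>bend \<omega>\<bar> * \<bar>Q (offset \<omega>) \<bullet> offset \<omega>\<bar>)" by (simp add: abs_mult)
      also have "\<dots> \<le> 2 * (norm Q * (36 * exp 1 / r\<^sup>2))" using le36 by simp
      finally show ?thesis by (simp add: mult.commute)
    qed
    have "\<bar>slope \<omega> * trace_V + 2 * bend \<omega> * (Q (P (offset \<omega>)) \<bullet> P (offset \<omega>))\<bar> \<le> ?c"
      using 1 2 unfolding P_V[OF elim] by linarith
    then have "(amp s \<omega>)\<^sup>2 * \<bar>slope \<omega> * trace_V + 2 * bend \<omega> * (Q (P (offset \<omega>)) \<bullet> P (offset \<omega>))\<bar> \<le> (amp s \<omega>)\<^sup>2 * \<bar>?c\<bar>"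
      by (intro mult_left_mono) auto
    then show ?case by (simp only: real_norm_def abs_mult power2_abs abs_power2)
  qed
qed measurable

lemma generator_integrable: "integrable M generator"
  and generator_integral: "(\<integral>\<omega>. generator \<omega> \<partial>M) = (\<integral>\<omega>. 2 * slope \<omega> * (offset \<omega> \<bullet> drift s \<omega>) \<partial>M)
    + (\<integral>\<omega>. (amp s \<omega>)\<^sup>2 * (slope \<omega> * trace_V + 2 * bend \<omega> * (Q (P (offset \<omega>)) \<bullet> P (offset \<omega>))) \<partial>M)"
  unfolding generator_def[abs_def] using first_order_limit(1) second_order_integrable by simp_all

lemma bump_X_integrable: "integrable M (\<lambda>\<omega>. bump (r\<^sup>2) ((norm (X t \<omega> - xstar))\<^sup>2))" if t: "t \<in> {0..T}"
proof -
  have R: "0 < r\<^sup>2" using r by simp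
  note [measurable] = bump_measurable[OF R] X_measurable[OF t]
  show ?thesis using bump_nonneg[of "r\<^sup>2"] bump_le_1[OF _ R]
    by (intro integrable_const_bound[where B = 1]) auto
qed

text \<open>
  The inequality in Dynkin's formula, for one short step. The expansion of the profile is integrated
  term by term; each of the four error terms is at most \<open>h \<epsilon> / 4\<close> for small \<open>h\<close>.
\<close>

theorem dynkin_lower_bound:
  assumes \<epsilon>: "0 < \<epsilon>"
  shows "\<forall>\<^sub>F n in sequentially. (\<integral>\<omega>. bump (r\<^sup>2) ((norm (X s \<omega> - xstar))\<^sup>2) \<partial>M) + h n * ((\<integral>\<omega>. generator \<omega> \<partial>M) - \<epsilon>)
    \<le> (\<integral>\<omega>. bump (r\<^sup>2) ((norm (X (s + h n) \<omega> - xstar))\<^sup>2) \<partial>M)"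
proof -
  obtain C where C: "C \<ge> 0" "\<And>(y::'h) z. defect_ratio r y z \<le> C" using defect_ratio_bound[OF r] by blast
  define K where "K = curv_const r"
  have K: "0 \<le> K" unfolding K_def by (rule curv_const_nonneg)
  \<comment> \<open>\<open>\<delta>\<close> makes the \<open>\<parallel>frozen\<parallel>\<^sup>2\<close> loss small; \<open>K2\<close> is the resulting, possibly large, factor of \<open>\<parallel>err\<parallel>\<^sup>2\<close>\<close>
  define \<delta> where "\<delta> = \<epsilon> / (4 * (K * (amp_sq * trace_V) + 1))"
  have KA: "0 \<le> K * (amp_sq * trace_V)" using K amp_sq_nonneg trace_V_nonneg by simp
  have \<delta>: "0 < \<delta>" using \<epsilon> KA by (simp add: \<delta>_def)
  define K2 where "K2 = K * (1 / \<delta> + 1) + 2 * C"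
  have K2: "0 \<le> K2" using K \<delta> C(1) by (simp add: K2_def)
  have \<epsilon>2: "0 < \<epsilon> / (4 * (K2 + 1))" and \<epsilon>8: "0 < \<epsilon> / 8" using \<epsilon> K2 by auto
  let ?G1 = "\<integral>\<omega>. 2 * slope \<omega> * (offset \<omega> \<bullet> drift s \<omega>) \<partial>M"
  let ?G2 = "\<integral>\<omega>. (amp s \<omega>)\<^sup>2 * (slope \<omega> * trace_V + 2 * bend \<omega> * (Q (P (offset \<omega>)) \<bullet> P (offset \<omega>))) \<partial>M"
  let ?J = "\<lambda>n. \<integral>\<omega>. 2 * slope \<omega> * (offset \<omega> \<bullet> drift_part n \<omega>) \<partial>M"
  have "\<forall>\<^sub>F n in sequentially. ?G1 - \<epsilon> / 4 < ?J n / h n"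
    using first_order_limit(2) \<epsilon> by (intro order_tendstoD(1)) auto
  then show ?thesis using err_small[OF \<epsilon>2] defect_ratio_frozen_small[OF \<epsilon>8]
  proof eventually_elim
    case (elim n)
    have hn: "0 < h n" by (rule h(1))
    let ?u0 = "\<lambda>\<omega>. bump (r\<^sup>2) ((norm (X s \<omega> - xstar))\<^sup>2)"
    let ?u1 = "\<lambda>\<omega>. bump (r\<^sup>2) ((norm (X (s + h n) \<omega> - xstar))\<^sup>2)"
    let ?\<rho> = "\<lambda>\<omega>. defect_ratio r (offset \<omega>) (step n \<omega>) * (norm (frozen n \<omega>))\<^sup>2"
    let ?L = "\<lambda>\<omega>. ?u0 \<omega> + 2 * slope \<omega> * (offset \<omega> \<bullet> drift_part n \<omega>) + 2 * slope \<omega> * (offset \<omega> \<bullet> noise n \<omega>) + curv r (offset \<omega>) (frozen n \<omega>)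
      - K * \<delta> * (norm (frozen n \<omega>))\<^sup>2 - K2 * (norm (err n \<omega>))\<^sup>2 - 2 * ?\<rho> \<omega>"
    have pt: "?L \<omega> \<le> ?u1 \<omega>" for \<omega>
    proof -
      have z: "frozen n \<omega> + err n \<omega> = step n \<omega>" "drift_part n \<omega> + noise n \<omega> = step n \<omega>" "offset \<omega> + step n \<omega> = X (s + h n) \<omega> - xstar"
        by (simp_all add: err_def drift_part_def offset_def step_def)
      have "2 * slope \<omega> * (offset \<omega> \<bullet> step n \<omega>) = 2 * slope \<omega> * (offset \<omega> \<bullet> drift_part n \<omega>) + 2 * slope \<omega> * (offset \<omega> \<bullet> noise n \<omega>)"
        unfolding z(2)[symmetric] by (simp add: inner_add_right distrib_left)
      moreover have "?u0 \<omega> + 2 * slope \<omega> * (offset \<omega> \<bullet> step n \<omega>) + curv r (offset \<omega>) (frozen n \<omega>)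
          - K * \<delta> * (norm (frozen n \<omega>))\<^sup>2 - K2 * (norm (err n \<omega>))\<^sup>2 - 2 * ?\<rho> \<omega> \<le> ?u1 \<omega>"
        using bump_increment_lower_bound[OF r \<delta> C(2), of "offset \<omega>" "frozen n \<omega>" "err n \<omega>"]
        unfolding z K_def K2_def slope_def by (simp add: offset_def)
      ultimately show ?thesis by linarith
    qed
    have i: "integrable M ?u0" "integrable M ?u1" "integrable M (\<lambda>\<omega>. 2 * slope \<omega> * (offset \<omega> \<bullet> drift_part n \<omega>))"
      "integrable M (\<lambda>\<omega>. 2 * slope \<omega> * (offset \<omega> \<bullet> noise n \<omega>))" "integrable M (\<lambda>\<omega>. curv r (offset \<omega>) (frozen n \<omega>))"
      "integrable M (\<lambda>\<omega>. K * \<delta> * (norm (frozen n \<omega>))\<^sup>2)" "integrable M (\<lambda>\<omega>. K2 * (norm (err n \<omega>))\<^sup>2)" "integrable M (\<lambda>\<omega>. 2 * ?\<rho> \<omega>)"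
      using bump_X_integrable times first_order_drift_integrable noise_first_order(1) curv_frozen(1) frozen_moments(1) elim(2) defect_ratio_frozen_integrable
      by auto
    have "(\<integral>\<omega>. ?u0 \<omega> \<partial>M) + ?J n + 0 + h n * ?G2 - K * \<delta> * (h n * (amp_sq * trace_V)) - K2 * (\<integral>\<omega>. (norm (err n \<omega>))\<^sup>2 \<partial>M) - 2 * (\<integral>\<omega>. ?\<rho> \<omega> \<partial>M)
      = (\<integral>\<omega>. ?L \<omega> \<partial>M)"
      using i by (simp only: Bochner_Integration.integral_add Bochner_Integration.integral_diff Bochner_Integration.integrable_add
          Bochner_Integration.integrable_diff noise_first_order(2) curv_frozen(2) integral_mult_right_zero frozen_moments(2))
    also have "\<dots> \<le> (\<integral>\<omega>. ?u1 \<omega> \<partial>M)"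
      using i pt by (intro integral_mono Bochner_Integration.integrable_add Bochner_Integration.integrable_diff) auto
    finally have main: "(\<integral>\<omega>. ?u0 \<omega> \<partial>M) + ?J n + 0 + h n * ?G2 - K * \<delta> * (h n * (amp_sq * trace_V)) - K2 * (\<integral>\<omega>. (norm (err n \<omega>))\<^sup>2 \<partial>M) - 2 * (\<integral>\<omega>. ?\<rho> \<omega> \<partial>M)
      \<le> (\<integral>\<omega>. ?u1 \<omega> \<partial>M)" .
    have 1: "h n * (?G1 - \<epsilon> / 4) \<le> ?J n" using elim(1) hn by (simp add: pos_less_divide_eq mult.commute)
    have 2: "K * \<delta> * (h n * (amp_sq * trace_V)) \<le> h n * (\<epsilon> / 4)"
    proof -
      have "K * (amp_sq * trace_V) * \<delta> \<le> \<epsilon> / 4" unfolding \<delta>_def using KA \<epsilon> by (intro mult_fraction_le) auto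
      then have "h n * (K * (amp_sq * trace_V) * \<delta>) \<le> h n * (\<epsilon> / 4)" using hn by (intro mult_left_mono) auto
      then show ?thesis by (simp add: ac_simps)
    qed
    have 3: "K2 * (\<integral>\<omega>. (norm (err n \<omega>))\<^sup>2 \<partial>M) \<le> h n * (\<epsilon> / 4)"
    proof -
      have "K2 * (\<integral>\<omega>. (norm (err n \<omega>))\<^sup>2 \<partial>M) \<le> K2 * (\<epsilon> / (4 * (K2 + 1)) * h n)"
        using elim(2) K2 by (intro mult_left_mono) auto
      also have "\<dots> = K2 * (\<epsilon> / (4 * (K2 + 1))) * h n" by simp
      also have "\<dots> \<le> \<epsilon> / 4 * h n" using hn K2 \<epsilon> by (intro mult_right_mono mult_fraction_le) auto
      finally show ?thesis by (simp add: mult.commute)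
    qed
    have 4: "2 * (\<integral>\<omega>. ?\<rho> \<omega> \<partial>M) \<le> h n * (\<epsilon> / 4)" using elim(3) by (simp add: mult.commute)
    have "h n * ((\<integral>\<omega>. generator \<omega> \<partial>M) - \<epsilon>) = h n * (?G1 - \<epsilon> / 4) + h n * ?G2 - h n * (\<epsilon> / 4) - h n * (\<epsilon> / 4) - h n * (\<epsilon> / 4)"
      unfolding generator_integral by (simp add: algebra_simps)
    then show ?case using main 1 2 3 4 by linarith
  qed
qed

text \<open>
  The constants in the pointwise inequality do not depend on \<open>s\<close>: inside the ball \<open>\<parallel>X s - m s\<parallel> \<le> r + B\<close>, and
  \<open>offset \<in> V\<close> gives the coercivity of \<open>Q\<close>. Outside both sides vanish.
\<close>

lemma generator_lower_bound:
  assumes p: "\<And>s n w \<kappa>. 0 \<le> s \<Longrightarrow> s < r\<^sup>2 \<Longrightarrow> 0 \<le> n \<Longrightarrow> n \<le> r + B \<Longrightarrow> \<bar>w\<bar> \<le> r * n \<Longrightarrow> lmin * s \<le> \<kappa> \<Longrightarrow> \<kappa> \<le> norm Q * r\<^sup>2 \<Longrightarrow>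
    - p * bump (r\<^sup>2) s \<le> - 2 * lam * bump' (r\<^sup>2) s * w + \<sigma>\<^sup>2 * n\<^sup>2 * (bump' (r\<^sup>2) s * trace_V + 2 * bump'' (r\<^sup>2) s * \<kappa>)"
  shows "- p * (\<integral>\<omega>. bump (r\<^sup>2) ((norm (X s \<omega> - xstar))\<^sup>2) \<partial>M) \<le> (\<integral>\<omega>. generator \<omega> \<partial>M)"
proof -
  have "AE \<omega> in M. - p * bump (r\<^sup>2) ((norm (X s \<omega> - xstar))\<^sup>2) \<le> generator \<omega>"
    using offset_in_V
  proof eventually_elim
    case (elim \<omega>)
    show ?case
    proof (cases "norm (offset \<omega>) < r")
      case True
      let ?n = "norm (X s \<omega> - m s)" and ?w = "offset \<omega> \<bullet> (X s \<omega> - m s)" and ?\<kappa> = "Q (offset \<omega>) \<bullet> offset \<omega>"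
      have y2: "(norm (offset \<omega>))\<^sup>2 < r\<^sup>2" using True by (intro power_strict_mono) auto
      have n: "?n \<le> r + B"
      proof -
        have "?n = norm (offset \<omega> + (xstar - m s))" by (simp add: offset_def)
        also have "\<dots> \<le> norm (offset \<omega>) + norm (xstar - m s)" by (rule norm_triangle_ineq)
        finally show ?thesis using True m_bound[OF times(1)] unfolding m_def by linarith
      qed
      have w: "\<bar>?w\<bar> \<le> r * ?n"
        using Cauchy_Schwarz_ineq2[of "offset \<omega>" "X s \<omega> - m s"] True
        by (meson less_imp_le mult_right_mono norm_ge_zero order_trans)
      have \<kappa>1: "lmin * (norm (offset \<omega>))\<^sup>2 \<le> ?\<kappa>" using lmin[OF elim] by (simp add: inner_commute)
      have \<kappa>2: "?\<kappa> \<le> norm Q * r\<^sup>2"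
      proof -
        have "?\<kappa> \<le> norm (Q (offset \<omega>)) * norm (offset \<omega>)" by (rule norm_cauchy_schwarz)
        also have "\<dots> \<le> norm Q * norm (offset \<omega>) * norm (offset \<omega>)" by (intro mult_right_mono norm_blinfun) auto
        also have "\<dots> = norm Q * (norm (offset \<omega>))\<^sup>2" by (simp add: power2_eq_square)
        also have "\<dots> \<le> norm Q * r\<^sup>2" using y2 by (intro mult_left_mono) auto
        finally show ?thesis .
      qed
      have "- p * bump (r\<^sup>2) ((norm (offset \<omega>))\<^sup>2) \<le> - 2 * lam * slope \<omega> * ?w + \<sigma>\<^sup>2 * ?n\<^sup>2 * (slope \<omega> * trace_V + 2 * bend \<omega> * ?\<kappa>)"
        unfolding slope_def bend_def by (rule p[OF _ y2 _ n w \<kappa>1 \<kappa>2]) auto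
      also have "\<dots> = generator \<omega>"
        unfolding generator_def P_V[OF elim] amp_def drift_def by (simp add: power_mult_distrib)
      finally show ?thesis by (simp add: offset_def)
    next
      case False
      then have "r\<^sup>2 \<le> (norm (offset \<omega>))\<^sup>2" using r by (intro power_mono) auto
      then have "\<not> (norm (offset \<omega>))\<^sup>2 < r\<^sup>2" by linarith
      then have "bump (r\<^sup>2) ((norm (offset \<omega>))\<^sup>2) = 0" "slope \<omega> = 0" "bend \<omega> = 0"
        unfolding slope_def bend_def bump_def bump'_def bump''_def by (simp_all only: if_False)
      then show ?thesis by (simp add: generator_def offset_def)
    qed
  qed
  then have "(\<integral>\<omega>. - p * bump (r\<^sup>2) ((norm (X s \<omega> - xstar))\<^sup>2) \<partial>M) \<le> (\<integral>\<omega>. generator \<omega> \<partial>M)"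
    using bump_X_integrable[OF times(1)] generator_integrable by (intro integral_mono_AE) auto
  then show ?thesis by simp
qed

end

section \<open>The mass of a ball around the minimizer\<close>

text \<open>
  The short step estimate, along arbitrary sequences \<open>h \<rightarrow> 0\<close>, bounds the Dini derivative of the
  expectation.
\<close>

theorem mollifier_expectation_decay:
  assumes r: "0 < r"
  shows "\<exists>p>0. \<forall>t\<in>{0..T}. (\<integral>\<omega>. mollifier xstar r (X 0 \<omega>) \<partial>M) * exp (- p * t) \<le> (\<integral>\<omega>. mollifier xstar r (X t \<omega>) \<partial>M)"
proof -
  obtain p where p: "p > 0" and generator: "\<And>s n w \<kappa>. 0 \<le> s \<Longrightarrow> s < r\<^sup>2 \<Longrightarrow> 0 \<le> n \<Longrightarrow> n \<le> r + B \<Longrightarrow> \<bar>w\<bar> \<le> r * n \<Longrightarrow>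
      lmin * s \<le> \<kappa> \<Longrightarrow> \<kappa> \<le> norm Q * r\<^sup>2 \<Longrightarrow>
      - p * bump (r\<^sup>2) s \<le> - 2 * lam * bump' (r\<^sup>2) s * w + \<sigma>\<^sup>2 * n\<^sup>2 * (bump' (r\<^sup>2) s * trace_V + 2 * bump'' (r\<^sup>2) s * \<kappa>)"
    using generator_bump_lower_bound[of lam \<sigma> r lmin "r + B" "norm Q * r\<^sup>2" trace_V] pos r trace_V_nonneg by auto
  define w where "w t = (\<integral>\<omega>. bump (r\<^sup>2) ((norm (X t \<omega> - xstar))\<^sup>2) \<partial>M)" for t
  have R: "0 < r\<^sup>2" using r by simp
  have "w 0 * exp (- p * t) \<le> w t" if t: "t \<in> {0..T}" for t
  proof (rule dini_exponential_lower_bound[of T])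
    show "0 \<le> w s" for s unfolding w_def using bump_nonneg by (intro integral_nonneg_AE) auto
    show "continuous_on {0..T} w"
      unfolding continuous_on_sequentially
    proof (intro ballI allI impI, elim conjE)
      fix t and s :: "nat \<Rightarrow> real"
      assume t: "t \<in> {0..T}" and s: "\<forall>n. s n \<in> {0..T}" "s \<longlonglongrightarrow> t"
      note [measurable] = bump_measurable[OF R]
      have [measurable]: "X t \<in> M \<rightarrow>\<^sub>M borel" "\<And>n. X (s n) \<in> M \<rightarrow>\<^sub>M borel" using X_measurable t s by auto
      have "(\<lambda>n. w (s n)) \<longlonglongrightarrow> w t" unfolding w_def
      proof (rule integral_dominated_convergence[where w = "\<lambda>_. 1"])
        show "AE \<omega> in M. (\<lambda>n. bump (r\<^sup>2) ((norm (X (s n) \<omega> - xstar))\<^sup>2)) \<longlonglongrightarrow> bump (r\<^sup>2) ((norm (X t \<omega> - xstar))\<^sup>2)"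
          using X_cont
        proof eventually_elim
          case (elim \<omega>)
          then have "(\<lambda>n. X (s n) \<omega>) \<longlonglongrightarrow> X t \<omega>"
            using s t unfolding continuous_on_sequentially by (auto simp: o_def)
          then have "(\<lambda>n. (norm (X (s n) \<omega> - xstar))\<^sup>2) \<longlonglongrightarrow> (norm (X t \<omega> - xstar))\<^sup>2" by (intro tendsto_intros)
          then show ?case by (rule isCont_tendsto_compose[OF continuous_bump[OF R]])
        qed
        show "AE \<omega> in M. norm (bump (r\<^sup>2) ((norm (X (s n) \<omega> - xstar))\<^sup>2)) \<le> 1" for n
          using bump_nonneg bump_le_1[OF _ R] by simp
      qed measurable
      then show "(w \<circ> s) \<longlonglongrightarrow> w t" by (simp add: o_def)
    qed
    show "0 \<le> p" using p by simp
    show "0 \<le> t" "t \<le> T" using t by auto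
    fix s \<epsilon> :: real assume s: "0 \<le> s" "s < T" and \<epsilon>: "0 < \<epsilon>"
    show "\<forall>\<^sub>F h in at_right 0. w s - h * (p * w s + \<epsilon>) \<le> w (s + h)"
    \<comment> \<open>dominated convergence works along sequences, which suffices\<close>
    proof (rule sequentially_imp_eventually_at_right[of 0 "T - s"])
      show "0 < T - s" using s by simp
      fix h :: "nat \<Rightarrow> real"
      assume h: "\<And>n. 0 < h n" "\<And>n. h n < T - s" "h \<longlonglongrightarrow> 0"
      have hT: "s + h n \<le> T" for n using h(2)[of n] by simp
      note ctx = r s h(1) hT h(3)
      have G: "- p * w s \<le> (\<integral>\<omega>. generator r s \<omega> \<partial>M)"
        unfolding w_def by (rule generator_lower_bound[OF ctx generator])
      show "\<forall>\<^sub>F n in sequentially. w s - h n * (p * w s + \<epsilon>) \<le> w (s + h n)"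
        using dynkin_lower_bound[OF ctx \<epsilon>]
      proof eventually_elim
        case (elim n)
        have "h n * (- p * w s - \<epsilon>) \<le> h n * ((\<integral>\<omega>. generator r s \<omega> \<partial>M) - \<epsilon>)"
          using G h(1)[of n] by (intro mult_left_mono) auto
        then have "w s - h n * (p * w s + \<epsilon>) \<le> w s + h n * ((\<integral>\<omega>. generator r s \<omega> \<partial>M) - \<epsilon>)"
          by (simp add: algebra_simps)
        then show ?case using elim unfolding w_def by linarith
      qed
    qed
  qed
  then show ?thesis using p unfolding w_def mollifier_eq_bump[OF r] by blast
qed

text \<open>
  At time \<open>0\<close> both integrals in the equation vanish.
\<close>

lemma X_zero: "AE \<omega> in M. X 0 \<omega> = \<xi> \<omega>"
  using X_eq I_zero
proof eventually_elim
  case (elim \<omega>)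
  have "AE u in lborel. u \<noteq> (0::real)" by (rule AE_lborel_singleton)
  then have "(LINT s:{0..0}|lborel. - lam *\<^sub>R (X s \<omega> - consensus_point \<E> \<alpha> (distr M borel (X s)))) = 0"
    unfolding set_lebesgue_integral_def by (intro integral_eq_zero_AE) (auto elim!: eventually_mono)
  moreover have "0 \<in> {0..T}" using pos by simp
  ultimately show ?case using elim by fastforce
qed

end

text \<open>
  The mollifier is at most the indicator of the ball, and positive inside, where the initial law has
  mass. The decay of its expectation is \<open>mollifier_expectation_decay\<close>.
\<close>

theorem lemma3p3:
  fixes M :: "'a measure"
    and F :: "real \<Rightarrow> 'a measure"
    and Q :: "'h::{real_inner, banach, polish_space} \<Rightarrow>\<^sub>L 'h"
    and W X :: "real \<Rightarrow> 'a \<Rightarrow> 'h"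
    and \<xi> :: "'a \<Rightarrow> 'h"
    and V :: "'h set"
    and \<E> :: "'h \<Rightarrow> real"
    and xstar :: 'h
    and \<alpha> lam \<sigma> r T B :: real
  assumes "infinite_dimensional TYPE('h)"
    and "covariance_operator Q"
    and "usual_filtered_prob_space M F"
    and "q_wiener_process M F Q W"
    and "\<xi> \<in> F 0 \<rightarrow>\<^sub>M borel" and "integrable M (\<lambda>\<omega>. (norm (\<xi> \<omega>))\<^sup>2)"
    and "continuous_on UNIV \<E>"
    and "\<alpha> > 0" and "lam > 0" and "\<sigma> > 0"
    and "active_subspace M V Q \<E> \<xi> xstar"
    and "\<And>U. open U \<Longrightarrow> xstar \<in> U \<Longrightarrow> measure (distr M borel \<xi>) U > 0"
    and "r > 0"
    and "T > 0"
    and "cbo_solution M F Q W V \<E> \<xi> \<alpha> lam \<sigma> T X"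
    and "B > 0"
    and "\<forall>t\<in>{0..T}. norm (xstar - consensus_point \<E> \<alpha> (distr M borel (X t))) \<le> B"
  shows "\<exists>p>0. \<forall>t\<in>{0..T}.
    measure (distr M borel (X t)) (ball xstar r) \<ge> (\<integral>\<omega>. mollifier xstar r (X t \<omega>) \<partial>M) \<and>
    (\<integral>\<omega>. mollifier xstar r (X t \<omega>) \<partial>M) \<ge> (\<integral>\<omega>. mollifier xstar r (X 0 \<omega>) \<partial>M) * exp (- p * t) \<and>
    (\<integral>\<omega>. mollifier xstar r (X 0 \<omega>) \<partial>M) * exp (- p * t) > 0"
proof -
  interpret prob_space M using assms(3) by (simp add: usual_filtered_prob_space_def)
  obtain C where C: "finite C" "V = span C"
    and act: "\<And>x. \<E> xstar \<le> \<E> x" "xstar \<in> V" "AE x in distr M borel \<xi>. x \<in> V"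
    and ex_lmin: "\<exists>lmin>0. \<forall>v\<in>V. v \<bullet> Q v \<ge> lmin * (norm v)\<^sup>2"
    using \<open>active_subspace M V Q \<E> \<xi> xstar\<close> unfolding active_subspace_def by blast
  obtain basis where basis: "finite basis" "orthonormal_set basis" "span basis = V"
    using finite_orthonormal_basis[OF C] .
  obtain lmin where lmin: "lmin > 0" "\<And>v. v \<in> V \<Longrightarrow> lmin * (norm v)\<^sup>2 \<le> v \<bullet> Q v"
    using ex_lmin by blast
  obtain I where X: "predictable F T X" "AE \<omega> in M. continuous_on {0..T} (\<lambda>t. X t \<omega>)"
    "(\<integral>\<^sup>+\<omega>. (SUP t\<in>{0..T}. ennreal ((norm (X t \<omega>))\<^sup>2)) \<partial>M) < \<infinity>"
    "ito_integral M F Q W T (\<lambda>t \<omega>. \<sigma> *\<^sub>R diffusion_op V (X t \<omega> - consensus_point \<E> \<alpha> (distr M borel (X t)))) I"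
    "AE \<omega> in M. \<forall>t\<in>{0..T}. X t \<omega> = \<xi> \<omega>
       + (LINT s:{0..t}|lborel. - lam *\<^sub>R (X s \<omega> - consensus_point \<E> \<alpha> (distr M borel (X s)))) + I t \<omega>"
    using \<open>cbo_solution M F Q W V \<E> \<xi> \<alpha> lam \<sigma> T X\<close> unfolding cbo_solution_def by blast
  interpret wiener_filtration M F Q W
    using assms(2-4) by unfold_locales
  have xi [measurable]: "\<xi> \<in> M \<rightarrow>\<^sub>M borel" using assms(5) by (rule measurable_F[rotated]) simp
  have xi_V: "AE \<omega> in M. \<xi> \<omega> \<in> V" using AE_distrD[OF xi act(3)] .
  interpret cbo_setting M F Q W X I \<xi> V \<E> xstar \<alpha> lam \<sigma> T B basis lmin
    by unfold_locales (use assms basis X xi_V lmin act in auto)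
  have R: "0 < r\<^sup>2" using \<open>r > 0\<close> by simp
  note [measurable] = bump_measurable[OF R]
  have moll_int: "integrable M (\<lambda>\<omega>. mollifier xstar r (X t \<omega>))" if t: "t \<in> {0..T}" for t
  proof -
    have [measurable]: "X t \<in> M \<rightarrow>\<^sub>M borel" by (rule X_measurable[OF t])
    show ?thesis unfolding mollifier_eq_bump[OF \<open>r > 0\<close>]
      using bump_nonneg[of "r\<^sup>2"] bump_le_1[OF _ R] by (intro integrable_const_bound[where B = 1]) auto
  qed
  have upper: "(\<integral>\<omega>. mollifier xstar r (X t \<omega>) \<partial>M) \<le> measure (distr M borel (X t)) (ball xstar r)"
    if t: "t \<in> {0..T}" for t
  proof -
    have [measurable]: "X t \<in> M \<rightarrow>\<^sub>M borel" by (rule X_measurable[OF t])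
    have "mollifier xstar r x \<le> indicator (ball xstar r) x" for x
      using bump_le_1[OF _ R, of "(norm (x - xstar))\<^sup>2"] mollifier_eq_bump[OF \<open>r > 0\<close>, of xstar x]
      by (auto simp: indicator_def dist_norm norm_minus_commute mollifier_def)
    moreover have "integrable M (\<lambda>\<omega>. indicat_real (ball xstar r) (X t \<omega>))"
    proof (rule integrable_const_bound[where B = 1])
      have "indicat_real (ball xstar r) \<in> borel_measurable borel" by (intro borel_measurable_indicator) simp
      then show "(\<lambda>\<omega>. indicat_real (ball xstar r) (X t \<omega>)) \<in> borel_measurable M"
        by (rule measurable_compose[rotated]) measurable
    qed (simp add: indicator_def)
    ultimately have "(\<integral>\<omega>. mollifier xstar r (X t \<omega>) \<partial>M) \<le> (\<integral>\<omega>. indicator (ball xstar r) (X t \<omega>) \<partial>M)"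
      by (intro integral_mono moll_int[OF t]) auto
    also have "\<dots> = (\<integral>\<omega>. indicator (X t -` ball xstar r \<inter> space M) \<omega> \<partial>M)"
      by (intro Bochner_Integration.integral_cong) (auto simp: indicator_def)
    also have "\<dots> = measure (distr M borel (X t)) (ball xstar r)"
      by (simp add: measure_distr)
    finally show ?thesis .
  qed
  have positive: "0 < (\<integral>\<omega>. mollifier xstar r (X 0 \<omega>) \<partial>M)"
  proof (rule ccontr)
    assume neg: "\<not> 0 < (\<integral>\<omega>. mollifier xstar r (X 0 \<omega>) \<partial>M)"
    have nonneg: "0 \<le> mollifier xstar r x" for x by (simp add: mollifier_def)
    have "0 \<le> (\<integral>\<omega>. mollifier xstar r (X 0 \<omega>) \<partial>M)" using nonneg by (intro integral_nonneg_AE) auto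
    then have "(\<integral>\<omega>. mollifier xstar r (X 0 \<omega>) \<partial>M) = 0" using neg by linarith
    then have "AE \<omega> in M. mollifier xstar r (X 0 \<omega>) = 0"
      using nonneg moll_int \<open>T > 0\<close> by (subst (asm) integral_nonneg_eq_0_iff_AE) auto
    then have "AE \<omega> in M. \<xi> \<omega> \<notin> ball xstar r"
      using X_zero
    proof eventually_elim
      case (elim \<omega>)
      then show ?case by (auto simp: mollifier_def dist_norm norm_minus_commute)
    qed
    then have "measure M (\<xi> -` ball xstar r \<inter> space M) = 0"
      by (subst prob_eq_0) (auto elim!: eventually_mono)
    moreover have "0 < measure (distr M borel \<xi>) (ball xstar r)"
      using \<open>r > 0\<close> by (intro assms(12)) auto
    ultimately show False by (simp add: measure_distr)
  qed
  obtain p where p: "p > 0" "\<And>t. t \<in> {0..T} \<Longrightarrow>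
      (\<integral>\<omega>. mollifier xstar r (X 0 \<omega>) \<partial>M) * exp (- p * t) \<le> (\<integral>\<omega>. mollifier xstar r (X t \<omega>) \<partial>M)"
    using mollifier_expectation_decay[OF \<open>r > 0\<close>] by blast
  show ?thesis
    using p upper positive by (intro exI[of _ p] conjI ballI mult_pos_pos exp_gt_zero) simp_all
qed

end
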